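(* Let $T>0$, $p\in[1,\infty)$ and let $b:[0,T]\times\mathbb{R}^d\times\mathcal{P}_p(\mathbb{R}^d)\to\mathbb{R}^d$ be a measurable function for which there is a constant $K_b$ such that $|b(t,x,\mu)-b(t,x',\mu')|^p\le K_b(|x-x'|^p+\mathcal{W}_{\mathbb{R}^d,p}(\mu,\mu')^p)$ for all $t\in[0,T]$, $x,x'\in\mathbb{R}^d$, $\mu,\mu'\in\mathcal{P}_p(\mathbb{R}^d)$. For each $N$ let $(\zeta^{(N)},W^{(N)})=(\zeta^{i,N},W^{i,N})_{1\le i\le N}\subset L^p(\mathbb{R}^d\times C_{T,0})$ be random variables and let $I:\mathcal{P}_p(\mathbb{R}^d\times C_{T,0})\to[0,+\infty]$ be a lower semicontinuous function. Assume that $L^N(\zeta^{(N)},W^{(N)})$ satisfies a large deviations principle with (good) rate function $I$. Let $X^{(N)}=(X^{i,N})_{i=1,\dots,N}$ be the solution to the interacting particle system $$dX^{i,N}_t=b(t,X^{i,N}_t,L^N(X^{(N)}_t))\,dt+dW^{i,N}_t,\qquad X^{i,N}_0=\zeta^{i,N},\qquad i=1,\dots,N.$$ Then the empirical law $L^N(X^{(N)})$ satisfies a large deviations principle (with the same speed) with (good) rate function $$J(\mu):=I(\Psi^{-1}(\mu))=I(f^\mu_\#\mu),\qquad\mu\in\mathcal{P}_p(C_T).$$ (Here "(good)" means: $J$ is good whenever $I$ is good.)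
   Context: $C_T:=C([0,T],\mathbb{R}^d)$ with the supremum norm $\|\cdot\|_\infty$; $C_{T,0}=\{\gamma\in C_T:\gamma_0=0\}$; $\mathbb{R}^d\times C_{T,0}$ has a product norm, e.g. $|x|+\|\gamma\|_\infty$. $\mathcal{P}_p(E)$ is the set of Borel probability measures with finite $p$-th moment, with the $p$-Wasserstein metric $\mathcal{W}_{E,p}$ (and the topology it induces). $L^p(\mathbb{R}^d\times C_{T,0})$ denotes random variables with values in $\mathbb{R}^d\times C_{T,0}$ with finite $p$-th moment. $L^N(y^{(N)}):=\frac1N\sum_{i=1}^N\delta_{y^i}$. The particle system is solved pathwise, in integrated form. For $\mu\in\mathcal{P}_p(C_T)$ with time marginals $\mu_t$, $S^\mu:\mathbb{R}^d\times C_{T,0}\to C_T$ maps $(x_0,\gamma)$ to the unique solution $x$ of $x_t=x_0+\int_0^t b(s,x_s,\mu_s)\,ds+\gamma_t$. $\Psi:\mathcal{P}_p(\mathbb{R}^d\times C_{T,0})\to\mathcal{P}_p(C_T)$ sends $\nu$ to the unique $\mu$ with $(S^\mu)_\#\nu=\mu$; it is a bijection with $\Psi^{-1}(\mu)=f^\mu_\#\mu$, where $$f^\mu:C_T\to\mathbb{R}^d\times C_{T,0},\qquad f^\mu(\gamma)=\Big(\gamma_0,\ \gamma_\cdot-\gamma_0-\int_0^\cdot b(s,\gamma_s,\mu_s)\,ds\Big).$$ Large deviations principle: let $E$ be a Polish space, $(a_N)$ positive reals with $a_N\to\infty$ (the speed), $I:E\to[0,\infty]$ lower semicontinuous. A sequence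 of $E$-valued random variables with laws $\mu^N$ satisfies a large deviations principle with rate function $I$ if for each Borel $A\subset E$, $-\inf_{A^\circ}I\le\liminf_N a_N^{-1}\log\mu^N(A)\le\limsup_N a_N^{-1}\log\mu^N(A)\le-\inf_{\bar A}I$. The rate function is good if its sublevel sets are compact. *)

theory Defs
  imports "HOL-Probability.Probability"
begin

section \<open>Borel measures and Wasserstein spaces over a metric space\<close>

definition borel_of :: "'a topology \<Rightarrow> 'a measure" where
  "borel_of X = sigma (topspace X) {U. openin X U}"

lemma space_borel_of [simp]: "space (borel_of X) = topspace X"
  by (simp add: borel_of_def space_measure_of_conv)

lemma borel_of_euclidean: "borel_of euclidean = borel"
  by (simp add: borel_of_def borel_def)

definition wasserstein_space :: "real \<Rightarrow> 'a metric \<Rightarrow> 'a measure set" where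
  "wasserstein_space p m =
     {\<mu>. prob_space \<mu> \<and> sets \<mu> = sets (borel_of (mtopology_of m)) \<and>
          (\<exists>x0\<in>mspace m. (\<integral>\<^sup>+x. ennreal (mdist m x0 x powr p) \<partial>\<mu>) < \<infinity>)}"

definition couplings :: "'a measure \<Rightarrow> 'b measure \<Rightarrow> ('a \<times> 'b) measure set" where
  "couplings \<mu> \<nu> =
     {\<pi>. sets \<pi> = sets (\<mu> \<Otimes>\<^sub>M \<nu>) \<and> distr \<pi> \<mu> fst = \<mu> \<and> distr \<pi> \<nu> snd = \<nu>}"

text \<open>The infimum is finite on \<open>wasserstein_space p m\<close>, so \<open>enn2real\<close> loses nothing there. For the
  separable spaces used below, the product \<open>\<sigma>\<close>-algebra in \<open>couplings\<close> is the Borel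
  \<open>\<sigma>\<close>-algebra of the product topology.\<close>

definition wasserstein_dist :: "real \<Rightarrow> 'a metric \<Rightarrow> 'a measure \<Rightarrow> 'a measure \<Rightarrow> real" where
  "wasserstein_dist p m \<mu> \<nu> =
     enn2real (INF \<pi>\<in>couplings \<mu> \<nu>. \<integral>\<^sup>+z. ennreal (mdist m (fst z) (snd z) powr p) \<partial>\<pi>)
       powr (1 / p)"

text \<open>The topology of the \<open>wasserstein_dist\<close>-balls, written out instead of via
  \<open>Metric_space.mtopology\<close> so that the next lemma does not depend on the metric axioms.\<close>

definition wasserstein_topology :: "real \<Rightarrow> 'a metric \<Rightarrow> 'a measure topology" where
  "wasserstein_topology p m = topology (\<lambda>U.
     U \<subseteq> wasserstein_space p m \<and>
     (\<forall>\<mu>\<in>U. \<exists>r>0. \<forall>\<nu>\<in>wasserstein_space p m. wasserstein_dist p m \<mu> \<nu> < r \<longrightarrow> \<nu> \<in> U))"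

lemma openin_wasserstein_topology:
  "openin (wasserstein_topology p m) U \<longleftrightarrow>
     U \<subseteq> wasserstein_space p m \<and>
     (\<forall>\<mu>\<in>U. \<exists>r>0. \<forall>\<nu>\<in>wasserstein_space p m. wasserstein_dist p m \<mu> \<nu> < r \<longrightarrow> \<nu> \<in> U)"
proof -
  let ?P = "\<lambda>U. U \<subseteq> wasserstein_space p m \<and>
     (\<forall>\<mu>\<in>U. \<exists>r>0. \<forall>\<nu>\<in>wasserstein_space p m. wasserstein_dist p m \<mu> \<nu> < r \<longrightarrow> \<nu> \<in> U)"
  have Int: "?P (S \<inter> T)" if S: "?P S" and T: "?P T" for S T
  proof (intro conjI ballI)
    show "S \<inter> T \<subseteq> wasserstein_space p m" using S by blast
    fix \<mu> assume "\<mu> \<in> S \<inter> T"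
    then obtain r s where "r > 0" "s > 0"
      "\<forall>\<nu>\<in>wasserstein_space p m. wasserstein_dist p m \<mu> \<nu> < r \<longrightarrow> \<nu> \<in> S"
      "\<forall>\<nu>\<in>wasserstein_space p m. wasserstein_dist p m \<mu> \<nu> < s \<longrightarrow> \<nu> \<in> T"
      using S T by blast
    then show "\<exists>r>0. \<forall>\<nu>\<in>wasserstein_space p m. wasserstein_dist p m \<mu> \<nu> < r \<longrightarrow> \<nu> \<in> S \<inter> T"
      by (intro exI[of _ "min r s"]) auto
  qed
  have Un: "?P (\<Union>K)" if K: "\<forall>U\<in>K. ?P U" for K
  proof (intro conjI ballI)
    show "\<Union>K \<subseteq> wasserstein_space p m" using K by blast
    fix \<mu> assume "\<mu> \<in> \<Union>K"
    then obtain U where U: "U \<in> K" "\<mu> \<in> U" by blast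
    then obtain r where "r > 0"
      "\<forall>\<nu>\<in>wasserstein_space p m. wasserstein_dist p m \<mu> \<nu> < r \<longrightarrow> \<nu> \<in> U"
      using K by blast
    with U show "\<exists>r>0. \<forall>\<nu>\<in>wasserstein_space p m. wasserstein_dist p m \<mu> \<nu> < r \<longrightarrow> \<nu> \<in> \<Union>K"
      by blast
  qed
  have "istopology ?P"
    unfolding istopology_def
    by (rule conjI; intro allI impI) (erule (1) Int, erule Un)
  then show ?thesis
    by (simp only: wasserstein_topology_def topology_inverse')
qed

lemma topspace_wasserstein_topology [simp]:
  "topspace (wasserstein_topology p m) = wasserstein_space p m"
proof
  show "topspace (wasserstein_topology p m) \<subseteq> wasserstein_space p m"
    using openin_topspace[of "wasserstein_topology p m"]
    by (rule openin_wasserstein_topology[THEN iffD1, THEN conjunct1])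
  have "openin (wasserstein_topology p m) (wasserstein_space p m)"
    unfolding openin_wasserstein_topology using zero_less_one by blast
  then show "wasserstein_space p m \<subseteq> topspace (wasserstein_topology p m)"
    by (rule openin_subset)
qed

definition random_variables_Lp ::
    "real \<Rightarrow> 'w measure \<Rightarrow> 'a metric \<Rightarrow> ('w \<Rightarrow> 'a) set" where
  "random_variables_Lp p M m =
     {Y \<in> M \<rightarrow>\<^sub>M borel_of (mtopology_of m).
        \<exists>x0\<in>mspace m. (\<integral>\<^sup>+\<omega>. ennreal (mdist m x0 (Y \<omega>) powr p) \<partial>M) < \<infinity>}"

definition empirical_measure :: "'a topology \<Rightarrow> nat \<Rightarrow> (nat \<Rightarrow> 'a) \<Rightarrow> 'a measure" where
  "empirical_measure X N y =
     measure_of (topspace X) (sets (borel_of X))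
       (\<lambda>A. (\<Sum>i=1..N. emeasure (return (borel_of X) (y i)) A) / of_nat N)"

lemma emeasure_empirical_measure:
  assumes "A \<in> sets (borel_of X)"
  shows "emeasure (empirical_measure X N y) A = (\<Sum>i=1..N. indicator A (y i)) / of_nat N"
proof -
  let ?f = "\<lambda>A. (\<Sum>i=1..N. emeasure (return (borel_of X) (y i)) A) / (of_nat N :: ennreal)"
  have "emeasure (empirical_measure X N y) A = ?f A"
    unfolding empirical_measure_def
  proof (rule emeasure_measure_of_sigma)
    show "sigma_algebra (topspace X) (sets (borel_of X))"
      using sets.sigma_algebra_axioms[of "borel_of X"] by simp
    show "positive (sets (borel_of X)) ?f"
      by (simp add: positive_def)
    show "countably_additive (sets (borel_of X)) ?f"
      unfolding countably_additive_def
      by (auto simp: divide_ennreal_def suminf_emeasure[symmetric]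
          simp flip: ennreal_suminf_multc suminf_sum)
  qed (fact assms)
  also have "\<dots> = (\<Sum>i=1..N. indicator A (y i)) / of_nat N"
    using assms by simp
  finally show ?thesis .
qed


section \<open>Large deviations principles\<close>

definition ereal_log :: "real \<Rightarrow> ereal" where
  "ereal_log x = (if x \<le> 0 then - \<infinity> else ereal (ln x))"

definition lower_semicontinuous_in :: "'e topology \<Rightarrow> ('e \<Rightarrow> ennreal) \<Rightarrow> bool" where
  "lower_semicontinuous_in E I \<longleftrightarrow> (\<forall>c. closedin E {x \<in> topspace E. I x \<le> c})"

definition good_rate_function :: "'e topology \<Rightarrow> ('e \<Rightarrow> ennreal) \<Rightarrow> bool" where
  "good_rate_function E I \<longleftrightarrow> (\<forall>c<\<infinity>. compactin E {x \<in> topspace E. I x \<le> c})"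

text \<open>Sequences are indexed by \<open>N \<ge> 1\<close>, and the \<open>N\<close>-th random variable \<open>Y N\<close> may live on its own
  probability space \<open>M N\<close>. Measurability of \<open>Y N\<close> and lower semicontinuity of \<open>I\<close> are part of the
  principle.\<close>

definition large_deviations_principle ::
    "'e topology \<Rightarrow> (nat \<Rightarrow> real) \<Rightarrow> (nat \<Rightarrow> 'w measure) \<Rightarrow> (nat \<Rightarrow> 'w \<Rightarrow> 'e) \<Rightarrow> ('e \<Rightarrow> ennreal) \<Rightarrow> bool"
  where
  "large_deviations_principle E a M Y I \<longleftrightarrow>
     (\<forall>N\<ge>1. a N > 0) \<and> filterlim a at_top sequentially \<and>
     (\<forall>N\<ge>1. Y N \<in> M N \<rightarrow>\<^sub>M borel_of E) \<and>
     lower_semicontinuous_in E I \<and>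
     (\<forall>A\<in>sets (borel_of E).
        - (INF x\<in>E interior_of A. enn2ereal (I x))
          \<le> liminf (\<lambda>N. ereal (1 / a N) * ereal_log (measure (distr (M N) (borel_of E) (Y N)) A)) \<and>
        limsup (\<lambda>N. ereal (1 / a N) * ereal_log (measure (distr (M N) (borel_of E) (Y N)) A))
          \<le> - (INF x\<in>E closure_of A. enn2ereal (I x)))"


section \<open>Path spaces\<close>

text \<open>Paths are functions on \<open>real\<close> that are \<open>undefined\<close> outside \<open>{0..T}\<close>, as required by \<open>cfunspace\<close>,
  whose metric is the supremum distance.\<close>

definition path_metric :: "real \<Rightarrow> (real \<Rightarrow> real ^ 'd) metric" where
  "path_metric T = cfunspace (top_of_set {0..T}) euclidean_metric"

definition path0_metric :: "real \<Rightarrow> (real \<Rightarrow> real ^ 'd) metric" where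
  "path0_metric T = submetric (path_metric T) {\<gamma>. \<gamma> 0 = 0}"

text \<open>\<open>prod_metric\<close> is the distance of the product norm \<open>sqrt (|x|\<^sup>2 + \<parallel>\<gamma>\<parallel>\<^sup>2)\<close>.\<close>

definition input_metric :: "real \<Rightarrow> ((real ^ 'd) \<times> (real \<Rightarrow> real ^ 'd)) metric" where
  "input_metric T = prod_metric euclidean_metric (path0_metric T)"

definition time_marginal :: "real \<Rightarrow> (real \<Rightarrow> real ^ 'd) measure \<Rightarrow> (real ^ 'd) measure" where
  "time_marginal t \<mu> = distr \<mu> borel (\<lambda>\<gamma>. \<gamma> t)"


section \<open>The integral equation and the maps it induces\<close>

text \<open>The Lebesgue integral of a non-integrable function is \<open>0\<close> by convention, so integrability of
  the drift along the solution is part of the notion of solution.\<close>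

definition solves_integral_equation ::
    "real \<Rightarrow> (real \<Rightarrow> real ^ 'd \<Rightarrow> real ^ 'd) \<Rightarrow> real ^ 'd \<Rightarrow> (real \<Rightarrow> real ^ 'd) \<Rightarrow>
      (real \<Rightarrow> real ^ 'd) \<Rightarrow> bool" where
  "solves_integral_equation T g x0 \<gamma> x \<longleftrightarrow>
     x \<in> mspace (path_metric T) \<and>
     set_integrable lborel {0..T} (\<lambda>s. g s (x s)) \<and>
     (\<forall>t\<in>{0..T}. x t = x0 + (LINT s:{0..t}|lborel. g s (x s)) + \<gamma> t)"

definition solution_map ::
    "real \<Rightarrow> (real \<Rightarrow> real ^ 'd \<Rightarrow> (real ^ 'd) measure \<Rightarrow> real ^ 'd) \<Rightarrow> (real \<Rightarrow> real ^ 'd) measure \<Rightarrow>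
      (real ^ 'd) \<times> (real \<Rightarrow> real ^ 'd) \<Rightarrow> (real \<Rightarrow> real ^ 'd)" where
  "solution_map T b \<mu> =
     (\<lambda>(x0, \<gamma>). THE x. solves_integral_equation T (\<lambda>s y. b s y (time_marginal s \<mu>)) x0 \<gamma> x)"

definition Psi ::
    "real \<Rightarrow> real \<Rightarrow> (real \<Rightarrow> real ^ 'd \<Rightarrow> (real ^ 'd) measure \<Rightarrow> real ^ 'd) \<Rightarrow>
      ((real ^ 'd) \<times> (real \<Rightarrow> real ^ 'd)) measure \<Rightarrow> (real \<Rightarrow> real ^ 'd) measure" where
  "Psi p T b \<nu> =
     (THE \<mu>. \<mu> \<in> wasserstein_space p (path_metric T) \<and>
        distr \<nu> (borel_of (mtopology_of (path_metric T))) (solution_map T b \<mu>) = \<mu>)"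

definition inverse_solution_map ::
    "real \<Rightarrow> (real \<Rightarrow> real ^ 'd \<Rightarrow> (real ^ 'd) measure \<Rightarrow> real ^ 'd) \<Rightarrow> (real \<Rightarrow> real ^ 'd) measure \<Rightarrow>
      (real \<Rightarrow> real ^ 'd) \<Rightarrow> (real ^ 'd) \<times> (real \<Rightarrow> real ^ 'd)" where
  "inverse_solution_map T b \<mu> \<gamma> =
     (\<gamma> 0, \<lambda>t\<in>{0..T}. \<gamma> t - \<gamma> 0 - (LINT s:{0..t}|lborel. b s (\<gamma> s) (time_marginal s \<mu>)))"

definition particle_system_solution ::
    "real \<Rightarrow> (real \<Rightarrow> real ^ 'd \<Rightarrow> (real ^ 'd) measure \<Rightarrow> real ^ 'd) \<Rightarrow> nat \<Rightarrow>
      (nat \<Rightarrow> real ^ 'd) \<Rightarrow> (nat \<Rightarrow> real \<Rightarrow> real ^ 'd) \<Rightarrow> (nat \<Rightarrow> real \<Rightarrow> real ^ 'd) \<Rightarrow> bool" where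
  "particle_system_solution T b N \<zeta> W X \<longleftrightarrow>
     (\<forall>i\<in>{1..N}. solves_integral_equation T
        (\<lambda>s y. b s y (empirical_measure euclidean N (\<lambda>j. X j s))) (\<zeta> i) (W i) (X i))"

end

theory Submission
  imports Defs
begin

text \<open>Push-forward of \<open>\<mu>\<close> under \<open>f\<^sup>\<mu>\<close> (\<open>input_law\<close> below) is bi-Lipschitz and onto for the
  Wasserstein distances, hence a homeomorphism with inverse \<open>\<Psi>\<close>, and the pathwise equations say
  that it sends the empirical law of the particles to that of the inputs. The large deviations
  principle is therefore carried over by \<open>\<Psi>\<close>.

  Both Lipschitz bounds are proved coupling by coupling, with path norms weighted by
  \<open>exp (- l t)\<close>. Surjectivity needs no completeness of the Wasserstein space: on the probability
  space given by the input law \<open>\<nu>\<close> itself, one solves the mean-field equation for all inputs \<open>z\<close>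
  at once, by Banach's theorem among continuous maps \<open>z \<mapsto> X z\<close> of at most linear growth. The
  drift is not assumed to be integrable in time; its integrability along one particle, which is part
  of the notion of solution, propagates to all paths and flows by the Lipschitz condition.\<close>

section \<open>Borel measures, Wasserstein distances and couplings\<close>

text \<open>\<open>Psi\<close> is given only implicitly, as a fixed point, whereas f^\<mu> is one
  explicit integration; so the estimates are made for f^\<mu> and the solution map, and reach
  \<open>Psi\<close> through uniqueness of the fixed point. The harder bound starts from a coupling
  of two inputs: the distance of the solutions depends on the distance of the two flows, which is
  itself being estimated. The rate 5 L gives the latter the coefficient 1/4; passing to p-th powers
  doubles it to 1/2, still small enough to absorb. In the existence proof the obstacle is that
  inputs, hence solutions, are unbounded. Paths are therefore divided by n(z) = 1 + distance of z
  from the zero input, and the p-th moment of n under \<nu> enters the rate of the exponential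
  weight. Wasserstein distances are handled in two ways only: a pair of random variables on one
  space bounds a distance from above, and a distance below e supplies a coupling of cost below e^p.
  Since the laws correspond at every outcome, measurability of the particles' empirical law is
  inherited from that of the inputs.\<close>

lemma sets_borel_of: "sets (borel_of X) = sigma_sets (topspace X) {U. openin X U}"
  unfolding borel_of_def by (subst sets_measure_of) (auto dest: openin_subset)

lemma continuous_map_measurable:
  assumes "continuous_map X Y f"
  shows "f \<in> borel_of X \<rightarrow>\<^sub>M borel_of Y"
proof (rule measurable_sigma_sets[OF sets_borel_of])
  show "{U. openin Y U} \<subseteq> Pow (topspace Y)"
    by (auto dest: openin_subset)
  show "f \<in> space (borel_of X) \<rightarrow> topspace Y"
    using assms by (simp add: continuous_map_def)
  fix U assume "U \<in> {U. openin Y U}"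
  then have "openin X {x\<in>topspace X. f x \<in> U}"
    using assms by (simp add: openin_continuous_map_preimage)
  moreover have "f -` U \<inter> space (borel_of X) = {x\<in>topspace X. f x \<in> U}"
    by auto
  ultimately show "f -` U \<inter> space (borel_of X) \<in> sets (borel_of X)"
    by (simp add: sets_borel_of)
qed

lemma continuous_map_euclidean_measurable:
  "continuous_map X euclidean f \<Longrightarrow> f \<in> borel_of X \<rightarrow>\<^sub>M borel"
  using continuous_map_measurable[of X euclidean f] by (simp add: borel_of_euclidean)

text \<open>The sum is at most twice the larger summand, so one of the two terms on the right
  already suffices. This is where most factors 2 in the moment estimates come from.\<close>

lemma powr_add_le:
  fixes a b p :: real
  assumes "a \<ge> 0" "b \<ge> 0" "p \<ge> 0"
  shows "(a + b) powr p \<le> (2 * a) powr p + (2 * b) powr p"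
proof -
  have "(a + b) powr p \<le> (2 * max a b) powr p"
    using assms by (intro powr_mono2) auto
  also have "\<dots> \<le> (2 * a) powr p + (2 * b) powr p"
    by (auto simp: max_def)
  finally show ?thesis .
qed

lemma mdist_powr_measurable [measurable]:
  assumes "x \<in> mspace m"
  shows "(\<lambda>y. ennreal (mdist m x y powr p)) \<in> borel_measurable (borel_of (mtopology_of m))"
  using continuous_map_euclidean_measurable[OF continuous_on_mdist[OF assms]] by measurable

lemma wasserstein_spaceD:
  assumes "\<mu> \<in> wasserstein_space p m"
  shows "prob_space \<mu>" "sets \<mu> = sets (borel_of (mtopology_of m))" "space \<mu> = mspace m"
  using assms sets_eq_imp_space_eq[of \<mu> "borel_of (mtopology_of m)"]
  by (auto simp: wasserstein_space_def)

text \<open>The moment condition of \<open>wasserstein_space\<close> names just some base point; the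
  triangle inequality frees it, at the price of a constant, which is integrable because
  \<open>P\<close> is finite.\<close>

lemma moment_finite_base_point:
  assumes x: "x \<in> mspace m" and y: "y \<in> mspace m" and p: "p \<ge> 0"
    and P: "finite_measure P" and Y: "Y \<in> P \<rightarrow>\<^sub>M borel_of (mtopology_of m)"
    and fin: "(\<integral>\<^sup>+\<omega>. ennreal (mdist m x (Y \<omega>) powr p) \<partial>P) < \<infinity>"
  shows "(\<integral>\<^sup>+\<omega>. ennreal (mdist m y (Y \<omega>) powr p) \<partial>P) < \<infinity>"
proof -
  interpret finite_measure P by fact
  have "(\<integral>\<^sup>+\<omega>. ennreal (mdist m y (Y \<omega>) powr p) \<partial>P) \<le>
    (\<integral>\<^sup>+\<omega>. ennreal ((2 * mdist m y x) powr p) + ennreal (2 powr p) * ennreal (mdist m x (Y \<omega>) powr p) \<partial>P)"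
  proof (rule nn_integral_mono)
    fix \<omega> assume "\<omega> \<in> space P"
    then have "Y \<omega> \<in> mspace m"
      using measurable_space[OF Y] by simp
    then have "mdist m y (Y \<omega>) powr p \<le> (mdist m y x + mdist m x (Y \<omega>)) powr p"
      using x y p by (intro powr_mono2 mdist_triangle) auto
    also have "\<dots> \<le> (2 * mdist m y x) powr p + (2 * mdist m x (Y \<omega>)) powr p"
      using p by (intro powr_add_le) auto
    finally show "ennreal (mdist m y (Y \<omega>) powr p) \<le> ennreal ((2 * mdist m y x) powr p) + ennreal (2 powr p) * ennreal (mdist m x (Y \<omega>) powr p)"
      by (simp add: powr_mult flip: ennreal_plus ennreal_mult)
  qed
  also have "\<dots> = ennreal ((2 * mdist m y x) powr p) * emeasure P (space P) + ennreal (2 powr p) * (\<integral>\<^sup>+\<omega>. ennreal (mdist m x (Y \<omega>) powr p) \<partial>P)"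
    using measurable_compose[OF Y mdist_powr_measurable[OF x]]
    by (simp add: nn_integral_add nn_integral_cmult)
  also have "\<dots> < \<infinity>"
    using fin by (auto simp: ennreal_mult_less_top emeasure_eq_measure)
  finally show ?thesis .
qed

lemma wasserstein_space_moment:
  assumes mu: "\<mu> \<in> wasserstein_space p m" and x: "x \<in> mspace m" and p: "p \<ge> 0"
  shows "(\<integral>\<^sup>+y. ennreal (mdist m x y powr p) \<partial>\<mu>) < \<infinity>"
proof -
  obtain x0 where x0: "x0 \<in> mspace m" "(\<integral>\<^sup>+y. ennreal (mdist m x0 y powr p) \<partial>\<mu>) < \<infinity>"
    using mu by (auto simp: wasserstein_space_def)
  have "finite_measure \<mu>"
    using wasserstein_spaceD(1)[OF mu] by (rule prob_space.finite_measure)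
  moreover have "(\<lambda>y. y) \<in> \<mu> \<rightarrow>\<^sub>M borel_of (mtopology_of m)"
    using wasserstein_spaceD(2)[OF mu] by simp
  ultimately show ?thesis
    using moment_finite_base_point[OF x0(1) x p _ _ x0(2)] by blast
qed

lemma distr_in_wasserstein_space:
  assumes P: "prob_space P" and Y: "Y \<in> P \<rightarrow>\<^sub>M borel_of (mtopology_of m)"
    and x: "x \<in> mspace m" and fin: "(\<integral>\<^sup>+\<omega>. ennreal (mdist m x (Y \<omega>) powr p) \<partial>P) < \<infinity>"
  shows "distr P (borel_of (mtopology_of m)) Y \<in> wasserstein_space p m"
  using x fin nn_integral_distr[OF Y, of "\<lambda>y. ennreal (mdist m x y powr p)"] mdist_powr_measurable[OF x]
  by (auto simp: wasserstein_space_def prob_space.prob_space_distr[OF P Y] intro!: bexI[of _ x])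

section \<open>Bounds on Wasserstein distances by couplings\<close>

lemma wasserstein_dist_nonneg: "wasserstein_dist p m \<mu> \<nu> \<ge> 0"
  by (simp add: wasserstein_dist_def)

text \<open>Since \<open>f\<close> is arbitrary, one inequality of the change of variables formula
  remains: every simple function below \<open>f\<close> pulls back to one below the composition with
  \<open>T\<close>. It applies to the cost on the product \<sigma>-algebra of a general metric
  space, where \<open>mdist\<close> may fail to be measurable.\<close>

lemma nn_integral_distr_le:
  assumes T: "T \<in> M \<rightarrow>\<^sub>M N"
  shows "(\<integral>\<^sup>+y. f y \<partial>distr M N T) \<le> (\<integral>\<^sup>+x. f (T x) \<partial>M)"
  unfolding nn_integral_def[of "distr M N T"]
proof (rule SUP_least)
  fix g assume "g \<in> {g. simple_function (distr M N T) g \<and> g \<le> f}"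
  then have g: "simple_function (distr M N T) g" "g \<le> f" by auto
  have "integral\<^sup>S (distr M N T) g = (\<integral>\<^sup>+x. g (T x) \<partial>M)"
    using nn_integral_distr[OF T borel_measurable_simple_function[OF g(1)]] nn_integral_eq_simple_integral[OF g(1)]
    by simp
  also have "\<dots> \<le> (\<integral>\<^sup>+x. f (T x) \<partial>M)"
    using g(2) by (intro nn_integral_mono) (auto simp: le_fun_def)
  finally show "integral\<^sup>S (distr M N T) g \<le> (\<integral>\<^sup>+x. f (T x) \<partial>M)" .
qed

text \<open>The joint law of \<open>Y\<close> and \<open>Y'\<close> is a coupling of the two image
  measures. Every upper bound on a Wasserstein distance below goes back to this.\<close>

lemma wasserstein_dist_distr_le:
  assumes Y: "Y \<in> P \<rightarrow>\<^sub>M borel_of (mtopology_of m)" and Y': "Y' \<in> P \<rightarrow>\<^sub>M borel_of (mtopology_of m)"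
    and p: "p > 0" and K: "K \<ge> 0"
    and le: "(\<integral>\<^sup>+\<omega>. ennreal (mdist m (Y \<omega>) (Y' \<omega>) powr p) \<partial>P) \<le> ennreal (K powr p)"
  shows "wasserstein_dist p m (distr P (borel_of (mtopology_of m)) Y) (distr P (borel_of (mtopology_of m)) Y') \<le> K"
proof -
  let ?B = "borel_of (mtopology_of m)"
  let ?\<mu> = "distr P ?B Y" and ?\<nu> = "distr P ?B Y'" and ?\<pi> = "distr P (?B \<Otimes>\<^sub>M ?B) (\<lambda>\<omega>. (Y \<omega>, Y' \<omega>))"
  let ?c = "\<lambda>\<pi>. \<integral>\<^sup>+z. ennreal (mdist m (fst z) (snd z) powr p) \<partial>\<pi>"
  have pair: "(\<lambda>\<omega>. (Y \<omega>, Y' \<omega>)) \<in> P \<rightarrow>\<^sub>M ?B \<Otimes>\<^sub>M ?B"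
    using Y Y' by simp
  have sets: "sets (?\<mu> \<Otimes>\<^sub>M ?\<nu>) = sets (?B \<Otimes>\<^sub>M ?B)"
    by (intro sets_pair_measure_cong) auto
  have "distr ?\<pi> ?\<mu> fst = distr ?\<pi> ?B fst" "distr ?\<pi> ?\<nu> snd = distr ?\<pi> ?B snd"
    by (auto intro: distr_cong)
  then have "?\<pi> \<in> couplings ?\<mu> ?\<nu>"
    using pair sets by (simp add: couplings_def distr_distr comp_def)
  then have "(INF \<pi>\<in>couplings ?\<mu> ?\<nu>. ?c \<pi>) \<le> ?c ?\<pi>"
    by (rule INF_lower)
  also have "\<dots> \<le> ennreal (K powr p)"
    using nn_integral_distr_le[OF pair, of "\<lambda>z. ennreal (mdist m (fst z) (snd z) powr p)"] le
    by simp
  finally have "enn2real (INF \<pi>\<in>couplings ?\<mu> ?\<nu>. ?c \<pi>) \<le> K powr p"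
    by (simp add: enn2real_leI)
  then have "wasserstein_dist p m ?\<mu> ?\<nu> \<le> (K powr p) powr (1 / p)"
    unfolding wasserstein_dist_def using p by (intro powr_mono2) auto
  also have "\<dots> = K"
    using p K by (simp add: powr_powr)
  finally show ?thesis .
qed

text \<open>The independent coupling has finite cost. This matters because \<open>enn2real\<close>
  would turn an infinite infimum into 0, and a small distance would then say nothing about
  couplings.\<close>

lemma wasserstein_couplings_finite:
  assumes mu: "\<mu> \<in> wasserstein_space p m" and nu: "\<nu> \<in> wasserstein_space p m" and p: "p \<ge> 0"
  shows "\<exists>\<pi>\<in>couplings \<mu> \<nu>. (\<integral>\<^sup>+z. ennreal (mdist m (fst z) (snd z) powr p) \<partial>\<pi>) < \<infinity>"
proof -
  interpret mu: prob_space \<mu> by (rule wasserstein_spaceD[OF mu])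
  interpret nu: prob_space \<nu> by (rule wasserstein_spaceD[OF nu])
  interpret pair_prob_space \<mu> \<nu> ..
  have fst: "distr (\<mu> \<Otimes>\<^sub>M \<nu>) \<mu> fst = \<mu>"
    by (rule nu.distr_pair_fst)
  have snd: "distr (\<mu> \<Otimes>\<^sub>M \<nu>) \<nu> snd = \<nu>"
  proof -
    have "\<nu> = distr (\<nu> \<Otimes>\<^sub>M \<mu>) \<nu> fst"
      by (simp add: mu.distr_pair_fst)
    also have "\<dots> = distr (distr (\<mu> \<Otimes>\<^sub>M \<nu>) (\<nu> \<Otimes>\<^sub>M \<mu>) (\<lambda>(x, y). (y, x))) \<nu> fst"
      by (subst pair_sigma_finite.distr_pair_swap)
        (auto intro: pair_sigma_finite.intro mu.sigma_finite_measure_axioms nu.sigma_finite_measure_axioms)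
    also have "\<dots> = distr (\<mu> \<Otimes>\<^sub>M \<nu>) \<nu> snd"
      by (subst distr_distr) (auto simp: comp_def case_prod_unfold)
    finally show ?thesis by simp
  qed
  obtain x where x: "x \<in> mspace m"
    using mu by (auto simp: wasserstein_space_def)
  have mx: "(\<lambda>y. ennreal (mdist m x y powr p)) \<in> borel_measurable \<mu>"
       "(\<lambda>y. ennreal (mdist m x y powr p)) \<in> borel_measurable \<nu>"
    using mdist_powr_measurable[OF x] wasserstein_spaceD(2)[OF mu] wasserstein_spaceD(2)[OF nu]
    by (simp_all cong: measurable_cong_sets)
  have i1: "(\<integral>\<^sup>+z. ennreal (mdist m x (fst z) powr p) \<partial>(\<mu> \<Otimes>\<^sub>M \<nu>)) = (\<integral>\<^sup>+y. ennreal (mdist m x y powr p) \<partial>\<mu>)"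
    using nn_integral_distr[of fst "\<mu> \<Otimes>\<^sub>M \<nu>" \<mu> "\<lambda>y. ennreal (mdist m x y powr p)"] mx(1) by (simp add: fst)
  have i2: "(\<integral>\<^sup>+z. ennreal (mdist m x (snd z) powr p) \<partial>(\<mu> \<Otimes>\<^sub>M \<nu>)) = (\<integral>\<^sup>+y. ennreal (mdist m x y powr p) \<partial>\<nu>)"
    using nn_integral_distr[of snd "\<mu> \<Otimes>\<^sub>M \<nu>" \<nu> "\<lambda>y. ennreal (mdist m x y powr p)"] mx(2) by (simp add: snd)
  have "(\<integral>\<^sup>+z. ennreal (mdist m (fst z) (snd z) powr p) \<partial>(\<mu> \<Otimes>\<^sub>M \<nu>)) \<le>
     (\<integral>\<^sup>+z. ennreal (2 powr p) * ennreal (mdist m x (fst z) powr p) + ennreal (2 powr p) * ennreal (mdist m x (snd z) powr p) \<partial>(\<mu> \<Otimes>\<^sub>M \<nu>))"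
  proof (rule nn_integral_mono)
    fix z assume "z \<in> space (\<mu> \<Otimes>\<^sub>M \<nu>)"
    then have z: "fst z \<in> mspace m" "snd z \<in> mspace m"
      using wasserstein_spaceD(3)[OF mu] wasserstein_spaceD(3)[OF nu] by (auto simp: space_pair_measure)
    have "mdist m (fst z) (snd z) \<le> mdist m x (fst z) + mdist m x (snd z)"
      using mdist_triangle[OF z(1) x z(2)] by (simp add: mdist_commute)
    then have "mdist m (fst z) (snd z) powr p \<le> (mdist m x (fst z) + mdist m x (snd z)) powr p"
      using p by (intro powr_mono2) auto
    also have "\<dots> \<le> (2 * mdist m x (fst z)) powr p + (2 * mdist m x (snd z)) powr p"
      using p by (intro powr_add_le) auto
    finally show "ennreal (mdist m (fst z) (snd z) powr p) \<le>
        ennreal (2 powr p) * ennreal (mdist m x (fst z) powr p) + ennreal (2 powr p) * ennreal (mdist m x (snd z) powr p)"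
      by (simp add: powr_mult flip: ennreal_plus ennreal_mult)
  qed
  also have "\<dots> = ennreal (2 powr p) * (\<integral>\<^sup>+y. ennreal (mdist m x y powr p) \<partial>\<mu>) + ennreal (2 powr p) * (\<integral>\<^sup>+y. ennreal (mdist m x y powr p) \<partial>\<nu>)"
    using measurable_compose[OF measurable_fst mx(1), of \<nu>] measurable_compose[OF measurable_snd mx(2), of \<mu>]
    by (simp add: nn_integral_add nn_integral_cmult i1 i2)
  also have "\<dots> < \<infinity>"
    using wasserstein_space_moment[OF mu x p] wasserstein_space_moment[OF nu x p]
    by (auto simp: ennreal_mult_less_top)
  finally show ?thesis
    using fst snd by (intro bexI[of _ "\<mu> \<Otimes>\<^sub>M \<nu>"]) (auto simp: couplings_def)
qed

text \<open>Such a coupling exists by the definition of the infimum, whose finiteness permits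
  undoing \<open>enn2real\<close>. The slack in \<open>e\<close> stands in for optimality and
  disappears when \<open>e\<close> decreases to the distance.\<close>

lemma wasserstein_dist_less_coupling:
  assumes mu: "\<mu> \<in> wasserstein_space p m" and nu: "\<nu> \<in> wasserstein_space p m" and p: "p > 0"
    and e: "wasserstein_dist p m \<mu> \<nu> < e"
  shows "\<exists>\<pi>\<in>couplings \<mu> \<nu>. (\<integral>\<^sup>+z. ennreal (mdist m (fst z) (snd z) powr p) \<partial>\<pi>) < ennreal (e powr p)"
proof -
  let ?i = "INF \<pi>\<in>couplings \<mu> \<nu>. \<integral>\<^sup>+z. ennreal (mdist m (fst z) (snd z) powr p) \<partial>\<pi>"
  have "?i < \<infinity>"
    using wasserstein_couplings_finite[OF mu nu] p by (auto simp: INF_less_iff)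
  moreover have "enn2real ?i < e powr p"
  proof -
    have "enn2real ?i = wasserstein_dist p m \<mu> \<nu> powr p"
      using p by (simp add: wasserstein_dist_def powr_powr)
    also have "\<dots> < e powr p"
      using e p wasserstein_dist_nonneg[of p m \<mu> \<nu>] by (intro powr_less_mono2) auto
    finally show ?thesis .
  qed
  ultimately have "?i < ennreal (e powr p)"
    using ennreal_enn2real[of ?i] ennreal_less_iff[OF enn2real_nonneg, of ?i "e powr p"] by simp
  then show ?thesis by (simp add: INF_less_iff)
qed

lemma couplingsD:
  assumes "\<pi> \<in> couplings \<mu> \<nu>"
  shows "sets \<pi> = sets (\<mu> \<Otimes>\<^sub>M \<nu>)" "fst \<in> \<pi> \<rightarrow>\<^sub>M \<mu>" "snd \<in> \<pi> \<rightarrow>\<^sub>M \<nu>"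
    "distr \<pi> \<mu> fst = \<mu>" "distr \<pi> \<nu> snd = \<nu>"
proof -
  show *: "sets \<pi> = sets (\<mu> \<Otimes>\<^sub>M \<nu>)"
    using assms by (simp add: couplings_def)
  show "fst \<in> \<pi> \<rightarrow>\<^sub>M \<mu>" "snd \<in> \<pi> \<rightarrow>\<^sub>M \<nu>"
    using measurable_cong_sets[OF * refl] measurable_fst measurable_snd by blast+
  show "distr \<pi> \<mu> fst = \<mu>" "distr \<pi> \<nu> snd = \<nu>"
    using assms by (simp_all add: couplings_def)
qed

lemma couplings_prob_space:
  assumes "\<pi> \<in> couplings \<mu> \<nu>" "prob_space \<mu>"
  shows "prob_space \<pi>"
  using couplingsD(4)[OF assms(1)] assms(2) by (intro prob_space_distrD[OF couplingsD(2)[OF assms(1)]]) simp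

lemma couplings_distr:
  assumes pi: "\<pi> \<in> couplings \<mu> \<nu>"
  shows "f \<in> \<mu> \<rightarrow>\<^sub>M A \<Longrightarrow> distr \<pi> A (\<lambda>z. f (fst z)) = distr \<mu> A f"
    and "g \<in> \<nu> \<rightarrow>\<^sub>M A \<Longrightarrow> distr \<pi> A (\<lambda>z. g (snd z)) = distr \<nu> A g"
  using distr_distr[OF _ couplingsD(2)[OF pi], of f A] distr_distr[OF _ couplingsD(3)[OF pi], of g A]
  by (simp_all add: couplingsD(4,5)[OF pi] comp_def)

text \<open>The ball of radius \<open>r / C\<close> around \<mu> is mapped into the ball of radius
  \<open>r\<close> around \<open>\<Phi> \<mu>\<close>, which is exactly the form in which
  \<open>wasserstein_topology\<close> defines openness.\<close>

lemma continuous_map_wasserstein_Lipschitz: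
  assumes im: "\<And>\<mu>. \<mu> \<in> wasserstein_space p m1 \<Longrightarrow> \<Phi> \<mu> \<in> wasserstein_space p m2"
    and C: "C > 0"
    and le: "\<And>\<mu> \<nu>. \<mu> \<in> wasserstein_space p m1 \<Longrightarrow> \<nu> \<in> wasserstein_space p m1 \<Longrightarrow>
      wasserstein_dist p m2 (\<Phi> \<mu>) (\<Phi> \<nu>) \<le> C * wasserstein_dist p m1 \<mu> \<nu>"
  shows "continuous_map (wasserstein_topology p m1) (wasserstein_topology p m2) \<Phi>"
  unfolding continuous_map_def
proof (intro conjI allI impI)
  show "\<Phi> \<in> topspace (wasserstein_topology p m1) \<rightarrow> topspace (wasserstein_topology p m2)"
    using im by simp
  fix U assume U: "openin (wasserstein_topology p m2) U"
  show "openin (wasserstein_topology p m1) {\<mu> \<in> topspace (wasserstein_topology p m1). \<Phi> \<mu> \<in> U}"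
    unfolding openin_wasserstein_topology
  proof (intro conjI ballI)
    fix \<mu> assume mu: "\<mu> \<in> {\<mu> \<in> topspace (wasserstein_topology p m1). \<Phi> \<mu> \<in> U}"
    then obtain r where r: "r > 0" "\<And>\<nu>. \<nu> \<in> wasserstein_space p m2 \<Longrightarrow> wasserstein_dist p m2 (\<Phi> \<mu>) \<nu> < r \<Longrightarrow> \<nu> \<in> U"
      using U by (auto simp: openin_wasserstein_topology)
    have "\<Phi> \<nu> \<in> U" if nu: "\<nu> \<in> wasserstein_space p m1" "wasserstein_dist p m1 \<mu> \<nu> < r / C" for \<nu>
    proof -
      have "wasserstein_dist p m2 (\<Phi> \<mu>) (\<Phi> \<nu>) \<le> C * wasserstein_dist p m1 \<mu> \<nu>"
        using le mu nu by simp
      also have "\<dots> < r"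
        using nu C by (simp add: field_simps)
      finally show ?thesis
        using r im nu by blast
    qed
    then show "\<exists>r>0. \<forall>\<nu>\<in>wasserstein_space p m1. wasserstein_dist p m1 \<mu> \<nu> < r \<longrightarrow>
        \<nu> \<in> {\<mu> \<in> topspace (wasserstein_topology p m1). \<Phi> \<mu> \<in> U}"
      using r C by (intro exI[of _ "r / C"]) auto
  qed auto
qed

lemma measurable_wasserstein_space:
  assumes "\<mu> \<in> wasserstein_space p m"
  shows "f \<in> \<mu> \<rightarrow>\<^sub>M N \<longleftrightarrow> f \<in> borel_of (mtopology_of m) \<rightarrow>\<^sub>M N"
  using measurable_cong_sets[OF wasserstein_spaceD(2)[OF assms] refl] by blast

text \<open>The diagonal coupling has cost zero. This serves whenever two paths are compared under
  one and the same flow.\<close>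

lemma wasserstein_dist_self:
  assumes mu: "\<mu> \<in> wasserstein_space p m" and p: "p > 0"
  shows "wasserstein_dist p m \<mu> \<mu> = 0"
proof -
  have id: "(\<lambda>x. x) \<in> \<mu> \<rightarrow>\<^sub>M borel_of (mtopology_of m)"
    by (simp add: measurable_wasserstein_space[OF mu])
  have "(\<integral>\<^sup>+x. ennreal (mdist m x x powr p) \<partial>\<mu>) = (\<integral>\<^sup>+x. 0 \<partial>\<mu>)"
    using wasserstein_spaceD(3)[OF mu] by (intro nn_integral_cong) auto
  moreover have "distr \<mu> (borel_of (mtopology_of m)) (\<lambda>x. x) = \<mu>"
    using distr_cong[OF refl, of "borel_of (mtopology_of m)" \<mu> \<mu>] wasserstein_spaceD(2)[OF mu] by simp
  ultimately have "wasserstein_dist p m \<mu> \<mu> \<le> 0"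
    using wasserstein_dist_distr_le[OF id id p, of 0] by simp
  then show ?thesis
    using wasserstein_dist_nonneg[of p m \<mu> \<mu>] by simp
qed

lemma couplings_wasserstein_space:
  assumes pi: "\<pi> \<in> couplings \<mu> \<nu>"
    and mu: "\<mu> \<in> wasserstein_space p m" and nu: "\<nu> \<in> wasserstein_space p' m'"
  shows "sets \<pi> = sets (borel_of (mtopology_of m) \<Otimes>\<^sub>M borel_of (mtopology_of m'))"
    and "z \<in> space \<pi> \<Longrightarrow> fst z \<in> mspace m" "z \<in> space \<pi> \<Longrightarrow> snd z \<in> mspace m'"
  using couplingsD(1)[OF pi] sets_pair_measure_cong[OF wasserstein_spaceD(2)[OF mu] wasserstein_spaceD(2)[OF nu]]
    measurable_space[OF couplingsD(2)[OF pi], of z] measurable_space[OF couplingsD(3)[OF pi], of z]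
  by (simp_all add: wasserstein_spaceD(3)[OF mu] wasserstein_spaceD(3)[OF nu])

text \<open>Turns a pointwise Lipschitz estimate into one for moments. In the coupling arguments
  \<open>d\<close> is the distance of the coupled points, \<alpha> a Lipschitz constant, and \<beta>
  the contribution of the distance between two flows, which is the same at all points.\<close>

lemma nn_integral_affine_powr_le:
  fixes d f :: "'a \<Rightarrow> real"
  assumes P: "prob_space P" and d: "d \<in> borel_measurable P" and p: "p > 0"
    and nonneg: "\<alpha> \<ge> 0" "\<beta> \<ge> 0" "\<And>x. x \<in> space P \<Longrightarrow> d x \<ge> 0"
    and f: "\<And>x. x \<in> space P \<Longrightarrow> 0 \<le> f x \<and> f x \<le> \<alpha> * d x + \<beta>"
    and e: "(\<integral>\<^sup>+x. ennreal (d x powr p) \<partial>P) \<le> ennreal (e powr p)" "e \<ge> 0"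
  shows "(\<integral>\<^sup>+x. ennreal (f x powr p) \<partial>P) \<le> ennreal ((2 * \<alpha> * e) powr p + (2 * \<beta>) powr p)"
proof -
  interpret prob_space P by fact
  have "(\<integral>\<^sup>+x. ennreal (f x powr p) \<partial>P) \<le>
     (\<integral>\<^sup>+x. ennreal ((2 * \<alpha>) powr p) * ennreal (d x powr p) + ennreal ((2 * \<beta>) powr p) \<partial>P)"
  proof (rule nn_integral_mono)
    fix x assume x: "x \<in> space P"
    have "f x powr p \<le> (\<alpha> * d x + \<beta>) powr p"
      using f[OF x] p by (intro powr_mono2) auto
    also have "\<dots> \<le> (2 * (\<alpha> * d x)) powr p + (2 * \<beta>) powr p"
      using nonneg x p by (intro powr_add_le) auto
    also have "(2 * (\<alpha> * d x)) powr p = (2 * \<alpha>) powr p * d x powr p"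
      using nonneg x by (simp add: powr_mult)
    finally show "ennreal (f x powr p) \<le> ennreal ((2 * \<alpha>) powr p) * ennreal (d x powr p) + ennreal ((2 * \<beta>) powr p)"
      by (simp flip: ennreal_mult ennreal_plus)
  qed
  also have "\<dots> = ennreal ((2 * \<alpha>) powr p) * (\<integral>\<^sup>+x. ennreal (d x powr p) \<partial>P) + ennreal ((2 * \<beta>) powr p)"
    using d by (simp add: nn_integral_add nn_integral_cmult emeasure_space_1)
  also have "\<dots> \<le> ennreal ((2 * \<alpha>) powr p) * ennreal (e powr p) + ennreal ((2 * \<beta>) powr p)"
    using e by (intro add_mono mult_left_mono) auto
  also have "\<dots> = ennreal ((2 * \<alpha> * e) powr p + (2 * \<beta>) powr p)"
    using nonneg e by (simp add: powr_mult flip: ennreal_mult ennreal_plus)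
  finally show ?thesis .
qed

section \<open>Empirical measures as laws\<close>

lemma measurable_uniform_count_measure:
  assumes "\<And>i. i \<in> A \<Longrightarrow> y i \<in> space N"
  shows "y \<in> uniform_count_measure A \<rightarrow>\<^sub>M N"
  using assms by (auto simp: measurable_def space_uniform_count_measure sets_uniform_count_measure)

text \<open>The empirical measure is the law of \<open>y\<close> at a uniformly drawn index, so
  facts on push-forwards apply to it.\<close>

lemma empirical_measure_eq_distr:
  assumes N: "N \<ge> 1" and y: "\<And>i. i \<in> {1..N} \<Longrightarrow> y i \<in> topspace X"
  shows "empirical_measure X N y = distr (uniform_count_measure {1..N}) (borel_of X) y"
proof (rule measure_eqI)
  have [simp]: "sets (empirical_measure X N y) = sets (borel_of X)"
    unfolding empirical_measure_def using sets.sigma_sets_eq[of "borel_of X"] sets.space_closed[of "borel_of X"]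
    by (subst sets_measure_of) auto
  show "sets (empirical_measure X N y) = sets (distr (uniform_count_measure {1..N}) (borel_of X) y)"
    by simp
  fix A assume "A \<in> sets (empirical_measure X N y)"
  then have A: "A \<in> sets (borel_of X)" by simp
  have meas: "y \<in> uniform_count_measure {1..N} \<rightarrow>\<^sub>M borel_of X"
    using y by (auto simp: measurable_def space_uniform_count_measure sets_uniform_count_measure)
  have "(\<Sum>i=1..N. indicator A (y i)) = (of_nat (card {i\<in>{1..N}. y i \<in> A}) :: ennreal)"
    by (simp add: indicator_def sum.If_cases Int_def)
  moreover have "y -` A \<inter> {1..N} = {i\<in>{1..N}. y i \<in> A}" by auto
  moreover have "emeasure (distr (uniform_count_measure {1..N}) (borel_of X) y) A
      = emeasure (uniform_count_measure {1..N}) (y -` A \<inter> {1..N})"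
    by (subst emeasure_distr[OF meas A]) (simp only: space_uniform_count_measure)
  moreover have "emeasure (uniform_count_measure {1..N}) {i\<in>{1..N}. y i \<in> A} = ennreal (card {i\<in>{1..N}. y i \<in> A} / N)"
    by (subst emeasure_uniform_count_measure) auto
  moreover have "ennreal (card {i\<in>{1..N}. y i \<in> A} / N) = of_nat (card {i\<in>{1..N}. y i \<in> A}) / of_nat N"
    using N by (subst divide_ennreal[symmetric]) (auto simp: ennreal_of_nat_eq_real_of_nat)
  ultimately show "emeasure (empirical_measure X N y) A = emeasure (distr (uniform_count_measure {1..N}) (borel_of X) y) A"
    by (simp only: emeasure_empirical_measure[OF A])
qed

lemma empirical_measure_in_wasserstein_space:
  assumes N: "N \<ge> 1" and y: "\<And>i. i \<in> {1..N} \<Longrightarrow> y i \<in> mspace m"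
  shows "empirical_measure (mtopology_of m) N y \<in> wasserstein_space p m"
proof -
  have P: "prob_space (uniform_count_measure {1..N})"
    using N by (intro prob_space_uniform_count_measure) auto
  have meas: "y \<in> uniform_count_measure {1..N} \<rightarrow>\<^sub>M borel_of (mtopology_of m)"
    using y by (auto simp: measurable_def space_uniform_count_measure sets_uniform_count_measure)
  have "(\<integral>\<^sup>+i. ennreal (mdist m (y 1) (y i) powr p) \<partial>uniform_count_measure {1..N}) < \<infinity>"
    unfolding uniform_count_measure_def
    by (subst nn_integral_point_measure_finite) (auto simp: less_top[symmetric] ennreal_mult_eq_top_iff)
  then show ?thesis
    using distr_in_wasserstein_space[OF P meas] N y
    by (subst empirical_measure_eq_distr) auto
qed


section \<open>Large deviations under homeomorphisms\<close>

text \<open>A homeomorphism commutes with interior and closure, so the bounds for a Borel set are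
  those for its preimage: the probabilities agree and the infima of the rate functions match point
  by point. Since \<open>Y'\<close> is tied to \<open>Y\<close> at every outcome, its measurability
  follows too.\<close>

lemma large_deviations_principle_homeomorphic:
  assumes LDP: "large_deviations_principle E a M Y I"
    and hom: "homeomorphic_maps E F H G"
    and Y': "\<And>N \<omega>. N \<ge> 1 \<Longrightarrow> \<omega> \<in> space (M N) \<Longrightarrow> Y' N \<omega> = H (Y N \<omega>)"
    and J: "\<And>y. y \<in> topspace F \<Longrightarrow> J y = I (G y)"
  shows "large_deviations_principle F a M Y' J"
proof -
  have H: "homeomorphic_map E F H" and cH: "continuous_map E F H" and cG: "continuous_map F E G"
    and GH: "\<And>x. x \<in> topspace E \<Longrightarrow> G (H x) = x" and HG: "\<And>y. y \<in> topspace F \<Longrightarrow> H (G y) = y"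
    using hom homeomorphic_maps_map by (auto simp: homeomorphic_maps_def)
  have HE: "H x \<in> topspace F" if "x \<in> topspace E" for x
    using cH that by (auto simp: continuous_map_def)
  have mY: "Y N \<in> M N \<rightarrow>\<^sub>M borel_of E" if "N \<ge> 1" for N
    using LDP that by (simp add: large_deviations_principle_def)
  have mY': "Y' N \<in> M N \<rightarrow>\<^sub>M borel_of F" if N: "N \<ge> 1" for N
  proof -
    have "(\<lambda>\<omega>. H (Y N \<omega>)) \<in> M N \<rightarrow>\<^sub>M borel_of F"
      using measurable_compose[OF mY[OF N] continuous_map_measurable[OF cH]] .
    then show ?thesis
      using N by (subst measurable_cong[OF Y'])
  qed
  have lsc: "lower_semicontinuous_in F J"
    unfolding lower_semicontinuous_in_def
  proof
    fix c
    have "{y \<in> topspace F. J y \<le> c} = {y \<in> topspace F. G y \<in> {x \<in> topspace E. I x \<le> c}}"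
      using cG J by (auto simp: continuous_map_def)
    moreover have "closedin E {x \<in> topspace E. I x \<le> c}"
      using LDP by (simp add: large_deviations_principle_def lower_semicontinuous_in_def)
    ultimately show "closedin F {y \<in> topspace F. J y \<le> c}"
      using closedin_continuous_map_preimage[OF cG] by (simp only:)
  qed
  have bounds: "- (INF x\<in>F interior_of A. enn2ereal (J x))
          \<le> liminf (\<lambda>N. ereal (1 / a N) * ereal_log (measure (distr (M N) (borel_of F) (Y' N)) A)) \<and>
        limsup (\<lambda>N. ereal (1 / a N) * ereal_log (measure (distr (M N) (borel_of F) (Y' N)) A))
          \<le> - (INF x\<in>F closure_of A. enn2ereal (J x))" if A: "A \<in> sets (borel_of F)" for A
  proof -
    define B where "B = H -` A \<inter> topspace E"
    have B: "B \<in> sets (borel_of E)"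
      using measurable_sets[OF continuous_map_measurable[OF cH] A] by (simp add: B_def)
    have AF: "A \<subseteq> topspace F"
      using sets.sets_into_space[OF A] by simp
    have AB: "A = H ` B"
    proof
      show "A \<subseteq> H ` B"
      proof
        fix y assume "y \<in> A"
        then have "G y \<in> B" "y = H (G y)"
          using AF HG cG by (auto simp: B_def continuous_map_def)
        then show "y \<in> H ` B" by blast
      qed
    qed (auto simp: B_def)
    have BE: "B \<subseteq> topspace E" by (auto simp: B_def)
    have INF: "(INF y\<in>H ` S. enn2ereal (J y)) = (INF x\<in>S. enn2ereal (I x))"
      if "S \<subseteq> topspace E" for S
      unfolding image_image using that J HE GH by (intro INF_cong refl) (auto simp: subset_iff)
    have eq: "measure (distr (M N) (borel_of F) (Y' N)) A = measure (distr (M N) (borel_of E) (Y N)) B"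
      if N: "N \<ge> 1" for N
    proof -
      have "Y' N -` A \<inter> space (M N) = Y N -` B \<inter> space (M N)"
        using Y'[OF N] measurable_space[OF mY[OF N]] by (auto simp: B_def)
      then show ?thesis
        by (simp add: measure_distr[OF mY[OF N] B] measure_distr[OF mY'[OF N] A])
    qed
    \<comment> \<open>The hypotheses start at \<open>N = 1\<close>, so the two sequences agree only
      eventually; \<open>liminf\<close> and \<open>limsup\<close> do not see the difference.\<close>
    have ev: "\<forall>\<^sub>F N in sequentially.
        ereal (1 / a N) * ereal_log (measure (distr (M N) (borel_of F) (Y' N)) A)
      = ereal (1 / a N) * ereal_log (measure (distr (M N) (borel_of E) (Y N)) B)"
      using eq by (intro eventually_sequentiallyI[of 1]) simp
    have "F interior_of A = H ` (E interior_of B)" "F closure_of A = H ` (E closure_of B)"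
      unfolding AB using homeomorphic_map_interior_of[OF H BE] homeomorphic_map_closure_of[OF H BE]
      by auto
    then show ?thesis
      using LDP B INF[OF interior_of_subset_topspace] INF[OF closure_of_subset_topspace]
      by (simp add: Liminf_eq[OF ev] Limsup_eq[OF ev] large_deviations_principle_def)
  qed
  show ?thesis
    using LDP mY' lsc bounds unfolding large_deviations_principle_def by blast
qed

text \<open>Sublevel sets of \<open>J\<close> are images of those of \<open>I\<close> under the
  continuous map \<open>H\<close>.\<close>

lemma good_rate_function_homeomorphic:
  assumes good: "good_rate_function E I"
    and hom: "homeomorphic_maps E F H G"
    and J: "\<And>y. y \<in> topspace F \<Longrightarrow> J y = I (G y)"
  shows "good_rate_function F J"
  unfolding good_rate_function_def
proof (intro allI impI)
  fix c :: ennreal assume "c < \<infinity>"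
  then have "compactin F (H ` {x \<in> topspace E. I x \<le> c})"
    using good hom by (auto simp: good_rate_function_def homeomorphic_maps_def intro: image_compactin)
  also have "H ` {x \<in> topspace E. I x \<le> c} = {y \<in> topspace F. J y \<le> c}"
  proof (intro equalityI subsetI)
    fix y assume "y \<in> {y \<in> topspace F. J y \<le> c}"
    then have "G y \<in> {x \<in> topspace E. I x \<le> c}" "y = H (G y)"
      using hom J by (auto simp: homeomorphic_maps_def continuous_map_def)
    then show "y \<in> H ` {x \<in> topspace E. I x \<le> c}" by blast
  next
    fix y assume "y \<in> H ` {x \<in> topspace E. I x \<le> c}"
    then obtain x where x: "x \<in> topspace E" "I x \<le> c" "y = H x" by blast
    then have "y \<in> topspace F" "G y = x"
      using hom by (auto simp: homeomorphic_maps_def continuous_map_def)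
    then show "y \<in> {y \<in> topspace F. J y \<le> c}"
      using J x by simp
  qed
  finally show "compactin F {y \<in> topspace F. J y \<le> c}" .
qed


section \<open>Path spaces\<close>

text \<open>Boundedness, which \<open>cfunspace\<close> demands, is automatic on a compact
  interval.\<close>

lemma mspace_path_metric:
  "x \<in> mspace (path_metric T) \<longleftrightarrow> x \<in> extensional {0..T} \<and> continuous_on {0..T} x"
  unfolding path_metric_def
  by (subst compactin_mspace_cfunspace) (auto simp: compactin_subtopology)

lemma mcomplete_of_path_metric: "mcomplete_of (path_metric T)"
proof -
  have "Met_TC.mcomplete TYPE(real ^ 'd)"
    by (simp add: mcomplete_iff_complete complete_UNIV)
  from Met_TC.mcomplete_cfunspace[OF this] show ?thesis
    by (simp add: path_metric_def Met_TC.Self_def euclidean_metric_def)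
qed

lemma mdist_path_metric_le_iff:
  assumes "x \<in> mspace (path_metric T)" "y \<in> mspace (path_metric T)" "T \<ge> 0"
  shows "mdist (path_metric T) x y \<le> a \<longleftrightarrow> (\<forall>t\<in>{0..T}. dist (x t) (y t) \<le> a)"
  using assms unfolding path_metric_def by (subst cfunspace_mdist_le) auto

lemma dist_le_mdist_path_metric:
  assumes "x \<in> mspace (path_metric T)" "y \<in> mspace (path_metric T)" "t \<in> {0..T}"
  shows "dist (x t) (y t) \<le> mdist (path_metric T) x y"
  using assms mdist_path_metric_le_iff[of x T y "mdist (path_metric T) x y"] by auto

lemma continuous_map_path_eval:
  assumes "t \<in> {0..T}"
  shows "continuous_map (mtopology_of (path_metric T)) euclidean (\<lambda>x. x t)"
proof -
  have "Lipschitz_continuous_map (path_metric T) euclidean_metric (\<lambda>x. x t)"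
    using dist_le_mdist_path_metric[OF _ _ assms]
    by (auto simp: Lipschitz_continuous_map_def intro!: exI[of _ 1])
  then show ?thesis
    by (auto dest: Lipschitz_continuous_imp_continuous_map)
qed

lemma measurable_path_eval:
  "t \<in> {0..T} \<Longrightarrow> (\<lambda>x. x t) \<in> borel_of (mtopology_of (path_metric T)) \<rightarrow>\<^sub>M borel"
  by (rule continuous_map_euclidean_measurable[OF continuous_map_path_eval])

text \<open>Measurability holds for the product \<open>\<sigma>\<close>-algebra, not only for the Borel \<open>\<sigma>\<close>-algebra of the
  product, because the supremum may be taken over a countable dense set of times.\<close>

lemma measurable_mdist_path_metric:
  assumes T: "T \<ge> 0"
  shows "(\<lambda>z. mdist (path_metric T) (fst z) (snd z)) \<in> borel_measurable
    (borel_of (mtopology_of (path_metric T)) \<Otimes>\<^sub>M borel_of (mtopology_of (path_metric T :: (real \<Rightarrow> real ^ 'd) metric)))"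
    (is "_ \<in> borel_measurable ?M")
proof -
  obtain D where D: "countable D" "D \<subseteq> {0..T}" "{0..T} \<subseteq> closure D"
    using separable[of "{0..T}"] by blast
  then have cl: "closure D = {0..T}"
    using closure_minimal[of D "{0..T}"] by auto
  with T have "D \<noteq> {}" by auto
  define d where "d = from_nat_into D"
  have d: "range d = D"
    using range_from_nat_into[OF \<open>D \<noteq> {}\<close> D(1)] by (simp add: d_def)
  have [measurable]: "(\<lambda>z. dist (fst z (d n)) (snd z (d n))) \<in> borel_measurable ?M" for n
  proof -
    have "d n \<in> {0..T}" using d D(2) by blast
    note eval = measurable_path_eval[OF this]
    show ?thesis
      using measurable_compose[OF measurable_fst eval] measurable_compose[OF measurable_snd eval]
      by measurable
  qed
  show ?thesis
    unfolding borel_measurable_iff_le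
  proof
    fix a
    have "{z \<in> space ?M. mdist (path_metric T) (fst z) (snd z) \<le> a} =
      {z \<in> space ?M. \<forall>n. dist (fst z (d n)) (snd z (d n)) \<le> a}"
    proof (rule Collect_cong, rule conj_cong[OF refl])
      fix z assume "z \<in> space ?M"
      then have z: "fst z \<in> mspace (path_metric T)" "snd z \<in> mspace (path_metric T)"
        by (auto simp: space_pair_measure)
      have "(\<forall>t\<in>{0..T}. dist (fst z t) (snd z t) \<le> a) \<longleftrightarrow> (\<forall>t\<in>D. dist (fst z t) (snd z t) \<le> a)"
      proof
        assume *: "\<forall>t\<in>D. dist (fst z t) (snd z t) \<le> a"
        have "continuous_on (closure D) (\<lambda>t. dist (fst z t) (snd z t))"
          unfolding cl using z by (auto simp: mspace_path_metric intro!: continuous_intros)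
        then show "\<forall>t\<in>{0..T}. dist (fst z t) (snd z t) \<le> a"
          using continuous_le_on_closure[of D "\<lambda>t. dist (fst z t) (snd z t)" _ a] * cl by auto
      qed (use D in auto)
      also have "\<dots> \<longleftrightarrow> (\<forall>n. dist (fst z (d n)) (snd z (d n)) \<le> a)"
        using d by auto
      finally show "mdist (path_metric T) (fst z) (snd z) \<le> a \<longleftrightarrow> (\<forall>n. dist (fst z (d n)) (snd z (d n)) \<le> a)"
        by (simp add: mdist_path_metric_le_iff[OF z T])
    qed
    also have "\<dots> \<in> sets ?M" by measurable
    finally show "{z \<in> space ?M. mdist (path_metric T) (fst z) (snd z) \<le> a} \<in> sets ?M" .
  qed
qed

section \<open>The space of inputs\<close>

lemma mspace_input_metric:
  "z \<in> mspace (input_metric T) \<longleftrightarrow> snd z \<in> mspace (path_metric T) \<and> snd z 0 = 0"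
  by (cases z) (auto simp: input_metric_def path0_metric_def)

lemma mdist_input_metric:
  "mdist (input_metric T) z z' = sqrt ((dist (fst z) (fst z'))\<^sup>2 + (mdist (path_metric T) (snd z) (snd z'))\<^sup>2)"
  by (simp add: input_metric_def path0_metric_def prod_dist_def case_prod_unfold)

lemma mdist_input_metric_bounds:
  "dist (fst z) (fst z') \<le> mdist (input_metric T) z z'"
  "mdist (path_metric T) (snd z) (snd z') \<le> mdist (input_metric T) z z'"
  "mdist (input_metric T) z z' \<le> dist (fst z) (fst z') + mdist (path_metric T) (snd z) (snd z')"
  unfolding mdist_input_metric by (auto intro: sqrt_sum_squares_le_sum)

lemma continuous_map_input_fst:
  "continuous_map (mtopology_of (input_metric T)) euclidean fst"
proof -
  have "Lipschitz_continuous_map (input_metric T) euclidean_metric fst"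
    using mdist_input_metric_bounds(1) by (auto simp: Lipschitz_continuous_map_def intro!: exI[of _ 1])
  then show ?thesis by (auto dest: Lipschitz_continuous_imp_continuous_map)
qed

lemma continuous_map_input_snd:
  "continuous_map (mtopology_of (input_metric T)) (mtopology_of (path_metric T)) snd"
proof -
  have "Lipschitz_continuous_map (input_metric T) (path_metric T) snd"
    using mdist_input_metric_bounds(2)
    by (auto simp: Lipschitz_continuous_map_def mspace_input_metric intro!: exI[of _ 1])
  then show ?thesis by (auto dest: Lipschitz_continuous_imp_continuous_map)
qed

text \<open>Couplings of input laws carry this product \<sigma>-algebra, and their costs are to be
  integrated. The claim reduces to the two components of an input.\<close>

lemma measurable_mdist_input_metric:
  assumes T: "T \<ge> 0"
  shows "(\<lambda>z. mdist (input_metric T) (fst z) (snd z)) \<in> borel_measurable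
    (borel_of (mtopology_of (input_metric T)) \<Otimes>\<^sub>M borel_of (mtopology_of (input_metric T :: ((real ^ 'd) \<times> (real \<Rightarrow> real ^ 'd)) metric)))"
    (is "_ \<in> borel_measurable (?B \<Otimes>\<^sub>M _)")
proof -
  have 1: "(\<lambda>z. fst (fst z)) \<in> borel_measurable (?B \<Otimes>\<^sub>M ?B)" "(\<lambda>z. fst (snd z)) \<in> borel_measurable (?B \<Otimes>\<^sub>M ?B)"
    using continuous_map_euclidean_measurable[OF continuous_map_input_fst, of T] by measurable
  have 2: "(\<lambda>z. snd (fst z)) \<in> (?B \<Otimes>\<^sub>M ?B) \<rightarrow>\<^sub>M borel_of (mtopology_of (path_metric T))"
    "(\<lambda>z. snd (snd z)) \<in> (?B \<Otimes>\<^sub>M ?B) \<rightarrow>\<^sub>M borel_of (mtopology_of (path_metric T))"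
    using continuous_map_measurable[OF continuous_map_input_snd, of T] by measurable
  have "(\<lambda>z. mdist (path_metric T) (snd (fst z)) (snd (snd z))) \<in> borel_measurable (?B \<Otimes>\<^sub>M ?B)"
    using measurable_compose[OF measurable_Pair[OF 2] measurable_mdist_path_metric[OF T]] by simp
  with 1 show ?thesis
    unfolding mdist_input_metric by measurable
qed

section \<open>Time marginals and the flow they form\<close>

lemma borel_of_mtopology_of_euclidean:
  "borel_of (mtopology_of (euclidean_metric :: 'a::metric_space metric)) = borel"
  by (simp add: borel_of_euclidean)

lemma time_marginal_distr:
  assumes "X \<in> P \<rightarrow>\<^sub>M borel_of (mtopology_of (path_metric T))" "t \<in> {0..T}"
  shows "time_marginal t (distr P (borel_of (mtopology_of (path_metric T))) X) = distr P borel (\<lambda>\<omega>. X \<omega> t)"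
  unfolding time_marginal_def
  by (subst distr_distr[OF measurable_path_eval[OF assms(2)] assms(1)]) (simp add: comp_def)

text \<open>The cost involves the distance at the single time \<open>t\<close>, not the supremum
  over times; this preserves time-dependent weights in the estimates of the flow.\<close>

lemma wasserstein_dist_time_marginal_le:
  assumes X: "X \<in> P \<rightarrow>\<^sub>M borel_of (mtopology_of (path_metric T))"
    and Y: "Y \<in> P \<rightarrow>\<^sub>M borel_of (mtopology_of (path_metric T))"
    and t: "t \<in> {0..T}" and p: "p > 0" and K: "K \<ge> 0"
    and le: "(\<integral>\<^sup>+\<omega>. ennreal (dist (X \<omega> t) (Y \<omega> t) powr p) \<partial>P) \<le> ennreal (K powr p)"
  shows "wasserstein_dist p euclidean_metric
    (time_marginal t (distr P (borel_of (mtopology_of (path_metric T))) X))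
    (time_marginal t (distr P (borel_of (mtopology_of (path_metric T))) Y)) \<le> K"
proof -
  have "(\<lambda>\<omega>. X \<omega> t) \<in> P \<rightarrow>\<^sub>M borel_of (mtopology_of euclidean_metric)"
    "(\<lambda>\<omega>. Y \<omega> t) \<in> P \<rightarrow>\<^sub>M borel_of (mtopology_of euclidean_metric)"
    using measurable_compose[OF X measurable_path_eval[OF t]]
      measurable_compose[OF Y measurable_path_eval[OF t]]
    by (simp_all only: borel_of_mtopology_of_euclidean)
  from wasserstein_dist_distr_le[OF this p K] show ?thesis
    using le by (simp add: time_marginal_distr[OF X t] time_marginal_distr[OF Y t] borel_of_euclidean)
qed

lemma time_marginal_in_wasserstein_space:
  assumes mu: "\<mu> \<in> wasserstein_space p (path_metric T)" and t: "t \<in> {0..T}" and p: "p \<ge> 0"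
  shows "time_marginal t \<mu> \<in> wasserstein_space p (euclidean_metric :: (real ^ 'd) metric)"
proof -
  note mu_sets = wasserstein_spaceD(2)[OF mu]
  have meas: "(\<lambda>\<gamma>. \<gamma> t) \<in> \<mu> \<rightarrow>\<^sub>M borel_of (mtopology_of euclidean_metric)"
    using measurable_path_eval[OF t] measurable_cong_sets[OF mu_sets refl]
    unfolding borel_of_mtopology_of_euclidean by blast
  obtain x :: "real \<Rightarrow> real ^ 'd" where x: "x \<in> mspace (path_metric T)"
    using mu by (auto simp: wasserstein_space_def)
  have "(\<integral>\<^sup>+\<gamma>. ennreal (dist (x t) (\<gamma> t) powr p) \<partial>\<mu>) \<le> (\<integral>\<^sup>+\<gamma>. ennreal (mdist (path_metric T) x \<gamma> powr p) \<partial>\<mu>)"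
    using dist_le_mdist_path_metric[OF x _ t] p wasserstein_spaceD(3)[OF mu]
    by (intro nn_integral_mono ennreal_leI powr_mono2) auto
  also have "\<dots> < \<infinity>"
    by (rule wasserstein_space_moment[OF mu x p])
  finally show ?thesis
    using distr_in_wasserstein_space[OF wasserstein_spaceD(1)[OF mu] meas, of "x t"]
    by (simp add: time_marginal_def borel_of_euclidean)
qed

text \<open>Evaluation at a time does not increase distances. Keeping \<pi> explicit lets one
  coupling control the paths and, at all times at once, the flow.\<close>

lemma wasserstein_dist_time_marginal_coupling:
  assumes pi: "\<pi> \<in> couplings \<mu> \<nu>" and mu: "\<mu> \<in> wasserstein_space p (path_metric T)"
    and nu: "\<nu> \<in> wasserstein_space p (path_metric T)"
    and t: "t \<in> {0..T}" and p: "p > 0" and K: "K \<ge> 0"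
    and le: "(\<integral>\<^sup>+z. ennreal (mdist (path_metric T) (fst z) (snd z) powr p) \<partial>\<pi>) \<le> ennreal (K powr p)"
  shows "wasserstein_dist p euclidean_metric (time_marginal t \<mu>) (time_marginal t \<nu>) \<le> K"
proof -
  let ?B = "borel_of (mtopology_of (path_metric T))"
  have id: "(\<lambda>x. x) \<in> \<mu> \<rightarrow>\<^sub>M ?B" "(\<lambda>x. x) \<in> \<nu> \<rightarrow>\<^sub>M ?B"
    using wasserstein_spaceD(2)[OF mu] wasserstein_spaceD(2)[OF nu] by simp_all
  have fst: "fst \<in> \<pi> \<rightarrow>\<^sub>M ?B" and snd: "snd \<in> \<pi> \<rightarrow>\<^sub>M ?B"
    using measurable_compose[OF couplingsD(2)[OF pi] id(1)] measurable_compose[OF couplingsD(3)[OF pi] id(2)]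
    by simp_all
  have "distr \<pi> ?B fst = \<mu>" "distr \<pi> ?B snd = \<nu>"
    using couplings_distr[OF pi] id couplingsD(4,5)[OF pi] wasserstein_spaceD(2)[OF mu] wasserstein_spaceD(2)[OF nu]
    by (metis distr_cong)+
  moreover have "(\<integral>\<^sup>+z. ennreal (dist (fst z t) (snd z t) powr p) \<partial>\<pi>)
      \<le> (\<integral>\<^sup>+z. ennreal (mdist (path_metric T) (fst z) (snd z) powr p) \<partial>\<pi>)"
    using p measurable_space[OF fst] measurable_space[OF snd]
    by (intro nn_integral_mono ennreal_leI powr_mono2 dist_le_mdist_path_metric[OF _ _ t]) simp_all
  ultimately show ?thesis
    using wasserstein_dist_time_marginal_le[OF fst snd t p K] le by (auto intro: order_trans)
qed

lemma restrict_in_path_metric: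
  "continuous_on {0..T} f \<Longrightarrow> restrict f {0..T} \<in> mspace (path_metric T)"
  unfolding mspace_path_metric using continuous_on_cong[of "{0..T}" "{0..T}" "restrict f {0..T}" f] by simp

lemma const_path_in_path_metric: "restrict (\<lambda>_. c) {0..T} \<in> mspace (path_metric T)"
  by (intro restrict_in_path_metric continuous_intros)

text \<open>Dominated convergence: paths are continuous, and an increment is at most twice the
  supremum norm, whose p-th moment is finite. By the coupling bound, the flow of time marginals is
  therefore continuous for the Wasserstein distance.\<close>

lemma tendsto_path_increment_moment:
  fixes \<mu> :: "(real \<Rightarrow> real ^ 'd) measure"
  assumes mu: "\<mu> \<in> wasserstein_space p (path_metric T)" and s: "s \<in> {0..T}" and p: "p > 0"
  shows "((\<lambda>t. \<integral>\<^sup>+\<gamma>. ennreal (dist (\<gamma> s) (\<gamma> t) powr p) \<partial>\<mu>) \<longlongrightarrow> 0) (at s within {0..T})"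
  unfolding tendsto_at_iff_sequentially
proof (intro allI impI)
  fix t assume "\<forall>i. t i \<in> {0..T} - {s}" and lim: "t \<longlonglongrightarrow> s"
  then have t: "t i \<in> {0..T}" for i by blast
  define z :: "real \<Rightarrow> real ^ 'd" where "z = restrict (\<lambda>_. 0) {0..T}"
  have z: "z \<in> mspace (path_metric T)"
    unfolding z_def by (rule const_path_in_path_metric)
  have eval: "(\<lambda>\<gamma>. \<gamma> r) \<in> borel_measurable \<mu>" if "r \<in> {0..T}" for r
    using measurable_path_eval[OF that] by (simp add: measurable_wasserstein_space[OF mu])
  note [measurable] = eval[OF s] eval[OF t]
  have meas_z [measurable]: "(\<lambda>\<gamma>. ennreal (mdist (path_metric T) z \<gamma> powr p)) \<in> borel_measurable \<mu>"
    using mdist_powr_measurable[OF z] by (simp only: measurable_wasserstein_space[OF mu])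
  have norm_le: "norm (\<gamma> r) \<le> mdist (path_metric T) z \<gamma>" if "\<gamma> \<in> space \<mu>" "r \<in> {0..T}" for \<gamma> r
    using dist_le_mdist_path_metric[OF z _ that(2), of \<gamma>] that wasserstein_spaceD(3)[OF mu]
    by (simp add: z_def)
  have "(\<lambda>i. \<integral>\<^sup>+\<gamma>. ennreal (dist (\<gamma> s) (\<gamma> (t i)) powr p) \<partial>\<mu>) \<longlonglongrightarrow> (\<integral>\<^sup>+\<gamma>. 0 \<partial>\<mu>)"
  proof (rule nn_integral_dominated_convergence[where w = "\<lambda>\<gamma>. ennreal (2 powr p) * ennreal (mdist (path_metric T) z \<gamma> powr p)"])
    fix i
    show "AE \<gamma> in \<mu>. ennreal (dist (\<gamma> s) (\<gamma> (t i)) powr p) \<le> ennreal (2 powr p) * ennreal (mdist (path_metric T) z \<gamma> powr p)"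
    proof (rule AE_I2)
      fix \<gamma> assume g: "\<gamma> \<in> space \<mu>"
      have "dist (\<gamma> s) (\<gamma> (t i)) \<le> norm (\<gamma> s) + norm (\<gamma> (t i))"
        by (simp add: dist_norm norm_triangle_ineq4)
      also have "\<dots> \<le> 2 * mdist (path_metric T) z \<gamma>"
        using norm_le[OF g s] norm_le[OF g t[of i]] by simp
      finally have "dist (\<gamma> s) (\<gamma> (t i)) powr p \<le> (2 * mdist (path_metric T) z \<gamma>) powr p"
        using p by (intro powr_mono2) auto
      then show "ennreal (dist (\<gamma> s) (\<gamma> (t i)) powr p) \<le> ennreal (2 powr p) * ennreal (mdist (path_metric T) z \<gamma> powr p)"
        by (simp add: powr_mult flip: ennreal_mult)
    qed
  next
    show "(\<integral>\<^sup>+\<gamma>. ennreal (2 powr p) * ennreal (mdist (path_metric T) z \<gamma> powr p) \<partial>\<mu>) < \<infinity>"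
      using wasserstein_space_moment[OF mu z] p by (subst nn_integral_cmult[OF meas_z]) (simp add: ennreal_mult_less_top)
  next
    show "AE \<gamma> in \<mu>. (\<lambda>i. ennreal (dist (\<gamma> s) (\<gamma> (t i)) powr p)) \<longlonglongrightarrow> 0"
    proof (rule AE_I2)
      fix \<gamma> assume "\<gamma> \<in> space \<mu>"
      then have "continuous_on {0..T} \<gamma>"
        using wasserstein_spaceD(3)[OF mu] by (simp add: mspace_path_metric)
      then have "(\<lambda>i. \<gamma> (t i)) \<longlonglongrightarrow> \<gamma> s"
        using continuous_on_tendsto_compose[OF _ lim s] t by auto
      then have "(\<lambda>i. dist (\<gamma> s) (\<gamma> (t i))) \<longlonglongrightarrow> dist (\<gamma> s) (\<gamma> s)"
        by (intro tendsto_intros)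
      then have "(\<lambda>i. dist (\<gamma> s) (\<gamma> (t i)) powr p) \<longlonglongrightarrow> dist (\<gamma> s) (\<gamma> s) powr p"
        using p by (intro tendsto_powr2 tendsto_const) auto
      then show "(\<lambda>i. ennreal (dist (\<gamma> s) (\<gamma> (t i)) powr p)) \<longlonglongrightarrow> 0"
        using tendsto_ennrealI by fastforce
    qed
  qed auto
  then show "((\<lambda>t. \<integral>\<^sup>+\<gamma>. ennreal (dist (\<gamma> s) (\<gamma> t) powr p) \<partial>\<mu>) \<circ> t) \<longlonglongrightarrow> 0"
    by (simp add: comp_def)
qed

text \<open>The flow is continuous into the Wasserstein space, hence Borel. This makes the drift
  along a path a measurable function of time.\<close>

lemma measurable_time_marginal:
  fixes \<mu> :: "(real \<Rightarrow> real ^ 'd) measure"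
  assumes mu: "\<mu> \<in> wasserstein_space p (path_metric T)" and p: "p > 0"
  shows "(\<lambda>t. time_marginal t \<mu>) \<in> restrict_space borel {0..T} \<rightarrow>\<^sub>M borel_of (wasserstein_topology p euclidean_metric)"
proof (rule measurable_sigma_sets[OF sets_borel_of])
  let ?W = "wasserstein_topology p (euclidean_metric :: (real ^ 'd) metric)"
  show "{U. openin ?W U} \<subseteq> Pow (topspace ?W)"
    using openin_subset by blast
  have mem: "time_marginal t \<mu> \<in> wasserstein_space p euclidean_metric" if "t \<in> {0..T}" for t
    using time_marginal_in_wasserstein_space[OF mu that] p by simp
  then show "(\<lambda>t. time_marginal t \<mu>) \<in> space (restrict_space borel {0..T}) \<rightarrow> topspace ?W"
    by (auto simp: space_restrict_space)
  fix U assume "U \<in> {U. openin ?W U}"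
  then have U: "\<And>\<rho>. \<rho> \<in> U \<Longrightarrow> \<exists>r>0. \<forall>\<rho>'\<in>wasserstein_space p euclidean_metric. wasserstein_dist p euclidean_metric \<rho> \<rho>' < r \<longrightarrow> \<rho>' \<in> U"
    by (simp add: openin_wasserstein_topology)
  let ?S = "{t\<in>{0..T}. time_marginal t \<mu> \<in> U}"
  have "openin (top_of_set {0..T}) ?S"
    unfolding openin_euclidean_subtopology_iff
  proof (intro conjI ballI)
    fix s assume s: "s \<in> ?S"
    then obtain r where r: "r > 0" "\<And>\<rho>'. \<rho>' \<in> wasserstein_space p euclidean_metric \<Longrightarrow>
        wasserstein_dist p euclidean_metric (time_marginal s \<mu>) \<rho>' < r \<Longrightarrow> \<rho>' \<in> U"
      using U by blast
    \<comment> \<open>Half the radius, because the coupling bound yields only a non-strict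
      inequality.\<close>
    have "\<forall>\<^sub>F t in at s within {0..T}. (\<integral>\<^sup>+\<gamma>. ennreal (dist (\<gamma> s) (\<gamma> t) powr p) \<partial>\<mu>) < ennreal ((r/2) powr p)"
      using tendsto_path_increment_moment[OF mu _ p] s r(1) by (intro order_tendstoD(2)[where y=0]) auto
    then obtain d where d: "d > 0" "\<And>t. t \<in> {0..T} \<Longrightarrow> t \<noteq> s \<Longrightarrow> dist t s < d \<Longrightarrow>
        (\<integral>\<^sup>+\<gamma>. ennreal (dist (\<gamma> s) (\<gamma> t) powr p) \<partial>\<mu>) < ennreal ((r/2) powr p)"
      unfolding eventually_at by blast
    have "t \<in> ?S" if t: "t \<in> {0..T}" "dist t s < d" for t
    proof (cases "t = s")
      case False
      have meas: "(\<lambda>\<gamma>. \<gamma> u) \<in> \<mu> \<rightarrow>\<^sub>M borel_of (mtopology_of euclidean_metric)" if "u \<in> {0..T}" for u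
        using measurable_path_eval[OF that]
        by (simp only: measurable_wasserstein_space[OF mu] borel_of_mtopology_of_euclidean)
      have "s \<in> {0..T}" using s by simp
      from wasserstein_dist_distr_le[OF meas[OF this] meas[OF t(1)] p, of "r/2"]
      have "wasserstein_dist p euclidean_metric (time_marginal s \<mu>) (time_marginal t \<mu>) \<le> r/2"
        using d(2)[OF t(1) False t(2)] r(1) by (simp add: time_marginal_def borel_of_euclidean)
      then show ?thesis
        using r mem t by force
    qed (use s in auto)
    then show "\<exists>e>0. \<forall>t\<in>{0..T}. dist t s < e \<longrightarrow> t \<in> ?S"
      using d(1) by blast
  qed auto
  then obtain V where "open V" "?S = {0..T} \<inter> V"
    by (auto simp: openin_open)
  then have "?S \<in> sets (restrict_space borel {0..T})"
    by (auto simp: sets_restrict_space)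
  moreover have "(\<lambda>t. time_marginal t \<mu>) -` U \<inter> space (restrict_space borel {0..T}) = ?S"
    by (auto simp: space_restrict_space)
  ultimately show "(\<lambda>t. time_marginal t \<mu>) -` U \<inter> space (restrict_space borel {0..T}) \<in> sets (restrict_space borel {0..T})"
    by simp
qed

lemma wasserstein_dist_time_marginal:
  assumes mu: "\<mu> \<in> wasserstein_space p (path_metric T)" and nu: "\<nu> \<in> wasserstein_space p (path_metric T)"
    and t: "t \<in> {0..T}" and p: "p > 0"
  shows "wasserstein_dist p euclidean_metric (time_marginal t \<mu>) (time_marginal t \<nu>)
    \<le> wasserstein_dist p (path_metric T) \<mu> \<nu>"
proof (rule dense_ge)
  fix e assume e: "wasserstein_dist p (path_metric T) \<mu> \<nu> < e"
  then have "e \<ge> 0"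
    using wasserstein_dist_nonneg[of p "path_metric T" \<mu> \<nu>] by simp
  then show "wasserstein_dist p euclidean_metric (time_marginal t \<mu>) (time_marginal t \<nu>) \<le> e"
    using wasserstein_dist_less_coupling[OF mu nu p e] wasserstein_dist_time_marginal_coupling[OF _ mu nu t p, of _ e]
    by (auto intro: less_imp_le)
qed

section \<open>Continuous maps into the path space\<close>

lemma mdist_self: "x \<in> mspace m \<Longrightarrow> mdist m x x = 0"
  by simp

text \<open>The function \<delta> is a modulus of continuity at \<open>x\<close>; continuity of a
  path-valued map is thereby reduced to continuity of real expressions.\<close>

lemma continuous_map_into_metricI:
  assumes im: "\<And>x. x \<in> topspace X \<Longrightarrow> f x \<in> mspace m"
    and mod: "\<And>x. x \<in> topspace X \<Longrightarrow> \<exists>\<delta>. continuous_map X euclideanreal \<delta> \<and> \<delta> x = 0 \<and>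
      (\<forall>y\<in>topspace X. mdist m (f x) (f y) \<le> \<delta> y)"
  shows "continuous_map X (mtopology_of m) f"
  unfolding mtopology_of_def
proof (subst Metric_space.continuous_map_to_metric[OF Metric_space_mspace_mdist], intro ballI allI impI)
  fix x and \<epsilon> :: real assume x: "x \<in> topspace X" and e: "\<epsilon> > 0"
  obtain \<delta> where d: "continuous_map X euclideanreal \<delta>" "\<delta> x = 0" "\<forall>y\<in>topspace X. mdist m (f x) (f y) \<le> \<delta> y"
    using mod[OF x] by blast
  have "openin X {y \<in> topspace X. \<delta> y \<in> {..<\<epsilon>}}"
    by (rule openin_continuous_map_preimage[OF d(1)]) auto
  moreover have "f y \<in> Metric_space.mball (mspace m) (mdist m) (f x) \<epsilon>" if "y \<in> topspace X" "\<delta> y < \<epsilon>" for y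
    using that d im[OF x] im[of y] by (fastforce simp: Metric_space.in_mball[OF Metric_space_mspace_mdist])
  ultimately show "\<exists>U. openin X U \<and> x \<in> U \<and> (\<forall>y\<in>U. f y \<in> Metric_space.mball (mspace m) (mdist m) (f x) \<epsilon>)"
    using x d e by (intro exI[of _ "{y \<in> topspace X. \<delta> y \<in> {..<\<epsilon>}}"]) auto
qed

text \<open>Needed for weights that factor into a function of the input and a function of time; with
  reciprocal factors it also covers division by them.\<close>

lemma continuous_map_path_scale:
  assumes Y: "continuous_map X (mtopology_of (path_metric T)) Y"
    and c: "continuous_map X euclideanreal c" and g: "continuous_on {0..T} g" and T: "T \<ge> 0"
  shows "continuous_map X (mtopology_of (path_metric T)) (\<lambda>z. \<lambda>t\<in>{0..T}. (c z * g t) *\<^sub>R Y z t)"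
proof (rule continuous_map_into_metricI)
  have YF: "Y z \<in> mspace (path_metric T)" if "z \<in> topspace X" for z
    using Y that by (auto simp: continuous_map_def)
  show im: "(\<lambda>t\<in>{0..T}. (c z * g t) *\<^sub>R Y z t) \<in> mspace (path_metric T)" if "z \<in> topspace X" for z
    using YF[OF that] g by (intro restrict_in_path_metric continuous_intros) (auto simp: mspace_path_metric)
  fix x assume x: "x \<in> topspace X"
  have "\<exists>G. \<forall>t\<in>{0..T}. \<bar>g t\<bar> \<le> G"
    using compact_imp_bounded[OF compact_continuous_image[OF g compact_Icc]] unfolding bounded_iff by auto
  then obtain G where G: "\<And>t. t \<in> {0..T} \<Longrightarrow> \<bar>g t\<bar> \<le> G" by blast
  have G0: "G \<ge> 0" using G[of 0] T by simp
  have "\<exists>B. \<forall>t\<in>{0..T}. norm (Y x t) \<le> B"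
    using compact_imp_bounded[OF compact_continuous_image[OF _ compact_Icc, of 0 T "Y x"]] YF[OF x]
    unfolding bounded_iff mspace_path_metric by auto
  then obtain B where B: "\<And>t. t \<in> {0..T} \<Longrightarrow> norm (Y x t) \<le> B" by blast
  have B0: "B \<ge> 0" using order_trans[OF norm_ge_zero B[of 0]] T by simp
  \<comment> \<open>The modulus comes from c(x) Y(x) - c(y) Y(y) = c(y) (Y(x) - Y(y)) + (c(x) -
    c(y)) Y(x), with \<open>G\<close> and \<open>B\<close> bounding \<open>g\<close> and
    \<open>Y x\<close> on the compact interval.\<close>
  let ?\<delta> = "\<lambda>y. G * (\<bar>c y\<bar> * mdist (path_metric T) (Y x) (Y y) + \<bar>c x - c y\<bar> * B)"
  have "continuous_map X (mtopology_of (path_metric T)) (\<lambda>_. Y x)"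
    using YF[OF x] by simp
  then have "continuous_map X euclideanreal ?\<delta>"
    using Y c by (intro continuous_intros) auto
  moreover have "?\<delta> x = 0"
    using YF[OF x] by simp
  moreover have "mdist (path_metric T) (\<lambda>t\<in>{0..T}. (c x * g t) *\<^sub>R Y x t) (\<lambda>t\<in>{0..T}. (c y * g t) *\<^sub>R Y y t) \<le> ?\<delta> y"
    if y: "y \<in> topspace X" for y
  proof (subst mdist_path_metric_le_iff[OF im[OF x] im[OF y] T], intro ballI)
    fix t assume t: "t \<in> {0..T}"
    have "(c x * g t) *\<^sub>R Y x t - (c y * g t) *\<^sub>R Y y t =
        g t *\<^sub>R (c y *\<^sub>R (Y x t - Y y t) + (c x - c y) *\<^sub>R Y x t)"
      by (simp add: algebra_simps)
    then have "norm ((c x * g t) *\<^sub>R Y x t - (c y * g t) *\<^sub>R Y y t) =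
        \<bar>g t\<bar> * norm (c y *\<^sub>R (Y x t - Y y t) + (c x - c y) *\<^sub>R Y x t)"
      by simp
    also have "\<dots> \<le> G * (\<bar>c y\<bar> * norm (Y x t - Y y t) + \<bar>c x - c y\<bar> * norm (Y x t))"
      using G[OF t] G0 by (intro mult_mono order_trans[OF norm_triangle_ineq]) auto
    also have "\<dots> \<le> ?\<delta> y"
      using dist_le_mdist_path_metric[OF YF[OF x] YF[OF y] t] B[OF t] G0
      by (intro mult_left_mono add_mono) (auto simp: dist_norm)
    finally show "dist ((\<lambda>t\<in>{0..T}. (c x * g t) *\<^sub>R Y x t) t) ((\<lambda>t\<in>{0..T}. (c y * g t) *\<^sub>R Y y t) t) \<le> ?\<delta> y"
      using t by (simp add: dist_norm)
  qed
  ultimately show "\<exists>\<delta>. continuous_map X euclideanreal \<delta> \<and> \<delta> x = 0 \<and>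
      (\<forall>y\<in>topspace X. mdist (path_metric T) (\<lambda>t\<in>{0..T}. (c x * g t) *\<^sub>R Y x t) (\<lambda>t\<in>{0..T}. (c y * g t) *\<^sub>R Y y t) \<le> \<delta> y)"
    by blast
qed

lemma cfunspaceI:
  assumes "f \<in> extensional (topspace X)" "continuous_map X (mtopology_of m) f" "c \<in> mspace m"
    and "\<And>x. x \<in> topspace X \<Longrightarrow> mdist m c (f x) \<le> B"
  shows "f \<in> mspace (cfunspace X m)"
proof -
  have "f \<in> topspace X \<rightarrow> mspace m"
    using assms(2) by (simp add: continuous_map_def)
  moreover from this have "f ` topspace X \<subseteq> mcball_of m c B"
    using assms by auto
  ultimately show ?thesis
    using assms by (auto simp: Metric_space.mbounded_def mcball_of_def)
qed


section \<open>The mean-field equation\<close>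

lemma ennreal_eq_powr:
  assumes "x < \<infinity>" "p > 0"
  obtains m :: real where "m \<ge> 0" "x = ennreal (m powr p)"
proof
  show "x = ennreal ((enn2real x powr (1 / p)) powr p)"
    using assms by (simp add: powr_powr)
qed simp

text \<open>Lets \<open>e\<close> decrease to the Wasserstein distance in bounds obtained from
  couplings of cost below \<open>e powr p\<close>.\<close>

lemma le_mult_if_le_mult_greater:
  fixes v w C :: real
  assumes C: "C > 0" and le: "\<And>e. w < e \<Longrightarrow> v \<le> C * e"
  shows "v \<le> C * w"
proof -
  have "v / C \<le> w"
  proof (rule dense_ge)
    show "v / C \<le> e" if "w < e" for e
      using le[OF that] C by (simp only: pos_divide_le_eq mult.commute)
  qed
  then show ?thesis
    using C by (simp only: pos_divide_le_eq mult.commute)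
qed

text \<open>Takes the p-th root of the Lipschitz hypothesis. The 2 comes from bounding both powers
  by that of \<open>a + w\<close>, the absolute value covers a \<open>K\<close> of either sign, and
  the extra 1 makes the constant positive.\<close>

lemma le_of_powr_le:
  fixes u a w K p :: real
  assumes le: "u powr p \<le> K * (a powr p + w powr p)" and nonneg: "u \<ge> 0" "a \<ge> 0" "w \<ge> 0" and p: "p > 0"
  shows "u \<le> (2 * \<bar>K\<bar> + 1) powr (1 / p) * (a + w)"
proof (rule ccontr)
  let ?L = "(2 * \<bar>K\<bar> + 1) powr (1 / p)"
  assume "\<not> ?thesis"
  then have "(?L * (a + w)) powr p < u powr p"
    using nonneg p by (intro powr_less_mono2) auto
  moreover have "(?L * (a + w)) powr p = (2 * \<bar>K\<bar> + 1) * (a + w) powr p"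
    using nonneg p by (simp add: powr_mult powr_powr)
  moreover have "u powr p \<le> \<bar>K\<bar> * ((a + w) powr p + (a + w) powr p)"
  proof -
    have "u powr p \<le> \<bar>K\<bar> * (a powr p + w powr p)"
      using le mult_right_mono[OF abs_ge_self[of K], of "a powr p + w powr p"] by simp
    also have "\<dots> \<le> \<bar>K\<bar> * ((a + w) powr p + (a + w) powr p)"
      using nonneg p by (intro mult_left_mono add_mono powr_mono2) auto
    finally show ?thesis .
  qed
  ultimately show False
    by (simp add: algebra_simps) (smt (verit) powr_ge_zero)
qed

section \<open>Measurability and integrability of the drift\<close>

lemma solves_integral_equation_cong:
  assumes "\<And>s y. s \<in> {0..T} \<Longrightarrow> g s y = g' s y"
  shows "solves_integral_equation T g x0 \<gamma> x \<longleftrightarrow> solves_integral_equation T g' x0 \<gamma> x"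
proof -
  have "set_integrable lborel {0..T} (\<lambda>s. g s (x s)) \<longleftrightarrow> set_integrable lborel {0..T} (\<lambda>s. g' s (x s))"
    using assms by (intro set_integrable_cong) auto
  moreover have "(LINT s:{0..t}|lborel. g s (x s)) = (LINT s:{0..t}|lborel. g' s (x s))" if "t \<in> {0..T}" for t
    using assms that by (intro set_lebesgue_integral_cong) auto
  ultimately show ?thesis
    by (simp add: solves_integral_equation_def)
qed

lemma measurable_drift:
  fixes b :: "real \<Rightarrow> real ^ 'd \<Rightarrow> (real ^ 'd) measure \<Rightarrow> real ^ 'd"
  assumes meas: "(\<lambda>(t, x, \<mu>). b t x \<mu>) \<in> restrict_space borel {0..T} \<Otimes>\<^sub>M borel \<Otimes>\<^sub>M
      borel_of (wasserstein_topology p euclidean_metric) \<rightarrow>\<^sub>M borel"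
    and p: "p > 0" and x: "x \<in> mspace (path_metric T)" and mu: "\<mu> \<in> wasserstein_space p (path_metric T)"
  shows "set_borel_measurable lborel {0..T} (\<lambda>s. b s (x s) (time_marginal s \<mu>))"
proof -
  let ?M = "restrict_space borel {0..T}"
  have "x \<in> ?M \<rightarrow>\<^sub>M borel"
    using x by (intro borel_measurable_continuous_on_restrict) (simp add: mspace_path_metric)
  then have "(\<lambda>s. (s, x s, time_marginal s \<mu>)) \<in> ?M \<rightarrow>\<^sub>M ?M \<Otimes>\<^sub>M borel \<Otimes>\<^sub>M borel_of (wasserstein_topology p euclidean_metric)"
    using measurable_time_marginal[OF mu p] by (intro measurable_Pair measurable_ident_sets refl) auto
  from measurable_compose[OF this meas]
  have "(\<lambda>s. b s (x s) (time_marginal s \<mu>)) \<in> borel_measurable (restrict_space lborel {0..T})"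
    by (simp cong: measurable_cong_sets add: sets_restrict_space_cong[of lborel borel])
  then show ?thesis
    by (subst (asm) borel_measurable_restrict_space_iff) (auto simp: set_borel_measurable_def)
qed

text \<open>Along any other path and flow the drift differs by at most the constant
  \<open>?c\<close>, because evaluation at a time is 1-Lipschitz for paths and for laws. On a
  bounded interval one integrable case thus dominates every other.\<close>

lemma integrable_drift:
  fixes b :: "real \<Rightarrow> real ^ 'd \<Rightarrow> (real ^ 'd) measure \<Rightarrow> real ^ 'd"
  assumes meas: "(\<lambda>(t, x, \<mu>). b t x \<mu>) \<in> restrict_space borel {0..T} \<Otimes>\<^sub>M borel \<Otimes>\<^sub>M
      borel_of (wasserstein_topology p euclidean_metric) \<rightarrow>\<^sub>M borel"
    and p: "p > 0" and L: "L \<ge> 0"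
    and Lipschitz: "\<And>t x x' \<mu> \<mu>'. t \<in> {0..T} \<Longrightarrow> \<mu> \<in> wasserstein_space p euclidean_metric \<Longrightarrow>
      \<mu>' \<in> wasserstein_space p euclidean_metric \<Longrightarrow>
      norm (b t x \<mu> - b t x' \<mu>') \<le> L * (norm (x - x') + wasserstein_dist p euclidean_metric \<mu> \<mu>')"
    and x: "x \<in> mspace (path_metric T)" and mu: "\<mu> \<in> wasserstein_space p (path_metric T)"
    and x0: "x0 \<in> mspace (path_metric T)" and mu0: "\<mu>0 \<in> wasserstein_space p (path_metric T)"
    and integrable: "set_integrable lborel {0..T} (\<lambda>s. b s (x0 s) (time_marginal s \<mu>0))"
  shows "set_integrable lborel {0..T} (\<lambda>s. b s (x s) (time_marginal s \<mu>))"
proof -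
  let ?c = "L * (mdist (path_metric T) x x0 + wasserstein_dist p (path_metric T) \<mu> \<mu>0)"
  have "set_integrable lborel {0..T} (\<lambda>s. norm (b s (x0 s) (time_marginal s \<mu>0)) + ?c)"
    by (intro set_integral_add set_integrable_norm[OF integrable] borel_integrable_atLeastAtMost' continuous_intros)
  then show ?thesis
  proof (rule set_integrable_bound[OF _ measurable_drift[OF meas p x mu]], intro AE_I2 impI)
    fix s assume s: "s \<in> {0..T}"
    have "norm (b s (x s) (time_marginal s \<mu>) - b s (x0 s) (time_marginal s \<mu>0))
      \<le> L * (norm (x s - x0 s) + wasserstein_dist p euclidean_metric (time_marginal s \<mu>) (time_marginal s \<mu>0))"
      using time_marginal_in_wasserstein_space[OF mu s] time_marginal_in_wasserstein_space[OF mu0 s] p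
      by (intro Lipschitz[OF s]) auto
    also have "\<dots> \<le> ?c"
      using dist_le_mdist_path_metric[OF x x0 s] wasserstein_dist_time_marginal[OF mu mu0 s p] L
      by (intro mult_left_mono add_mono) (auto simp: dist_norm)
    finally show "norm (b s (x s) (time_marginal s \<mu>)) \<le> norm (norm (b s (x0 s) (time_marginal s \<mu>0)) + ?c)"
      using norm_triangle_sub[of "b s (x s) (time_marginal s \<mu>)" "b s (x0 s) (time_marginal s \<mu>0)"] by simp
  qed
qed

lemma time_marginal_empirical_measure:
  assumes N: "N \<ge> 1" and y: "\<And>i. i \<in> {1..N} \<Longrightarrow> y i \<in> mspace (path_metric T)" and t: "t \<in> {0..T}"
  shows "time_marginal t (empirical_measure (mtopology_of (path_metric T)) N y) = empirical_measure euclidean N (\<lambda>i. y i t)"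
proof -
  have "y \<in> uniform_count_measure {1..N} \<rightarrow>\<^sub>M borel_of (mtopology_of (path_metric T))"
    using y by (intro measurable_uniform_count_measure) simp
  from time_marginal_distr[OF this t] show ?thesis
    using empirical_measure_eq_distr[OF N, of y "mtopology_of (path_metric T)"]
      empirical_measure_eq_distr[OF N, of "\<lambda>i. y i t" euclidean] y
    by (simp only: topspace_mtopology_of topspace_euclidean UNIV_I borel_of_euclidean)
qed

text \<open>\<open>Lipschitz\<close> is the hypothesis on \<open>b\<close> after taking p-th roots,
  and \<open>integrable\<close> is what measurability and one known solution provide. Both survive
  freezing the measure argument of \<open>b\<close> along a given flow, which allows the locale to
  be instantiated again inside itself.\<close>

locale mean_field_drift =
  fixes T p L :: real and b :: "real \<Rightarrow> real ^ 'd \<Rightarrow> (real ^ 'd) measure \<Rightarrow> real ^ 'd"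
  assumes T: "T > 0" and p: "p \<ge> 1" and L: "L > 0"
    and Lipschitz: "\<And>t x x' \<mu> \<mu>'. t \<in> {0..T} \<Longrightarrow> \<mu> \<in> wasserstein_space p euclidean_metric \<Longrightarrow>
      \<mu>' \<in> wasserstein_space p euclidean_metric \<Longrightarrow>
      norm (b t x \<mu> - b t x' \<mu>') \<le> L * (norm (x - x') + wasserstein_dist p euclidean_metric \<mu> \<mu>')"
    and integrable: "\<And>x \<mu>. x \<in> mspace (path_metric T) \<Longrightarrow> \<mu> \<in> wasserstein_space p (path_metric T) \<Longrightarrow>
      set_integrable lborel {0..T} (\<lambda>s. b s (x s) (time_marginal s \<mu>))"
begin

abbreviation paths :: "(real \<Rightarrow> real ^ 'd) metric" where
  "paths \<equiv> path_metric T"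

abbreviation inputs :: "((real ^ 'd) \<times> (real \<Rightarrow> real ^ 'd)) metric" where
  "inputs \<equiv> input_metric T"

abbreviation path_laws :: "(real \<Rightarrow> real ^ 'd) measure set" where
  "path_laws \<equiv> wasserstein_space p paths"

abbreviation input_laws :: "((real ^ 'd) \<times> (real \<Rightarrow> real ^ 'd)) measure set" where
  "input_laws \<equiv> wasserstein_space p inputs"

abbreviation flow_dist :: "real \<Rightarrow> (real \<Rightarrow> real ^ 'd) measure \<Rightarrow> (real \<Rightarrow> real ^ 'd) measure \<Rightarrow> real" where
  "flow_dist s \<mu> \<mu>' \<equiv> wasserstein_dist p euclidean_metric (time_marginal s \<mu>) (time_marginal s \<mu>')"

abbreviation zero_path :: "real \<Rightarrow> real ^ 'd" where
  "zero_path \<equiv> restrict (\<lambda>_. 0) {0..T}"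

lemma T0: "T \<ge> 0" and p0: "p > 0"
  using T p by auto

definition drift :: "(real \<Rightarrow> real ^ 'd) measure \<Rightarrow> (real \<Rightarrow> real ^ 'd) \<Rightarrow> real \<Rightarrow> real ^ 'd" where
  "drift \<mu> x t = (LINT s:{0..t}|lborel. b s (x s) (time_marginal s \<mu>))"

lemma flow_in_wasserstein_space:
  "\<mu> \<in> path_laws \<Longrightarrow> t \<in> {0..T} \<Longrightarrow> time_marginal t \<mu> \<in> wasserstein_space p euclidean_metric"
  using time_marginal_in_wasserstein_space[of \<mu> p T t] p0 by simp

text \<open>The passage to the gauge integral gives access to the fundamental theorem of calculus
  and to norm bounds by a majorant.\<close>

lemma drift_eq_integral:
  assumes "x \<in> mspace paths" "\<mu> \<in> path_laws" "t \<in> {0..T}"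
  shows "(\<lambda>s. b s (x s) (time_marginal s \<mu>)) integrable_on {0..t}"
    "drift \<mu> x t = integral {0..t} (\<lambda>s. b s (x s) (time_marginal s \<mu>))"
proof -
  have "set_integrable lborel {0..t} (\<lambda>s. b s (x s) (time_marginal s \<mu>))"
    using assms(3) by (intro set_integrable_subset[OF integrable[OF assms(1,2)]]) auto
  from set_borel_integral_eq_integral[OF this]
  show "(\<lambda>s. b s (x s) (time_marginal s \<mu>)) integrable_on {0..t}"
    "drift \<mu> x t = integral {0..t} (\<lambda>s. b s (x s) (time_marginal s \<mu>))"
    by (simp_all add: drift_def)
qed

lemma drift_0: "drift \<mu> x 0 = 0"
proof -
  have "(LINT s:{0..0}|lborel. b s (x s) (time_marginal s \<mu>)) = 0"
    unfolding set_lebesgue_integral_def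
    by (rule integral_eq_zero_AE) (use AE_lborel_singleton[of "0::real"] in \<open>auto elim!: eventually_mono\<close>)
  then show ?thesis by (simp add: drift_def)
qed

lemma continuous_on_drift:
  assumes "x \<in> mspace paths" "\<mu> \<in> path_laws"
  shows "continuous_on {0..T} (drift \<mu> x)"
proof -
  have "continuous_on {0..T} (\<lambda>t. integral {0..t} (\<lambda>s. b s (x s) (time_marginal s \<mu>)))"
    using drift_eq_integral(1)[OF assms, of T] T0 by (intro indefinite_integral_continuous_1) simp
  then show ?thesis
    using drift_eq_integral(2)[OF assms] continuous_on_cong[OF refl, of "{0..T}" "drift \<mu> x"] by simp
qed

text \<open>With exponential weights the Lipschitz bound integrates to a factor \<open>L / l\<close>, so a large rate \<open>l\<close> turns
  every fixed-point and stability argument into a contraction; this replaces Gronwall's inequality.\<close>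

lemma drift_diff_le:
  assumes x: "x \<in> mspace paths" "x' \<in> mspace paths" and mu: "\<mu> \<in> path_laws" "\<mu>' \<in> path_laws"
    and l: "l > 0"
    and A: "\<And>s. s \<in> {0..T} \<Longrightarrow> norm (x s - x' s) \<le> exp (l * s) * A"
    and V: "\<And>s. s \<in> {0..T} \<Longrightarrow> flow_dist s \<mu> \<mu>' \<le> exp (l * s) * V"
    and t: "t \<in> {0..T}"
  shows "norm (drift \<mu> x t - drift \<mu>' x' t) \<le> L / l * exp (l * t) * (A + V)"
proof -
  let ?g = "\<lambda>s. b s (x s) (time_marginal s \<mu>)" and ?g' = "\<lambda>s. b s (x' s) (time_marginal s \<mu>')"
  let ?h = "\<lambda>s. L * (A + V) * exp (l * s)"
  \<comment> \<open>Reading the two bounds at time 0 shows that \<open>A\<close> and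
    \<open>V\<close> are nonnegative.\<close>
  have A0: "A \<ge> 0" using order_trans[OF norm_ge_zero A[of 0]] T0 by simp
  have V0: "V \<ge> 0" using order_trans[OF wasserstein_dist_nonneg V[of 0]] T0 by simp
  have int_h: "(?h has_integral (L * (A + V) * exp (l * t) / l - L * (A + V) * exp (l * 0) / l)) {0..t}"
    using t l by (intro fundamental_theorem_of_calculus)
      (auto intro!: derivative_eq_intros simp: has_real_derivative_iff_has_vector_derivative[symmetric])
  have "norm (drift \<mu> x t - drift \<mu>' x' t) = norm (integral {0..t} (\<lambda>s. ?g s - ?g' s))"
    using drift_eq_integral[OF x(1) mu(1) t] drift_eq_integral[OF x(2) mu(2) t]
    by (simp add: Henstock_Kurzweil_Integration.integral_diff)
  also have "\<dots> \<le> integral {0..t} ?h"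
  proof (rule integral_norm_bound_integral)
    show "(\<lambda>s. ?g s - ?g' s) integrable_on {0..t}"
      using drift_eq_integral[OF x(1) mu(1) t] drift_eq_integral[OF x(2) mu(2) t]
      by (intro integrable_diff)
    show "?h integrable_on {0..t}" using int_h by blast
    fix s assume "s \<in> {0..t}"
    then have s: "s \<in> {0..T}" using t by auto
    have "norm (?g s - ?g' s) \<le> L * (norm (x s - x' s) + flow_dist s \<mu> \<mu>')"
      using Lipschitz[OF s] flow_in_wasserstein_space mu s by blast
    also have "\<dots> \<le> L * (exp (l * s) * A + exp (l * s) * V)"
      using A[OF s] V[OF s] L by (intro mult_left_mono add_mono) auto
    finally show "norm (?g s - ?g' s) \<le> ?h s"
      by (simp add: algebra_simps)
  qed
  also have "\<dots> \<le> L / l * exp (l * t) * (A + V)"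
  proof -
    \<comment> \<open>The antiderivative's value at 0 is subtracted; being nonnegative, it may be
      dropped.\<close>
    have "integral {0..t} ?h = L / l * exp (l * t) * (A + V) - L / l * (A + V)"
      using integral_unique[OF int_h] by simp
    moreover have "L / l * (A + V) \<ge> 0" using A0 V0 L l by simp
    ultimately show ?thesis by simp
  qed
  finally show ?thesis .
qed


section \<open>The map f^\<mu>: its equation, Lipschitz bound and stability\<close>

lemma inverse_solution_map_eq:
  "inverse_solution_map T b \<mu> x = (x 0, \<lambda>t\<in>{0..T}. x t - x 0 - drift \<mu> x t)"
  by (simp add: inverse_solution_map_def drift_def)

lemma inverse_solution_map_in_inputs:
  assumes "x \<in> mspace paths" "\<mu> \<in> path_laws"
  shows "inverse_solution_map T b \<mu> x \<in> mspace inputs"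
  using assms continuous_on_drift[OF assms] T0
  by (auto simp: inverse_solution_map_eq mspace_input_metric drift_0 mspace_path_metric[of x]
      intro!: restrict_in_path_metric continuous_intros)

text \<open>At time 0 drift and noise vanish, which identifies the initial value; the rest is
  rearrangement. The noise path is extensional, so agreement on \<open>{0..T}\<close> is equality of
  functions.\<close>

lemma solves_integral_equation_iff:
  assumes x: "x \<in> mspace paths" and mu: "\<mu> \<in> path_laws" and z: "z \<in> mspace inputs"
  shows "solves_integral_equation T (\<lambda>s y. b s y (time_marginal s \<mu>)) (fst z) (snd z) x
    \<longleftrightarrow> inverse_solution_map T b \<mu> x = z"
proof -
  have z0: "snd z 0 = 0" and ext: "snd z \<in> extensional {0..T}"
    using z by (auto simp: mspace_input_metric mspace_path_metric)
  have "solves_integral_equation T (\<lambda>s y. b s y (time_marginal s \<mu>)) (fst z) (snd z) x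
    \<longleftrightarrow> (\<forall>t\<in>{0..T}. x t = fst z + drift \<mu> x t + snd z t)"
    using x integrable[OF x mu] by (simp add: solves_integral_equation_def drift_def)
  also have "\<dots> \<longleftrightarrow> x 0 = fst z \<and> (\<forall>t\<in>{0..T}. x t - x 0 - drift \<mu> x t = snd z t)"
    using T0 z0 drift_0[of \<mu> x] by (auto simp: algebra_simps)
  also have "\<dots> \<longleftrightarrow> x 0 = fst z \<and> (\<lambda>t\<in>{0..T}. x t - x 0 - drift \<mu> x t) = snd z"
    using ext by (auto simp: fun_eq_iff extensional_def restrict_def)
  also have "\<dots> \<longleftrightarrow> inverse_solution_map T b \<mu> x = z"
    by (cases z) (auto simp: inverse_solution_map_eq)
  finally show ?thesis .
qed

text \<open>In the constant 3, one unit is for the initial value and two are for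
  \<open>x t - x 0\<close>. The summand \<open>L * exp T\<close> is the weighted drift estimate at
  rate 1, the weights lying between 1 and \<open>exp T\<close>.\<close>

lemma inverse_solution_map_Lipschitz:
  assumes x: "x \<in> mspace paths" "x' \<in> mspace paths" and mu: "\<mu> \<in> path_laws" "\<mu>' \<in> path_laws"
    and V: "\<And>s. s \<in> {0..T} \<Longrightarrow> flow_dist s \<mu> \<mu>' \<le> V"
  shows "mdist inputs (inverse_solution_map T b \<mu> x) (inverse_solution_map T b \<mu>' x')
    \<le> (3 + L * exp T) * (mdist paths x x' + V)"
proof -
  let ?f = "inverse_solution_map T b \<mu> x" and ?f' = "inverse_solution_map T b \<mu>' x'" and ?D = "mdist paths x x'"
  have D: "norm (x s - x' s) \<le> ?D" if "s \<in> {0..T}" for s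
    using dist_le_mdist_path_metric[OF x that] by (simp add: dist_norm)
  have V0: "V \<ge> 0" using order_trans[OF wasserstein_dist_nonneg V[of 0]] T0 by simp
  have "norm (drift \<mu> x t - drift \<mu>' x' t) \<le> L * exp T * (?D + V)" if t: "t \<in> {0..T}" for t
  proof -
    have "norm (drift \<mu> x t - drift \<mu>' x' t) \<le> L / 1 * exp (1 * t) * (?D + V)"
    proof (rule drift_diff_le[OF x mu _ _ _ t])
      fix s assume s: "s \<in> {0..T}"
      have "1 * ?D \<le> exp (1 * s) * ?D" "1 * V \<le> exp (1 * s) * V"
        using s V0 by (intro mult_right_mono; simp)+
      then show "norm (x s - x' s) \<le> exp (1 * s) * ?D" "flow_dist s \<mu> \<mu>' \<le> exp (1 * s) * V"
        using D[OF s] V[OF s] by simp_all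
    qed simp
    also have "\<dots> \<le> L * exp T * (?D + V)"
      using t L V0 by (auto intro!: mult_right_mono)
    finally show ?thesis .
  qed
  note drift = this
  have "mdist paths (snd ?f) (snd ?f') \<le> 2 * ?D + L * exp T * (?D + V)"
  proof (subst mdist_path_metric_le_iff[OF _ _ T0], goal_cases)
    case 3
    show ?case
    proof
      fix t assume t: "t \<in> {0..T}"
      have "dist (snd ?f t) (snd ?f' t) = norm ((x t - x' t) - (x 0 - x' 0) - (drift \<mu> x t - drift \<mu>' x' t))"
        using t by (simp add: inverse_solution_map_eq dist_norm algebra_simps)
      also have "\<dots> \<le> norm (x t - x' t) + norm (x 0 - x' 0) + norm (drift \<mu> x t - drift \<mu>' x' t)"
        by (rule order_trans[OF norm_triangle_ineq4 add_right_mono[OF norm_triangle_ineq4]])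
      also have "\<dots> \<le> 2 * ?D + L * exp T * (?D + V)"
        using D[OF t] D[of 0] T0 drift[OF t] by simp
      finally show "dist (snd ?f t) (snd ?f' t) \<le> 2 * ?D + L * exp T * (?D + V)" .
    qed
  qed (use inverse_solution_map_in_inputs x mu in \<open>auto simp: mspace_input_metric\<close>)
  moreover have "dist (fst ?f) (fst ?f') \<le> ?D"
    using D[of 0] T0 by (simp add: inverse_solution_map_eq dist_norm)
  ultimately have "mdist inputs ?f ?f' \<le> 3 * ?D + L * exp T * (?D + V)"
    using mdist_input_metric_bounds(3)[of T ?f ?f'] by linarith
  also have "\<dots> \<le> (3 + L * exp T) * (?D + V)"
    using V0 by (simp add: algebra_simps)
  finally show ?thesis .
qed

text \<open>At rate \<open>5 * L\<close> the drift estimate carries the factor 1/5. With w the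
  maximal weighted distance of the paths and d the distance of the inputs, w \<le> 2 d + (w + V) /
  5, hence w \<le> 5/2 d + V / 4. The coefficient 1/4 leaves room for a later factor 2.\<close>

lemma solution_stability:
  assumes x: "x \<in> mspace paths" "x' \<in> mspace paths" and mu: "\<mu> \<in> path_laws" "\<mu>' \<in> path_laws"
    and V: "\<And>s. s \<in> {0..T} \<Longrightarrow> flow_dist s \<mu> \<mu>' \<le> exp (5 * L * s) * V"
    and t: "t \<in> {0..T}"
  shows "norm (x t - x' t) \<le> exp (5 * L * t) *
    (5 / 2 * mdist inputs (inverse_solution_map T b \<mu> x) (inverse_solution_map T b \<mu>' x') + V / 4)"
proof -
  let ?f = "inverse_solution_map T b \<mu> x" and ?f' = "inverse_solution_map T b \<mu>' x'"
  let ?d = "mdist inputs ?f ?f'" and ?w = "\<lambda>s. exp (- (5 * L * s)) * norm (x s - x' s)"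
  have "continuous_on {0..T} ?w"
    using x by (intro continuous_intros) (auto simp: mspace_path_metric)
  \<comment> \<open>The maximum is attained by continuity, so at \<open>s\<close> the same finite
    number stands on both sides of the estimate and can be absorbed.\<close>
  then obtain s where s: "s \<in> {0..T}" "\<And>r. r \<in> {0..T} \<Longrightarrow> ?w r \<le> ?w s"
    using continuous_attains_sup[of "{0..T}" ?w] T0 by auto
  have w: "norm (x r - x' r) = exp (5 * L * r) * ?w r" for r
    by (simp add: mult.assoc[symmetric] exp_add[symmetric])
  have drift: "norm (drift \<mu> x s - drift \<mu>' x' s) \<le> L / (5 * L) * exp (5 * L * s) * (?w s + V)"
  proof (rule drift_diff_le[OF x mu _ _ V s(1)])
    fix r assume "r \<in> {0..T}"
    then show "norm (x r - x' r) \<le> exp (5 * L * r) * ?w s"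
      using s(2) by (subst w) (simp add: mult_left_mono)
  qed (use L in auto)
  have in_in: "?f \<in> mspace inputs" "?f' \<in> mspace inputs"
    using inverse_solution_map_in_inputs x mu by auto
  have "norm (x s - x' s) = norm ((fst ?f - fst ?f') + (snd ?f s - snd ?f' s) + (drift \<mu> x s - drift \<mu>' x' s))"
    using s(1) by (simp add: inverse_solution_map_eq algebra_simps)
  also have "\<dots> \<le> norm (fst ?f - fst ?f') + norm (snd ?f s - snd ?f' s) + norm (drift \<mu> x s - drift \<mu>' x' s)"
    by (rule order_trans[OF norm_triangle_ineq add_right_mono[OF norm_triangle_ineq]])
  also have "\<dots> \<le> 2 * ?d + 1 / 5 * exp (5 * L * s) * (?w s + V)"
  proof -
    have "norm (fst ?f - fst ?f') \<le> ?d"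
      using mdist_input_metric_bounds(1)[of ?f ?f' T] by (simp only: dist_norm)
    moreover have "norm (snd ?f s - snd ?f' s) \<le> ?d"
    proof -
      have "snd ?f \<in> mspace paths" "snd ?f' \<in> mspace paths"
        using in_in by (simp_all add: mspace_input_metric)
      from dist_le_mdist_path_metric[OF this s(1)] show ?thesis
        unfolding dist_norm by (rule order_trans[OF _ mdist_input_metric_bounds(2)])
    qed
    moreover have "norm (drift \<mu> x s - drift \<mu>' x' s) \<le> 1 / 5 * exp (5 * L * s) * (?w s + V)"
      using drift L by simp
    ultimately show ?thesis by linarith
  qed
  finally have "?w s \<le> exp (- (5 * L * s)) * (2 * ?d + 1 / 5 * exp (5 * L * s) * (?w s + V))"
    by (intro mult_left_mono) auto
  also have "\<dots> = exp (- (5 * L * s)) * (2 * ?d) + 1 / 5 * (exp (- (5 * L * s)) * exp (5 * L * s)) * (?w s + V)"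
    by (simp add: distrib_left)
  also have "exp (- (5 * L * s)) * exp (5 * L * s) = 1"
    by (simp add: exp_add[symmetric])
  also have "exp (- (5 * L * s)) * (2 * ?d) \<le> 1 * (2 * ?d)"
    using s(1) L by (intro mult_right_mono) auto
  finally have "?w s \<le> 5 / 2 * ?d + V / 4"
    by (simp add: algebra_simps)
  then have "?w t \<le> 5 / 2 * ?d + V / 4"
    using s(2)[OF t] by linarith
  then show ?thesis
    by (subst w) (simp add: mult_left_mono)
qed

section \<open>Existence for the mean-field equation\<close>

text \<open>The law in the drift is the image of \<nu> under the very map being iterated, so a fixed
  point solves the pathwise equation under its own law. The equation then holds at every input, not
  only \<nu>-almost surely, which makes the result usable at a single prescribed input.\<close>

lemma ex_mean_field_solution:
  assumes nu: "\<nu> \<in> input_laws"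
  obtains X where "continuous_map (mtopology_of inputs) (mtopology_of paths) X"
    "distr \<nu> (borel_of (mtopology_of paths)) X \<in> path_laws"
    "\<And>z. z \<in> mspace inputs \<Longrightarrow>
       inverse_solution_map T b (distr \<nu> (borel_of (mtopology_of paths)) X) (X z) = z"
proof -
  interpret prob_space \<nu> by (rule wasserstein_spaceD[OF nu])
  let ?BF = "borel_of (mtopology_of paths)"
  have sp: "space \<nu> = mspace inputs" by (rule wasserstein_spaceD[OF nu])
  define z0 :: "(real ^ 'd) \<times> (real \<Rightarrow> real ^ 'd)" where "z0 = (0, zero_path)"
  have zero: "zero_path \<in> mspace paths" by (rule const_path_in_path_metric)
  have z0: "z0 \<in> mspace inputs"
    using zero T0 by (simp add: z0_def mspace_input_metric)
  \<comment> \<open>Growth weight: solutions grow at most linearly in the input, so dividing by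
    \<open>n\<close> gives bounded maps. The summand 1 ensures \<open>n z \<ge> 1\<close>, so that
    reciprocals are harmless and terms independent of the input are bounded by multiples of
    \<open>n z\<close>.\<close>
  define n where "n z = 1 + mdist inputs z0 z" for z
  have n1: "n z \<ge> 1" for z by (simp add: n_def)
  have n0: "n z > 0" for z using n1[of z] by linarith
  have cont_n: "continuous_map (mtopology_of inputs) euclideanreal n"
    unfolding n_def using z0 by (intro continuous_intros) auto
  \<comment> \<open>\<open>m\<close> is the norm of \<open>n\<close> in L^p(\<nu>), finite because
    \<nu> has a finite p-th moment.\<close>
  obtain m where m: "m \<ge> 0" "(\<integral>\<^sup>+z. ennreal (n z powr p) \<partial>\<nu>) = ennreal (m powr p)"
  proof -
    obtain e where e: "e \<ge> 0" "(\<integral>\<^sup>+z. ennreal (mdist inputs z0 z powr p) \<partial>\<nu>) = ennreal (e powr p)"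
      using ennreal_eq_powr[OF wasserstein_space_moment[OF nu z0] p0] p0 by auto
    have "(\<lambda>z. mdist inputs z0 z) \<in> borel_measurable \<nu>"
      using continuous_map_euclidean_measurable[OF continuous_on_mdist[OF z0]]
      by (simp add: measurable_wasserstein_space[OF nu])
    then have "(\<integral>\<^sup>+z. ennreal (n z powr p) \<partial>\<nu>) \<le> ennreal ((2 * 1 * e) powr p + (2 * 1) powr p)"
      using e p0 by (intro nn_integral_affine_powr_le[where d = "mdist inputs z0"]) (auto simp: n_def prob_space_axioms)
    also have "\<dots> < \<infinity>" by simp
    finally show ?thesis
      using ennreal_eq_powr[OF _ p0] that by blast
  qed
  have n_moment: "(\<integral>\<^sup>+z. ennreal ((n z * c) powr p) \<partial>\<nu>) = ennreal ((c * m) powr p)" if "c \<ge> 0" for c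
  proof -
    have "n \<in> borel_measurable \<nu>"
      using continuous_map_euclidean_measurable[OF cont_n] by (simp add: measurable_wasserstein_space[OF nu])
    then have "(\<integral>\<^sup>+z. ennreal (c powr p) * ennreal (n z powr p) \<partial>\<nu>) = ennreal (c powr p) * ennreal (m powr p)"
      by (subst nn_integral_cmult) (auto simp: m(2))
    then show ?thesis
      using that m(1) n0 by (simp add: powr_mult less_imp_le mult.commute flip: ennreal_mult)
  qed
  \<comment> \<open>Chosen so that \<open>L / l * (n z + m) \<le> n z / 2\<close>: because
    \<open>n z \<ge> 1\<close>, the sum is at most \<open>n z * (1 + m)\<close>.\<close>
  define l where "l = 2 * L * (1 + m)"
  have l: "l > 0" using L m by (simp add: l_def)
  have Ll: "L / l = 1 / (2 * (1 + m))" using L by (simp add: l_def)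
  define C where "C = cfunspace (mtopology_of inputs) paths"
  \<comment> \<open>\<open>up h\<close> is the candidate solution, of which \<open>h\<close> stores
    the quotient by both weights. \<open>S\<close> evaluates the right-hand side of the equation
    under the candidate's own law, and \<open>step\<close> divides by the weights again.\<close>
  define up where "up h z = (\<lambda>t\<in>{0..T}. (n z * exp (l * t)) *\<^sub>R h z t)" for h :: "_ \<Rightarrow> real \<Rightarrow> real ^ 'd" and z
  define law where "law h = distr \<nu> ?BF (up h)" for h
  define S where "S h z = (\<lambda>t\<in>{0..T}. fst z + snd z t + drift (law h) (up h z) t)" for h z
  define step where "step h = (\<lambda>z\<in>mspace inputs. \<lambda>t\<in>{0..T}. (1 / n z * exp (- (l * t))) *\<^sub>R S h z t)" for h
  have cont: "continuous_map (mtopology_of inputs) (mtopology_of paths) h"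
    and hF: "\<And>z. z \<in> mspace inputs \<Longrightarrow> h z \<in> mspace paths"
    if "h \<in> mspace C" for h
    using that by (auto simp: C_def)
  have cont_up: "continuous_map (mtopology_of inputs) (mtopology_of paths) (up h)" if "h \<in> mspace C" for h
    unfolding up_def using cont[OF that] cont_n T0
    by (intro continuous_map_path_scale continuous_intros)
  have upF: "up h z \<in> mspace paths" if "h \<in> mspace C" "z \<in> mspace inputs" for h z
    using cont_up[OF that(1)] that(2) by (auto simp: continuous_map_def)
  have meas_up: "up h \<in> \<nu> \<rightarrow>\<^sub>M ?BF" if "h \<in> mspace C" for h
    using continuous_map_measurable[OF cont_up[OF that]] by (simp add: measurable_wasserstein_space[OF nu])
  define zC where "zC = (\<lambda>z\<in>mspace inputs. zero_path)"
  have zC: "zC \<in> mspace C"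
    unfolding C_def
  proof (rule cfunspaceI[where c = zero_path and B = "mdist paths zero_path zero_path"])
    have "continuous_map (mtopology_of inputs) (mtopology_of paths) (\<lambda>_. zero_path)"
      using zero by simp
    then show "continuous_map (mtopology_of inputs) (mtopology_of paths) zC"
      by (rule continuous_map_eq) (simp add: zC_def)
  qed (use zero in \<open>auto simp: zC_def\<close>)
  have up_zC: "up zC z = zero_path" if "z \<in> mspace inputs" for z
    using that by (auto simp: up_def zC_def fun_eq_iff)
  have dist_C: "norm (h z t - h' z t) \<le> mdist C h h'"
    if "h \<in> mspace C" "h' \<in> mspace C" "z \<in> mspace inputs" "t \<in> {0..T}" for h h' z t
    using dist_le_mdist_path_metric[OF hF hF, OF that(1,3) that(2,3) that(4)]
      mdist_cfunspace_imp_mdist_le[of h "mtopology_of inputs" paths h' "mdist C h h'" z] that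
    unfolding C_def dist_norm by auto
  have up_diff: "norm (up h z t - up h' z t) \<le> exp (l * t) * (n z * mdist C h h')"
    if "h \<in> mspace C" "h' \<in> mspace C" "z \<in> mspace inputs" "t \<in> {0..T}" for h h' z t
  proof -
    have "up h z t - up h' z t = (n z * exp (l * t)) *\<^sub>R (h z t - h' z t)"
      using that(4) by (simp add: up_def scaleR_diff_right)
    then have "norm (up h z t - up h' z t) = n z * exp (l * t) * norm (h z t - h' z t)"
      using n0[of z] by simp
    also have "\<dots> \<le> n z * exp (l * t) * mdist C h h'"
      using dist_C[OF that] n0[of z] by (intro mult_left_mono) auto
    finally show ?thesis by (simp add: mult_ac)
  qed
  \<comment> \<open>\<open>up h z\<close> is within a constant multiple of \<open>n z\<close> from
    the zero path, and \<open>n\<close> has a finite p-th moment.\<close>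
  have law: "law h \<in> path_laws" if h: "h \<in> mspace C" for h
    unfolding law_def
  proof (rule distr_in_wasserstein_space[OF prob_space_axioms meas_up[OF h] zero])
    let ?K = "exp (l * T) * mdist C zC h"
    have "(\<integral>\<^sup>+z. ennreal (mdist paths zero_path (up h z) powr p) \<partial>\<nu>) \<le> (\<integral>\<^sup>+z. ennreal ((n z * ?K) powr p) \<partial>\<nu>)"
    proof (intro nn_integral_mono ennreal_leI powr_mono2)
      fix z assume "z \<in> space \<nu>"
      then have z: "z \<in> mspace inputs" using sp by simp
      show "mdist paths zero_path (up h z) \<le> n z * ?K"
        unfolding mdist_path_metric_le_iff[OF zero upF[OF h z] T0]
      proof
        fix t assume t: "t \<in> {0..T}"
        have "dist (zero_path t) (up h z t) \<le> exp (l * t) * (n z * mdist C zC h)"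
          using up_diff[OF zC h z t] by (simp add: up_zC[OF z] dist_norm)
        also have "\<dots> \<le> exp (l * T) * (n z * mdist C zC h)"
          using t l n0[of z] by (intro mult_right_mono) auto
        finally show "dist (zero_path t) (up h z t) \<le> n z * ?K" by (simp add: mult_ac)
      qed
    qed (use p0 in auto)
    also have "\<dots> < \<infinity>" by (simp add: n_moment)
    finally show "(\<integral>\<^sup>+z. ennreal (mdist paths zero_path (up h z) powr p) \<partial>\<nu>) < \<infinity>" .
  qed
  \<comment> \<open>The two candidates are coupled through their common input \<open>z\<close>;
    integrating the growth weight produces \<open>m\<close>.\<close>
  have flow: "flow_dist t (law h) (law h') \<le> exp (l * t) * (mdist C h h' * m)"
    if h: "h \<in> mspace C" "h' \<in> mspace C" and t: "t \<in> {0..T}" for h h' t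
    unfolding law_def
  proof (rule wasserstein_dist_time_marginal_le[OF meas_up[OF h(1)] meas_up[OF h(2)] t p0])
    have "(\<integral>\<^sup>+z. ennreal (dist (up h z t) (up h' z t) powr p) \<partial>\<nu>)
        \<le> (\<integral>\<^sup>+z. ennreal ((n z * (exp (l * t) * mdist C h h')) powr p) \<partial>\<nu>)"
    proof (intro nn_integral_mono ennreal_leI powr_mono2)
      fix z assume "z \<in> space \<nu>"
      then have z: "z \<in> mspace inputs" using sp by simp
      show "dist (up h z t) (up h' z t) \<le> n z * (exp (l * t) * mdist C h h')"
        using up_diff[OF h z t] by (simp add: dist_norm mult_ac)
    qed (use p0 in auto)
    also have "\<dots> = ennreal ((exp (l * t) * (mdist C h h' * m)) powr p)"
      by (subst n_moment) (auto simp: mult_ac)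
    finally show "(\<integral>\<^sup>+z. ennreal (dist (up h z t) (up h' z t) powr p) \<partial>\<nu>)
      \<le> ennreal ((exp (l * t) * (mdist C h h' * m)) powr p)" .
  qed (use m in simp)
  have drift_diff: "norm (drift (law h) (up h z) t - drift (law h') (up h' z) t) \<le> n z * exp (l * t) * (mdist C h h' / 2)"
    if h: "h \<in> mspace C" "h' \<in> mspace C" and z: "z \<in> mspace inputs" and t: "t \<in> {0..T}" for h h' z t
  proof -
    have "norm (drift (law h) (up h z) t - drift (law h') (up h' z) t)
        \<le> L / l * exp (l * t) * (n z * mdist C h h' + mdist C h h' * m)"
      using upF h z law up_diff[OF h z] flow[OF h] l t by (intro drift_diff_le) auto
    also have "n z * mdist C h h' + mdist C h h' * m \<le> n z * (1 + m) * mdist C h h'"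
    proof -
      have "mdist C h h' * m \<le> n z * (mdist C h h' * m)"
        using mult_right_mono[OF n1[of z], of "mdist C h h' * m"] m by simp
      then show ?thesis by (simp add: algebra_simps)
    qed
    then have "L / l * exp (l * t) * (n z * mdist C h h' + mdist C h h' * m)
        \<le> L / l * exp (l * t) * (n z * (1 + m) * mdist C h h')"
      using L l by (intro mult_left_mono) auto
    also have "\<dots> = n z * exp (l * t) * (mdist C h h' / 2)"
      unfolding Ll using m by (simp add: field_simps)
    finally show ?thesis .
  qed
  have step_diff: "norm (step h z t - step h' z t) \<le> mdist C h h' / 2"
    if h: "h \<in> mspace C" "h' \<in> mspace C" and z: "z \<in> mspace inputs" and t: "t \<in> {0..T}" for h h' z t
  proof -
    let ?w = "1 / n z * exp (- (l * t))"
    have "step h z t - step h' z t = ?w *\<^sub>R (drift (law h) (up h z) t - drift (law h') (up h' z) t)"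
      using z t by (simp add: step_def S_def scaleR_diff_right[symmetric])
    then have "norm (step h z t - step h' z t) = ?w * norm (drift (law h) (up h z) t - drift (law h') (up h' z) t)"
      using n0[of z] by simp
    also have "\<dots> \<le> ?w * (n z * exp (l * t) * (mdist C h h' / 2))"
      using drift_diff[OF that] n0[of z] by (intro mult_left_mono) auto
    also have "\<dots> = mdist C h h' / 2"
      using n0[of z] by (simp add: exp_minus field_simps)
    finally show ?thesis .
  qed
  have SF: "S h z \<in> mspace paths" if "h \<in> mspace C" "z \<in> mspace inputs" for h z
    unfolding S_def using that continuous_on_drift[OF upF[OF that] law[OF that(1)]]
    by (intro restrict_in_path_metric continuous_intros) (auto simp: mspace_input_metric mspace_path_metric)
  \<comment> \<open>Only the input varies here: the law is fixed, so the flow term is zero and the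
    drift depends Lipschitz continuously on the path.\<close>
  have cont_S: "continuous_map (mtopology_of inputs) (mtopology_of paths) (S h)" if h: "h \<in> mspace C" for h
  proof (rule continuous_map_into_metricI)
    fix x assume "x \<in> topspace (mtopology_of inputs)"
    then have x: "x \<in> mspace inputs" by simp
    let ?D = "\<lambda>y. mdist paths (up h x) (up h y)"
    let ?\<delta> = "\<lambda>y. dist (fst x) (fst y) + mdist paths (snd x) (snd y) + L * exp T * ?D y"
    have "continuous_map (mtopology_of inputs) (mtopology_of paths) (\<lambda>_. snd x)"
      "continuous_map (mtopology_of inputs) (mtopology_of paths) (\<lambda>_. up h x)"
      using x upF[OF h x] by (auto simp: mspace_input_metric)
    then have "continuous_map (mtopology_of inputs) euclideanreal
        (\<lambda>y. norm (fst x - fst y) + mdist paths (snd x) (snd y) + L * exp T * ?D y)"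
      using cont_up[OF h] continuous_map_input_fst continuous_map_input_snd
      by (intro continuous_intros) auto
    then have "continuous_map (mtopology_of inputs) euclideanreal ?\<delta>"
      by (simp add: dist_norm)
    moreover have "?\<delta> x = 0"
    proof -
      have "mdist paths (snd x) (snd x) = 0" "?D x = 0"
        using x upF[OF h x] by (simp_all add: mspace_input_metric)
      then show ?thesis by simp
    qed
    moreover have "mdist paths (S h x) (S h y) \<le> ?\<delta> y" if y: "y \<in> mspace inputs" for y
      unfolding mdist_path_metric_le_iff[OF SF[OF h x] SF[OF h y] T0]
    proof
      fix t assume t: "t \<in> {0..T}"
      have "norm (drift (law h) (up h x) t - drift (law h) (up h y) t) \<le> L / 1 * exp (1 * t) * (?D y + 0)"
      proof (rule drift_diff_le[OF upF[OF h x] upF[OF h y] law[OF h] law[OF h] _ _ _ t])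
        fix s assume s: "s \<in> {0..T}"
        have "norm (up h x s - up h y s) \<le> ?D y"
          using dist_le_mdist_path_metric[OF upF[OF h x] upF[OF h y] s] by (simp add: dist_norm)
        also have "\<dots> \<le> exp (1 * s) * ?D y"
          using mult_right_mono[of 1 "exp (1 * s)" "?D y"] s by simp
        finally show "norm (up h x s - up h y s) \<le> exp (1 * s) * ?D y" .
        show "flow_dist s (law h) (law h) \<le> exp (1 * s) * 0"
          using wasserstein_dist_self[OF flow_in_wasserstein_space[OF law[OF h] s] p0] by simp
      qed simp
      also have "\<dots> \<le> L * exp T * ?D y"
        using t L by (auto intro!: mult_right_mono)
      finally have "norm (drift (law h) (up h x) t - drift (law h) (up h y) t) \<le> L * exp T * ?D y" .
      moreover have "norm (snd x t - snd y t) \<le> mdist paths (snd x) (snd y)"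
        using dist_le_mdist_path_metric[of "snd x" T "snd y" t] x y t
        by (simp add: mspace_input_metric dist_norm)
      moreover have "S h x t - S h y t = (fst x - fst y) + (snd x t - snd y t) + (drift (law h) (up h x) t - drift (law h) (up h y) t)"
        using t by (simp add: S_def)
      ultimately show "dist (S h x t) (S h y t) \<le> ?\<delta> y"
        using norm_triangle_ineq[of "fst x - fst y + (snd x t - snd y t)" "drift (law h) (up h x) t - drift (law h) (up h y) t"]
          norm_triangle_ineq[of "fst x - fst y" "snd x t - snd y t"]
        by (simp add: dist_norm)
    qed
    ultimately show "\<exists>\<delta>. continuous_map (mtopology_of inputs) euclideanreal \<delta> \<and> \<delta> x = 0 \<and>
        (\<forall>y\<in>topspace (mtopology_of inputs). mdist paths (S h x) (S h y) \<le> \<delta> y)"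
      by (intro exI[of _ ?\<delta>]) simp
  qed (use SF h in simp)
  have cont_step: "continuous_map (mtopology_of inputs) (mtopology_of paths) (step h)" if h: "h \<in> mspace C" for h
  proof -
    have "continuous_map (mtopology_of inputs) (mtopology_of paths)
        (\<lambda>z. \<lambda>t\<in>{0..T}. (1 / n z * exp (- (l * t))) *\<^sub>R S h z t)"
      using n0 cont_n by (intro continuous_map_path_scale cont_S h T0 continuous_intros) (auto simp: less_le)
    then show ?thesis
      by (rule continuous_map_eq) (simp add: step_def)
  qed
  have stepF: "step h z \<in> mspace paths" if "h \<in> mspace C" "z \<in> mspace inputs" for h z
    using cont_step[OF that(1)] that(2) by (auto simp: continuous_map_def)
  obtain B where B: "\<And>t. t \<in> {0..T} \<Longrightarrow> norm (drift (law zC) zero_path t) \<le> B"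
  proof -
    have "\<exists>B. \<forall>t\<in>{0..T}. norm (drift (law zC) zero_path t) \<le> B"
      using compact_imp_bounded[OF compact_continuous_image[OF continuous_on_drift[OF zero law[OF zC]] compact_Icc]]
      unfolding bounded_iff by auto
    then show ?thesis using that by blast
  qed
  \<comment> \<open>Initial value and noise are each at most \<open>n z\<close>, which gives the 2;
    \<open>B\<close> bounds the drift along the zero path, which does not depend on the
    input.\<close>
  have step_zC: "norm (step zC z t) \<le> 2 + B" if z: "z \<in> mspace inputs" and t: "t \<in> {0..T}" for z t
  proof -
    let ?w = "1 / n z * exp (- (l * t))"
    have "norm (fst z) \<le> n z" "norm (snd z t) \<le> n z"
      using mdist_input_metric_bounds(1)[of z0 z T] mdist_input_metric_bounds(2)[of T z0 z] z0 z t
        dist_le_mdist_path_metric[of "snd z0" T "snd z" t]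
      by (auto simp: n_def z0_def mspace_input_metric)
    moreover have "B \<ge> 0" using order_trans[OF norm_ge_zero B[OF t]] .
    then have "B \<le> n z * B" using mult_right_mono[OF n1[of z], of B] by simp
    ultimately have "norm (fst z + snd z t + drift (law zC) zero_path t) \<le> n z * (2 + B)"
      using B[OF t] norm_triangle_ineq[of "fst z + snd z t" "drift (law zC) zero_path t"]
        norm_triangle_ineq[of "fst z" "snd z t"] by (simp add: algebra_simps)
    then have "?w * norm (fst z + snd z t + drift (law zC) zero_path t) \<le> ?w * (n z * (2 + B))"
      using n0[of z] by (intro mult_left_mono) auto
    also have "\<dots> = exp (- (l * t)) * (2 + B)"
      using n0[of z] by simp
    also have "\<dots> \<le> 1 * (2 + B)"
      using \<open>B \<ge> 0\<close> l t by (intro mult_right_mono) auto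
    finally show ?thesis
      using z t n0[of z] by (simp add: step_def S_def up_zC)
  qed
  \<comment> \<open>Boundedness of \<open>step h\<close> follows from that of \<open>step zC\<close>
    and the contraction estimate.\<close>
  have step_C: "step h \<in> mspace C" if h: "h \<in> mspace C" for h
    unfolding C_def
  proof (rule cfunspaceI[OF _ _ zero])
    show "step h \<in> extensional (topspace (mtopology_of inputs))"
      by (simp add: step_def)
    show "continuous_map (mtopology_of inputs) (mtopology_of paths) (step h)"
      by (rule cont_step[OF h])
    fix z assume "z \<in> topspace (mtopology_of inputs)"
    then have z: "z \<in> mspace inputs" by simp
    show "mdist paths zero_path (step h z) \<le> 2 + B + mdist C h zC / 2"
      unfolding mdist_path_metric_le_iff[OF zero stepF[OF h z] T0]
    proof
      fix t assume t: "t \<in> {0..T}"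
      then show "dist (zero_path t) (step h z t) \<le> 2 + B + mdist C h zC / 2"
        using step_diff[OF h zC z t] step_zC[OF z t] norm_triangle_sub[of "step h z t" "step zC z t"]
        by simp
    qed
  qed
  have contraction: "mdist C (step h) (step h') \<le> 1 / 2 * mdist C h h'"
    if h: "h \<in> mspace C" "h' \<in> mspace C" for h h'
    unfolding C_def
  proof (rule mdist_cfunspace_le)
    fix z assume "z \<in> topspace (mtopology_of inputs)"
    then have z: "z \<in> mspace inputs" by simp
    have "mdist paths (step h z) (step h' z) \<le> mdist C h h' / 2"
      unfolding mdist_path_metric_le_iff[OF stepF[OF h(1) z] stepF[OF h(2) z] T0]
      using step_diff[OF h z] by (simp add: dist_norm)
    then show "mdist paths (step h z) (step h' z) \<le> 1 / 2 * mdist (cfunspace (mtopology_of inputs) paths) h h'"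
      by (simp add: C_def)
  qed simp
  have "mcomplete_of C"
    unfolding C_def
    using Metric_space.mcomplete_cfunspace[OF Metric_space_mspace_mdist, of paths "mtopology_of inputs"]
      mcomplete_of_path_metric[of T]
    by (simp add: Metric_space.Self_def mcomplete_of_def)
  then obtain h where h: "h \<in> mspace C" "step h = h"
    using Metric_space.Banach_fixedpoint_thm[OF Metric_space_mspace_mdist, of C step "1 / 2"]
      zC step_C contraction unfolding mcomplete_of_def by (auto simp: Pi_iff)
  show thesis
  proof (rule that)
    show "continuous_map (mtopology_of inputs) (mtopology_of paths) (up h)"
      by (rule cont_up[OF h(1)])
    show law_h: "distr \<nu> ?BF (up h) \<in> path_laws"
      using law[OF h(1)] by (simp add: law_def)
    fix z assume z: "z \<in> mspace inputs"
    \<comment> \<open>At the fixed point the weights cancel and the original equation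
      remains.\<close>
    have eq: "up h z t = S h z t" if t: "t \<in> {0..T}" for t
    proof -
      have "up h z t = (n z * exp (l * t)) *\<^sub>R step h z t"
        using t by (simp add: up_def h(2))
      also have "\<dots> = S h z t"
        using t z n0[of z] by (simp add: step_def exp_minus)
      finally show ?thesis .
    qed
    have "solves_integral_equation T (\<lambda>s y. b s y (time_marginal s (law h))) (fst z) (snd z) (up h z)"
      using eq upF[OF h(1) z] integrable[OF upF[OF h(1) z] law[OF h(1)]]
      by (simp add: solves_integral_equation_def drift_def S_def)
    then show "inverse_solution_map T b (distr \<nu> ?BF (up h)) (up h z) = z"
      using solves_integral_equation_iff[OF upF[OF h(1) z] law[OF h(1)] z] by (simp add: law_def)
  qed
qed

section \<open>Push-forwards under f^\<mu> and under the solution map\<close>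

definition input_law :: "(real \<Rightarrow> real ^ 'd) measure \<Rightarrow> ((real ^ 'd) \<times> (real \<Rightarrow> real ^ 'd)) measure" where
  "input_law \<mu> = distr \<mu> (borel_of (mtopology_of inputs)) (inverse_solution_map T b \<mu>)"

lemma flow_dist_self:
  assumes "\<mu> \<in> path_laws" "s \<in> {0..T}"
  shows "flow_dist s \<mu> \<mu> = 0"
  using wasserstein_dist_self[OF flow_in_wasserstein_space[OF assms] p0] .

lemma continuous_map_inverse_solution_map:
  assumes mu: "\<mu> \<in> path_laws"
  shows "continuous_map (mtopology_of paths) (mtopology_of inputs) (inverse_solution_map T b \<mu>)"
proof -
  have "Lipschitz_continuous_map paths inputs (inverse_solution_map T b \<mu>)"
    using inverse_solution_map_Lipschitz[OF _ _ mu mu, of _ _ 0] inverse_solution_map_in_inputs[OF _ mu]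
      flow_dist_self[OF mu]
    by (auto simp: Lipschitz_continuous_map_def)
  then show ?thesis by (rule Lipschitz_continuous_imp_continuous_map)
qed

lemma measurable_inverse_solution_map:
  assumes mu: "\<mu> \<in> path_laws"
  shows "inverse_solution_map T b \<mu> \<in> \<mu> \<rightarrow>\<^sub>M borel_of (mtopology_of inputs)"
  using continuous_map_measurable[OF continuous_map_inverse_solution_map[OF mu]]
  by (simp add: measurable_wasserstein_space[OF mu])

text \<open>Stability with equal inputs and equal flows, where the right-hand side is zero.\<close>

lemma inverse_solution_map_inj:
  assumes x: "x \<in> mspace paths" "x' \<in> mspace paths" and mu: "\<mu> \<in> path_laws"
    and eq: "inverse_solution_map T b \<mu> x = inverse_solution_map T b \<mu> x'"
  shows "x = x'"
proof -
  have "x t = x' t" if "t \<in> {0..T}" for t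
    using solution_stability[OF x mu mu _ that, of 0] flow_dist_self[OF mu] eq
      mdist_self[OF inverse_solution_map_in_inputs[OF x(2) mu]] by simp
  then show ?thesis
    using x by (auto simp: mspace_path_metric intro: extensionalityI)
qed

text \<open>Freezing the flow at \<open>\<mu>\<close> turns the mean-field equation into the equation that defines the solution map, so
  the mean-field existence result, applied to an arbitrary input law, also yields surjectivity.\<close>

lemma inverse_solution_map_surj:
  assumes mu: "\<mu> \<in> path_laws" and z: "z \<in> mspace inputs"
  obtains x where "x \<in> mspace paths" "inverse_solution_map T b \<mu> x = z"
proof -
  let ?b = "\<lambda>s x (\<rho> :: (real ^ 'd) measure). b s x (time_marginal s \<mu>)"
  \<comment> \<open>The measure argument of \<open>?b\<close> is a dummy, so its increments obey the
    bound for equal measures, which lies below the one demanded for \<rho> and \<rho>'.\<close>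
  interpret frozen: mean_field_drift T p L ?b
  proof
    fix t x x' \<rho> \<rho>' assume t: "t \<in> {0..T}"
    have "norm (b t x (time_marginal t \<mu>) - b t x' (time_marginal t \<mu>)) \<le> L * (norm (x - x') + flow_dist t \<mu> \<mu>)"
      by (rule Lipschitz[OF t flow_in_wasserstein_space[OF mu t] flow_in_wasserstein_space[OF mu t]])
    also have "\<dots> \<le> L * (norm (x - x') + wasserstein_dist p euclidean_metric \<rho> \<rho>')"
      using L wasserstein_dist_nonneg[of p euclidean_metric \<rho> \<rho>'] by (simp add: flow_dist_self[OF mu t])
    finally show "norm (b t x (time_marginal t \<mu>) - b t x' (time_marginal t \<mu>))
      \<le> L * (norm (x - x') + wasserstein_dist p euclidean_metric \<rho> \<rho>')" .
  next
    fix x :: "real \<Rightarrow> real ^ 'd" assume "x \<in> mspace paths"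
    then show "set_integrable lborel {0..T} (\<lambda>s. b s (x s) (time_marginal s \<mu>))"
      by (rule integrable[OF _ mu])
  qed (fact T p L)+
  \<comment> \<open>The point mass at \<open>z\<close>, written as an empirical measure of one
    sample, serves as input law; the solution is then read off at \<open>z\<close> itself.\<close>
  define \<nu> where "\<nu> = empirical_measure (mtopology_of inputs) 1 (\<lambda>_. z)"
  have "\<nu> \<in> input_laws"
    unfolding \<nu>_def using z by (intro empirical_measure_in_wasserstein_space) auto
  then obtain X where X: "continuous_map (mtopology_of inputs) (mtopology_of paths) X"
    "\<And>z. z \<in> mspace inputs \<Longrightarrow>
       inverse_solution_map T ?b (distr \<nu> (borel_of (mtopology_of paths)) X) (X z) = z"
    by (rule frozen.ex_mean_field_solution) blast
  show thesis
  proof (rule that)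
    show "X z \<in> mspace paths" using X(1) z by (auto simp: continuous_map_def)
    show "inverse_solution_map T b \<mu> (X z) = z"
      using X(2)[OF z] by (simp add: inverse_solution_map_def)
  qed
qed

text \<open>Injectivity of f^\<mu> is uniqueness for the integral equation, which gives the
  \<open>THE\<close> in \<open>solution_map\<close> its meaning.\<close>

lemma solution_map_inverse:
  assumes mu: "\<mu> \<in> path_laws" and x: "x \<in> mspace paths"
  shows "solution_map T b \<mu> (inverse_solution_map T b \<mu> x) = x"
proof -
  let ?z = "inverse_solution_map T b \<mu> x"
  have z: "?z \<in> mspace inputs"
    by (rule inverse_solution_map_in_inputs[OF x mu])
  have "(THE y. solves_integral_equation T (\<lambda>s y. b s y (time_marginal s \<mu>)) (fst ?z) (snd ?z) y) = x"
  proof (rule the_equality)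
    show "solves_integral_equation T (\<lambda>s y. b s y (time_marginal s \<mu>)) (fst ?z) (snd ?z) x"
      using solves_integral_equation_iff[OF x mu z] by simp
    fix y assume y: "solves_integral_equation T (\<lambda>s y. b s y (time_marginal s \<mu>)) (fst ?z) (snd ?z) y"
    then have yF: "y \<in> mspace paths" by (simp add: solves_integral_equation_def)
    then show "y = x"
      using solves_integral_equation_iff[OF yF mu z] y inverse_solution_map_inj[OF yF x mu] by simp
  qed
  then show ?thesis
    by (simp add: solution_map_def case_prod_unfold)
qed

lemma solution_map:
  assumes mu: "\<mu> \<in> path_laws" and z: "z \<in> mspace inputs"
  shows "solution_map T b \<mu> z \<in> mspace paths" "inverse_solution_map T b \<mu> (solution_map T b \<mu> z) = z"
  using inverse_solution_map_surj[OF mu z] solution_map_inverse[OF mu] by metis+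

lemma solution_map_stability:
  assumes mu: "\<mu> \<in> path_laws" "\<mu>' \<in> path_laws" and z: "z \<in> mspace inputs" "z' \<in> mspace inputs"
    and V: "\<And>s. s \<in> {0..T} \<Longrightarrow> flow_dist s \<mu> \<mu>' \<le> exp (5 * L * s) * V"
    and t: "t \<in> {0..T}"
  shows "norm (solution_map T b \<mu> z t - solution_map T b \<mu>' z' t) \<le> exp (5 * L * t) * (5 / 2 * mdist inputs z z' + V / 4)"
  using solution_stability[OF solution_map(1)[OF mu(1) z(1)] solution_map(1)[OF mu(2) z(2)] mu V t]
  by (simp add: solution_map(2) mu z)

lemma continuous_map_solution_map:
  assumes mu: "\<mu> \<in> path_laws"
  shows "continuous_map (mtopology_of inputs) (mtopology_of paths) (solution_map T b \<mu>)"
proof -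
  have "Lipschitz_continuous_map inputs paths (solution_map T b \<mu>)"
    unfolding Lipschitz_continuous_map_def
  proof (intro conjI exI[of _ "exp (5 * L * T) * (5 / 2)"] ballI)
    fix z z' assume z: "z \<in> mspace inputs" "z' \<in> mspace inputs"
    show "mdist paths (solution_map T b \<mu> z) (solution_map T b \<mu> z') \<le> exp (5 * L * T) * (5 / 2) * mdist inputs z z'"
      unfolding mdist_path_metric_le_iff[OF solution_map(1)[OF mu z(1)] solution_map(1)[OF mu z(2)] T0]
    proof
      fix t assume t: "t \<in> {0..T}"
      have "norm (solution_map T b \<mu> z t - solution_map T b \<mu> z' t) \<le> exp (5 * L * t) * (5 / 2 * mdist inputs z z' + 0 / 4)"
        by (rule solution_map_stability[OF mu mu z _ t]) (simp add: flow_dist_self[OF mu])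
      also have "\<dots> \<le> exp (5 * L * T) * (5 / 2 * mdist inputs z z' + 0 / 4)"
        using t L by (intro mult_right_mono) auto
      finally show "dist (solution_map T b \<mu> z t) (solution_map T b \<mu> z' t) \<le> exp (5 * L * T) * (5 / 2) * mdist inputs z z'"
        by (simp add: dist_norm)
    qed
  qed (use solution_map(1)[OF mu] in auto)
  then show ?thesis by (rule Lipschitz_continuous_imp_continuous_map)
qed

lemma measurable_solution_map:
  assumes mu: "\<mu> \<in> path_laws" and nu: "\<nu> \<in> input_laws"
  shows "solution_map T b \<mu> \<in> \<nu> \<rightarrow>\<^sub>M borel_of (mtopology_of paths)"
  using continuous_map_measurable[OF continuous_map_solution_map[OF mu]]
  by (simp add: measurable_wasserstein_space[OF nu])

text \<open>Under a fixed flow f^\<mu> is Lipschitz, so the moment of the image is controlled by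
  that of \<mu>.\<close>

lemma input_law_in_input_laws:
  assumes mu: "\<mu> \<in> path_laws"
  shows "input_law \<mu> \<in> input_laws"
  unfolding input_law_def
proof (rule distr_in_wasserstein_space[OF wasserstein_spaceD(1)[OF mu] measurable_inverse_solution_map[OF mu]])
  have zero: "zero_path \<in> mspace paths" by (rule const_path_in_path_metric)
  then show z: "inverse_solution_map T b \<mu> zero_path \<in> mspace inputs"
    by (rule inverse_solution_map_in_inputs[OF _ mu])
  let ?C = "3 + L * exp T"
  have "(\<integral>\<^sup>+x. ennreal (mdist inputs (inverse_solution_map T b \<mu> zero_path) (inverse_solution_map T b \<mu> x) powr p) \<partial>\<mu>)
    \<le> (\<integral>\<^sup>+x. ennreal (?C powr p) * ennreal (mdist paths zero_path x powr p) \<partial>\<mu>)"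
  proof (rule nn_integral_mono)
    fix x assume "x \<in> space \<mu>"
    then have x: "x \<in> mspace paths" using wasserstein_spaceD(3)[OF mu] by simp
    have "mdist inputs (inverse_solution_map T b \<mu> zero_path) (inverse_solution_map T b \<mu> x) \<le> ?C * (mdist paths zero_path x + 0)"
      by (rule inverse_solution_map_Lipschitz[OF zero x mu mu]) (simp add: flow_dist_self[OF mu])
    then have "mdist inputs (inverse_solution_map T b \<mu> zero_path) (inverse_solution_map T b \<mu> x) powr p \<le> (?C * mdist paths zero_path x) powr p"
      using p0 by (intro powr_mono2) auto
    also have "\<dots> = ?C powr p * mdist paths zero_path x powr p"
      using L by (simp add: powr_mult)
    finally show "ennreal (mdist inputs (inverse_solution_map T b \<mu> zero_path) (inverse_solution_map T b \<mu> x) powr p)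
        \<le> ennreal (?C powr p) * ennreal (mdist paths zero_path x powr p)"
      by (simp flip: ennreal_mult)
  qed
  also have "\<dots> = ennreal (?C powr p) * (\<integral>\<^sup>+x. ennreal (mdist paths zero_path x powr p) \<partial>\<mu>)"
    using mdist_powr_measurable[OF zero, of p]
    by (intro nn_integral_cmult) (simp add: measurable_wasserstein_space[OF mu])
  also have "\<dots> < \<infinity>"
    using wasserstein_space_moment[OF mu zero] p0 by (simp add: ennreal_mult_less_top)
  finally show "(\<integral>\<^sup>+x. ennreal (mdist inputs (inverse_solution_map T b \<mu> zero_path) (inverse_solution_map T b \<mu> x) powr p) \<partial>\<mu>) < \<infinity>" .
qed

text \<open>For one and the same \<mu> the maps f^\<mu> and \<open>solution_map T b \<mu>\<close>
  are mutually inverse and measurable, so a push-forward by one is undone by the other. This turns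
  the fixed-point equation in \<open>Psi\<close> into the explicit
  \<open>input_law \<mu> = \<nu>\<close>.\<close>

lemma distr_solution_map_iff:
  assumes mu: "\<mu> \<in> path_laws" and nu: "\<nu> \<in> input_laws"
  shows "distr \<nu> (borel_of (mtopology_of paths)) (solution_map T b \<mu>) = \<mu> \<longleftrightarrow> input_law \<mu> = \<nu>"
proof
  let ?BF = "borel_of (mtopology_of paths)" and ?BE = "borel_of (mtopology_of inputs)"
  have f: "inverse_solution_map T b \<mu> \<in> ?BF \<rightarrow>\<^sub>M ?BE"
    by (rule continuous_map_measurable[OF continuous_map_inverse_solution_map[OF mu]])
  have S: "solution_map T b \<mu> \<in> ?BE \<rightarrow>\<^sub>M ?BF"
    by (rule continuous_map_measurable[OF continuous_map_solution_map[OF mu]])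
  {
    assume eq: "distr \<nu> ?BF (solution_map T b \<mu>) = \<mu>"
    have "input_law \<mu> = distr (distr \<nu> ?BF (solution_map T b \<mu>)) ?BE (inverse_solution_map T b \<mu>)"
      by (simp add: input_law_def eq)
    also have "\<dots> = distr \<nu> ?BE (inverse_solution_map T b \<mu> \<circ> solution_map T b \<mu>)"
      by (rule distr_distr[OF f measurable_solution_map[OF mu nu]])
    also have "\<dots> = distr \<nu> \<nu> (\<lambda>z. z)"
      using solution_map(2)[OF mu] wasserstein_spaceD(2,3)[OF nu] by (intro distr_cong) auto
    finally show "input_law \<mu> = \<nu>" by simp
  next
    assume eq: "input_law \<mu> = \<nu>"
    have "distr \<nu> ?BF (solution_map T b \<mu>) = distr (distr \<mu> ?BE (inverse_solution_map T b \<mu>)) ?BF (solution_map T b \<mu>)"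
      by (simp add: input_law_def flip: eq)
    also have "\<dots> = distr \<mu> ?BF (solution_map T b \<mu> \<circ> inverse_solution_map T b \<mu>)"
      by (rule distr_distr[OF S measurable_inverse_solution_map[OF mu]])
    also have "\<dots> = distr \<mu> \<mu> (\<lambda>x. x)"
      using solution_map_inverse[OF mu] wasserstein_spaceD(2,3)[OF mu] by (intro distr_cong) auto
    finally show "distr \<nu> ?BF (solution_map T b \<mu>) = \<mu>" by simp
  }
qed

text \<open>The mean-field solution coincides with the solution map under its own law, so that law
  is a fixed point.\<close>

lemma input_law_surj:
  assumes nu: "\<nu> \<in> input_laws"
  obtains \<mu> where "\<mu> \<in> path_laws" "input_law \<mu> = \<nu>"
proof -
  let ?BF = "borel_of (mtopology_of paths)" and ?BE = "borel_of (mtopology_of inputs)"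
  obtain X where X: "continuous_map (mtopology_of inputs) (mtopology_of paths) X"
    and mu: "distr \<nu> ?BF X \<in> path_laws"
    and inv: "\<And>z. z \<in> mspace inputs \<Longrightarrow> inverse_solution_map T b (distr \<nu> ?BF X) (X z) = z"
    using ex_mean_field_solution[OF nu] by blast
  have XF: "X z \<in> mspace paths" if "z \<in> mspace inputs" for z
    using X that by (auto simp: continuous_map_def)
  have "solution_map T b (distr \<nu> ?BF X) z = X z" if z: "z \<in> mspace inputs" for z
    using solution_map_inverse[OF mu XF[OF z]] by (simp add: inv[OF z])
  then have "distr \<nu> ?BF (solution_map T b (distr \<nu> ?BF X)) = distr \<nu> ?BF X"
    using wasserstein_spaceD(3)[OF nu] by (intro distr_cong) auto
  then show thesis
    using that mu distr_solution_map_iff[OF mu nu] by blast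
qed

section \<open>Lipschitz bounds in both directions\<close>

text \<open>A near-optimal coupling is pushed forward by the pair of maps. It also bounds the
  distance of the flows by \<open>e\<close>, so both terms of the pathwise Lipschitz bound are of
  order \<open>e\<close>. The 4 is a 2 from splitting the p-th power of a sum times a 2 from adding
  two equal powers.\<close>

lemma wasserstein_dist_input_law_le:
  assumes mu: "\<mu> \<in> path_laws" "\<mu>' \<in> path_laws"
  shows "wasserstein_dist p inputs (input_law \<mu>) (input_law \<mu>') \<le> 4 * (3 + L * exp T) * wasserstein_dist p paths \<mu> \<mu>'"
proof -
  let ?BF = "borel_of (mtopology_of paths)" and ?BE = "borel_of (mtopology_of inputs)"
  let ?f = "inverse_solution_map T b \<mu>" and ?f' = "inverse_solution_map T b \<mu>'" and ?C = "3 + L * exp T"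
  have C: "?C > 0" using L by (intro add_pos_pos) auto
  have le: "wasserstein_dist p inputs (input_law \<mu>) (input_law \<mu>') \<le> 4 * ?C * e" if e: "wasserstein_dist p paths \<mu> \<mu>' < e" for e
  proof -
    have e0: "e \<ge> 0" using e wasserstein_dist_nonneg[of p paths \<mu> \<mu>'] by simp
    obtain \<pi> where pi: "\<pi> \<in> couplings \<mu> \<mu>'"
      and cost: "(\<integral>\<^sup>+z. ennreal (mdist paths (fst z) (snd z) powr p) \<partial>\<pi>) \<le> ennreal (e powr p)"
      using wasserstein_dist_less_coupling[OF mu p0 e] by (auto intro: less_imp_le)
    have flow: "flow_dist s \<mu> \<mu>' \<le> e" if "s \<in> {0..T}" for s
      by (rule wasserstein_dist_time_marginal_coupling[OF pi mu that p0 e0 cost])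
    note sets = couplings_wasserstein_space(1)[OF pi mu]
    note space = couplings_wasserstein_space(2,3)[OF pi mu]
    have meas: "(\<lambda>z. ?f (fst z)) \<in> \<pi> \<rightarrow>\<^sub>M ?BE" "(\<lambda>z. ?f' (snd z)) \<in> \<pi> \<rightarrow>\<^sub>M ?BE"
      using measurable_compose[OF couplingsD(2)[OF pi] measurable_inverse_solution_map[OF mu(1)]]
        measurable_compose[OF couplingsD(3)[OF pi] measurable_inverse_solution_map[OF mu(2)]] by auto
    have "(\<integral>\<^sup>+z. ennreal (mdist inputs (?f (fst z)) (?f' (snd z)) powr p) \<partial>\<pi>) \<le> ennreal ((2 * ?C * e) powr p + (2 * (?C * e)) powr p)"
    proof (rule nn_integral_affine_powr_le[OF couplings_prob_space[OF pi wasserstein_spaceD(1)[OF mu(1)]] _ p0])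
      show "(\<lambda>z. mdist paths (fst z) (snd z)) \<in> borel_measurable \<pi>"
        using measurable_mdist_path_metric[OF T0] measurable_cong_sets[OF sets refl] by blast
      fix z assume z: "z \<in> space \<pi>"
      show "0 \<le> mdist inputs (?f (fst z)) (?f' (snd z)) \<and>
         mdist inputs (?f (fst z)) (?f' (snd z)) \<le> ?C * mdist paths (fst z) (snd z) + ?C * e"
        using inverse_solution_map_Lipschitz[OF space[OF z] mu flow] by (simp add: distrib_left)
    qed (use C e0 cost in auto)
    \<comment> \<open>The factor 2 is at most \<open>2 powr p\<close> because p \<ge> 1, and so it
      can be moved inside the power.\<close>
    also have "(2 * ?C * e) powr p + (2 * (?C * e)) powr p = 2 powr 1 * (2 * ?C * e) powr p"
      unfolding mult.assoc by simp
    also have "\<dots> \<le> 2 powr p * (2 * ?C * e) powr p"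
      using p by (intro mult_right_mono powr_mono) auto
    also have "\<dots> = (4 * ?C * e) powr p"
      using C e0 by (subst powr_mult[symmetric]) (auto simp: mult_ac)
    finally have "(\<integral>\<^sup>+z. ennreal (mdist inputs (?f (fst z)) (?f' (snd z)) powr p) \<partial>\<pi>) \<le> ennreal ((4 * ?C * e) powr p)"
      by (simp add: ennreal_leI)
    from wasserstein_dist_distr_le[OF meas p0 _ this]
    show ?thesis
      using couplings_distr(1)[OF pi measurable_inverse_solution_map[OF mu(1)]]
        couplings_distr(2)[OF pi measurable_inverse_solution_map[OF mu(2)]] C e0
      by (simp add: input_law_def)
  qed
  show ?thesis
    using C by (intro le_mult_if_le_mult_greater[OF _ le]) auto
qed

text \<open>The quantity \<open>V\<close> below is the weighted distance of the two flows. The stability estimate bounds it by a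
  multiple of the input distance plus half of itself, and it is finite, so it can be absorbed.\<close>

lemma wasserstein_dist_path_law_le:
  assumes mu: "\<mu> \<in> path_laws" "\<mu>' \<in> path_laws"
  shows "wasserstein_dist p paths \<mu> \<mu>' \<le> exp (5 * L * T) * 10 * wasserstein_dist p inputs (input_law \<mu>) (input_law \<mu>')"
proof -
  let ?BF = "borel_of (mtopology_of paths)" and ?BE = "borel_of (mtopology_of inputs)"
  let ?S = "solution_map T b \<mu>" and ?S' = "solution_map T b \<mu>'"
  let ?\<nu> = "input_law \<mu>" and ?\<nu>' = "input_law \<mu>'"
  have nu: "?\<nu> \<in> input_laws" "?\<nu>' \<in> input_laws"
    using mu by (simp_all add: input_law_in_input_laws)
  have law: "distr ?\<nu> ?BF ?S = \<mu>" "distr ?\<nu>' ?BF ?S' = \<mu>'"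
    using distr_solution_map_iff mu nu by blast+
  define V where "V = (SUP s\<in>{0..T}. exp (- (5 * L * s)) * flow_dist s \<mu> \<mu>')"
  \<comment> \<open>The distance of the path laws bounds the supremum; this finiteness is what
    allows \<open>V\<close> to be absorbed.\<close>
  have bdd: "bdd_above ((\<lambda>s. exp (- (5 * L * s)) * flow_dist s \<mu> \<mu>') ` {0..T})"
  proof (rule bdd_aboveI2)
    fix s assume s: "s \<in> {0..T}"
    have "exp (- (5 * L * s)) * flow_dist s \<mu> \<mu>' \<le> 1 * wasserstein_dist p paths \<mu> \<mu>'"
      using s L wasserstein_dist_time_marginal[OF mu s p0] by (intro mult_mono wasserstein_dist_nonneg) auto
    then show "exp (- (5 * L * s)) * flow_dist s \<mu> \<mu>' \<le> wasserstein_dist p paths \<mu> \<mu>'" by simp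
  qed
  have V: "flow_dist s \<mu> \<mu>' \<le> exp (5 * L * s) * V" if "s \<in> {0..T}" for s
  proof -
    have "flow_dist s \<mu> \<mu>' = exp (5 * L * s) * (exp (- (5 * L * s)) * flow_dist s \<mu> \<mu>')"
      by (simp add: mult.assoc[symmetric] exp_add[symmetric])
    also have "\<dots> \<le> exp (5 * L * s) * V"
      unfolding V_def by (intro mult_left_mono cSUP_upper[OF that bdd]) simp
    finally show ?thesis .
  qed
  have V0: "V \<ge> 0"
    using order_trans[OF wasserstein_dist_nonneg V[of 0]] T0 by simp
  have le: "wasserstein_dist p paths \<mu> \<mu>' \<le> exp (5 * L * T) * 10 * e" if e: "wasserstein_dist p inputs ?\<nu> ?\<nu>' < e" for e
  proof -
    have e0: "e \<ge> 0" using e wasserstein_dist_nonneg[of p inputs ?\<nu> ?\<nu>'] by simp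
    obtain \<pi> where pi: "\<pi> \<in> couplings ?\<nu> ?\<nu>'"
      and cost: "(\<integral>\<^sup>+z. ennreal (mdist inputs (fst z) (snd z) powr p) \<partial>\<pi>) \<le> ennreal (e powr p)"
      using wasserstein_dist_less_coupling[OF nu p0 e] by (auto intro: less_imp_le)
    note sets = couplings_wasserstein_space(1)[OF pi nu]
    note space = couplings_wasserstein_space(2,3)[OF pi nu]
    have meas: "(\<lambda>z. ?S (fst z)) \<in> \<pi> \<rightarrow>\<^sub>M ?BF" "(\<lambda>z. ?S' (snd z)) \<in> \<pi> \<rightarrow>\<^sub>M ?BF"
      using measurable_compose[OF couplingsD(2)[OF pi] measurable_solution_map[OF mu(1) nu(1)]]
        measurable_compose[OF couplingsD(3)[OF pi] measurable_solution_map[OF mu(2) nu(2)]] by auto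
    have distr: "distr \<pi> ?BF (\<lambda>z. ?S (fst z)) = \<mu>" "distr \<pi> ?BF (\<lambda>z. ?S' (snd z)) = \<mu>'"
      using couplings_distr(1)[OF pi measurable_solution_map[OF mu(1) nu(1)]]
        couplings_distr(2)[OF pi measurable_solution_map[OF mu(2) nu(2)]] law by simp_all
    \<comment> \<open>Used twice: for the marginals at time \<open>t\<close> with the weight at
      \<open>t\<close> as \<open>c\<close>, and for whole paths with the weight at \<open>T\<close>.
      Splitting the p-th power doubles 5/2 to 5 and V / 4 to V / 2.\<close>
    have moment: "(\<integral>\<^sup>+z. ennreal (f z powr p) \<partial>\<pi>) \<le> ennreal ((c * K) powr p)"
      if c: "c \<ge> 0" and f: "\<And>z. z \<in> space \<pi> \<Longrightarrow> 0 \<le> f z \<and> f z \<le> c * (5 / 2 * mdist inputs (fst z) (snd z) + V / 4)"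
        and K: "(5 * e) powr p + (V / 2) powr p \<le> K powr p" "K \<ge> 0" for c K f
    proof -
      have "(\<integral>\<^sup>+z. ennreal (f z powr p) \<partial>\<pi>) \<le> ennreal ((2 * (c * (5 / 2)) * e) powr p + (2 * (c * (V / 4))) powr p)"
      proof (rule nn_integral_affine_powr_le[OF couplings_prob_space[OF pi wasserstein_spaceD(1)[OF nu(1)]] _ p0])
        show "(\<lambda>z. mdist inputs (fst z) (snd z)) \<in> borel_measurable \<pi>"
          using measurable_mdist_input_metric[OF T0] measurable_cong_sets[OF sets refl] by blast
        show "0 \<le> f z \<and> f z \<le> c * (5 / 2) * mdist inputs (fst z) (snd z) + c * (V / 4)" if "z \<in> space \<pi>" for z
          using f[OF that] by (simp add: distrib_left mult.assoc)
      qed (use c V0 e0 cost in auto)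
      also have "2 * (c * (5 / 2)) * e = c * (5 * e)" by simp
      also have "2 * (c * (V / 4)) = c * (V / 2)" by simp
      also have "(c * (5 * e)) powr p + (c * (V / 2)) powr p = c powr p * ((5 * e) powr p + (V / 2) powr p)"
        using c e0 V0 powr_mult[of c "5 * e" p] powr_mult[of c "V / 2" p] by (simp only: distrib_left)
      also have "\<dots> \<le> c powr p * K powr p"
        using K by (intro mult_left_mono) auto
      also have "\<dots> = (c * K) powr p"
        using c K by (simp add: powr_mult)
      finally show ?thesis by (simp add: ennreal_leI)
    qed
    have stab: "norm (?S (fst z) t - ?S' (snd z) t) \<le> exp (5 * L * t) * (5 / 2 * mdist inputs (fst z) (snd z) + V / 4)"
      if "z \<in> space \<pi>" "t \<in> {0..T}" for z t
      by (rule solution_map_stability[OF mu space[OF that(1)] V that(2)])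
    define K where "K = ((5 * e) powr p + (V / 2) powr p) powr (1 / p)"
    have K: "(5 * e) powr p + (V / 2) powr p = K powr p" "K \<ge> 0"
      using p0 by (simp_all add: K_def powr_powr)
    have flow: "flow_dist t \<mu> \<mu>' \<le> exp (5 * L * t) * K" if t: "t \<in> {0..T}" for t
    proof -
      have "(\<integral>\<^sup>+z. ennreal (dist (?S (fst z) t) (?S' (snd z) t) powr p) \<partial>\<pi>) \<le> ennreal ((exp (5 * L * t) * K) powr p)"
        using stab[OF _ t] K by (intro moment) (auto simp: dist_norm)
      from wasserstein_dist_time_marginal_le[OF meas t p0 _ this]
      show ?thesis using K by (simp add: distr)
    qed
    \<comment> \<open>Dividing the flow bound by its weight and taking the supremum bounds
      \<open>V\<close> in terms of itself, as \<open>K\<close> contains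
      \<open>V / 2\<close>.\<close>
    have "V \<le> K"
      unfolding V_def
    proof (rule cSUP_least)
      fix s assume s: "s \<in> {0..T}"
      have "exp (- (5 * L * s)) * flow_dist s \<mu> \<mu>' \<le> exp (- (5 * L * s)) * (exp (5 * L * s) * K)"
        by (intro mult_left_mono flow[OF s]) simp
      also have "\<dots> = K" by (simp add: mult.assoc[symmetric] exp_add[symmetric])
      finally show "exp (- (5 * L * s)) * flow_dist s \<mu> \<mu>' \<le> K" .
    qed (use T0 in simp)
    then have "V powr p \<le> (5 * e) powr p + (V / 2) powr p"
      unfolding K(1) using V0 p0 by (intro powr_mono2) auto
    \<comment> \<open>Because p \<ge> 1, halving \<open>V\<close> at least halves its p-th power.
      Hence V^p / 2 \<le> (5 e)^p, and the sum of the two powers is at most 2 (5 e)^p \<le> (10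
      e)^p.\<close>
    moreover have "(V / 2) powr p \<le> V powr p / 2"
    proof -
      have "(V / 2) powr p = V powr p / 2 powr p"
        using V0 by (simp add: powr_divide)
      also have "\<dots> \<le> V powr p / 2 powr 1"
        using p by (intro divide_left_mono powr_mono) auto
      finally show ?thesis by simp
    qed
    ultimately have "(5 * e) powr p + (V / 2) powr p \<le> 2 powr 1 * (5 * e) powr p" by simp
    also have "\<dots> \<le> 2 powr p * (5 * e) powr p"
      using p by (intro mult_right_mono powr_mono) auto
    also have "\<dots> = (10 * e) powr p"
      using e0 by (subst powr_mult[symmetric]) auto
    finally have K10: "(5 * e) powr p + (V / 2) powr p \<le> (10 * e) powr p" .
    have "(\<integral>\<^sup>+z. ennreal (mdist paths (?S (fst z)) (?S' (snd z)) powr p) \<partial>\<pi>) \<le> ennreal ((exp (5 * L * T) * (10 * e)) powr p)"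
    proof (rule moment[OF _ _ K10])
      fix z assume z: "z \<in> space \<pi>"
      have SF: "?S (fst z) \<in> mspace paths" "?S' (snd z) \<in> mspace paths"
        using solution_map(1)[OF mu(1) space(1)[OF z]] solution_map(1)[OF mu(2) space(2)[OF z]] .
      have "mdist paths (?S (fst z)) (?S' (snd z)) \<le> exp (5 * L * T) * (5 / 2 * mdist inputs (fst z) (snd z) + V / 4)"
        unfolding mdist_path_metric_le_iff[OF SF T0]
      proof
        fix t assume t: "t \<in> {0..T}"
        have "dist (?S (fst z) t) (?S' (snd z) t) \<le> exp (5 * L * t) * (5 / 2 * mdist inputs (fst z) (snd z) + V / 4)"
          using stab[OF z t] by (simp add: dist_norm)
        also have "\<dots> \<le> exp (5 * L * T) * (5 / 2 * mdist inputs (fst z) (snd z) + V / 4)"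
          using t L V0 by (intro mult_right_mono) auto
        finally show "dist (?S (fst z) t) (?S' (snd z) t) \<le> exp (5 * L * T) * (5 / 2 * mdist inputs (fst z) (snd z) + V / 4)" .
      qed
      then show "0 \<le> mdist paths (?S (fst z)) (?S' (snd z)) \<and>
          mdist paths (?S (fst z)) (?S' (snd z)) \<le> exp (5 * L * T) * (5 / 2 * mdist inputs (fst z) (snd z) + V / 4)"
        by simp
    qed (use e0 in auto)
    from wasserstein_dist_distr_le[OF meas p0 _ this] show ?thesis
      using e0 by (simp add: distr)
  qed
  show ?thesis
    by (rule le_mult_if_le_mult_greater[OF _ le]) auto
qed

section \<open>\<open>Psi\<close> as the inverse of \<open>input_law\<close>\<close>

text \<open>Distance zero of the path laws makes all distances between their time marginals vanish.
  By stability the two solution maps then agree, and both laws are images of the same input law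
  under the same map.\<close>

lemma input_law_inj:
  assumes mu: "\<mu> \<in> path_laws" "\<mu>' \<in> path_laws" and eq: "input_law \<mu> = input_law \<mu>'"
  shows "\<mu> = \<mu>'"
proof -
  let ?BF = "borel_of (mtopology_of paths)"
  have nu: "input_law \<mu> \<in> input_laws" by (rule input_law_in_input_laws[OF mu(1)])
  have "wasserstein_dist p paths \<mu> \<mu>' \<le> 0"
    using wasserstein_dist_path_law_le[OF mu] wasserstein_dist_self[OF nu p0] eq by simp
  then have "flow_dist s \<mu> \<mu>' \<le> exp (5 * L * s) * 0" if "s \<in> {0..T}" for s
    using wasserstein_dist_time_marginal[OF mu that p0] by simp
  note stab = solution_map_stability[OF mu _ _ this]
  have "solution_map T b \<mu> z = solution_map T b \<mu>' z" if z: "z \<in> mspace inputs" for z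
  proof -
    have "solution_map T b \<mu> z t = solution_map T b \<mu>' z t" if "t \<in> {0..T}" for t
      using stab[OF z z _ that] mdist_self[OF z] by simp
    then show ?thesis
      using solution_map(1)[OF mu(1) z] solution_map(1)[OF mu(2) z]
      by (auto simp: mspace_path_metric intro: extensionalityI)
  qed
  then have "distr (input_law \<mu>) ?BF (solution_map T b \<mu>) = distr (input_law \<mu>') ?BF (solution_map T b \<mu>')"
    using wasserstein_spaceD(3)[OF nu] eq by (intro distr_cong) auto
  then show ?thesis
    using distr_solution_map_iff[OF mu(1) nu] distr_solution_map_iff[OF mu(2) nu] eq by simp
qed

text \<open>Any competing fixed point has the same image under \<open>input_law\<close>, which is
  injective; so the \<open>THE\<close> in \<open>Psi\<close> is well defined.\<close>

lemma Psi_input_law: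
  assumes mu: "\<mu> \<in> path_laws"
  shows "Psi p T b (input_law \<mu>) = \<mu>"
  unfolding Psi_def
proof (rule the_equality)
  show "\<mu> \<in> path_laws \<and> distr (input_law \<mu>) (borel_of (mtopology_of paths)) (solution_map T b \<mu>) = \<mu>"
    using mu distr_solution_map_iff[OF mu input_law_in_input_laws[OF mu]] by simp
  show "\<mu>' = \<mu>" if "\<mu>' \<in> path_laws \<and> distr (input_law \<mu>) (borel_of (mtopology_of paths)) (solution_map T b \<mu>') = \<mu>'" for \<mu>'
    using that distr_solution_map_iff[OF _ input_law_in_input_laws[OF mu], of \<mu>'] input_law_inj[OF _ mu] by blast
qed

lemma input_law_Psi:
  assumes nu: "\<nu> \<in> input_laws"
  shows "Psi p T b \<nu> \<in> path_laws" "input_law (Psi p T b \<nu>) = \<nu>"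
  using input_law_surj[OF nu] Psi_input_law by metis+

lemma inv_into_Psi:
  assumes mu: "\<mu> \<in> path_laws"
  shows "inv_into input_laws (Psi p T b) \<mu> = input_law \<mu>"
proof (rule inv_into_f_eq)
  show "inj_on (Psi p T b) input_laws"
    using input_law_Psi(2) by (intro inj_on_inverseI)
qed (use mu input_law_in_input_laws Psi_input_law in auto)

lemma homeomorphic_maps_Psi:
  "homeomorphic_maps (wasserstein_topology p inputs) (wasserstein_topology p paths) (Psi p T b) input_law"
  unfolding homeomorphic_maps_def
proof (intro conjI)
  show "continuous_map (wasserstein_topology p inputs) (wasserstein_topology p paths) (Psi p T b)"
  proof (rule continuous_map_wasserstein_Lipschitz)
    fix \<nu> \<nu>' assume "\<nu> \<in> input_laws" "\<nu>' \<in> input_laws"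
    then show "wasserstein_dist p paths (Psi p T b \<nu>) (Psi p T b \<nu>') \<le> exp (5 * L * T) * 10 * wasserstein_dist p inputs \<nu> \<nu>'"
      using wasserstein_dist_path_law_le[of "Psi p T b \<nu>" "Psi p T b \<nu>'"] by (simp add: input_law_Psi)
  qed (auto simp: input_law_Psi)
  show "continuous_map (wasserstein_topology p paths) (wasserstein_topology p inputs) input_law"
  proof (rule continuous_map_wasserstein_Lipschitz)
    show "4 * (3 + L * exp T) > 0" using L by (intro mult_pos_pos add_pos_pos) auto
  qed (use wasserstein_dist_input_law_le input_law_in_input_laws in blast)+
qed (auto simp: Psi_input_law input_law_Psi)

section \<open>The particle system at a fixed outcome\<close>

text \<open>Each particle solves the integral equation under the flow of the empirical measure
  itself, so f^\<mu> for this measure sends it to its own input. Drawing the index uniformly gives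
  the statement on laws.\<close>

lemma input_law_empirical_measure:
  assumes N: "N \<ge> 1" and z: "\<And>i. i \<in> {1..N} \<Longrightarrow> (\<zeta> i, W i) \<in> mspace inputs"
    and sol: "particle_system_solution T b N \<zeta> W X"
  shows "empirical_measure (mtopology_of paths) N X \<in> path_laws"
    and "input_law (empirical_measure (mtopology_of paths) N X) = empirical_measure (mtopology_of inputs) N (\<lambda>i. (\<zeta> i, W i))"
proof -
  let ?\<mu> = "empirical_measure (mtopology_of paths) N X"
  have X: "X i \<in> mspace paths" if "i \<in> {1..N}" for i
    using sol that by (auto simp: particle_system_solution_def solves_integral_equation_def)
  show mu: "?\<mu> \<in> path_laws"
    by (rule empirical_measure_in_wasserstein_space[OF N X])
  have inv: "inverse_solution_map T b ?\<mu> (X i) = (\<zeta> i, W i)" if i: "i \<in> {1..N}" for i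
  proof -
    have "solves_integral_equation T (\<lambda>s y. b s y (empirical_measure euclidean N (\<lambda>j. X j s))) (\<zeta> i) (W i) (X i)"
      using sol i by (simp add: particle_system_solution_def)
    \<comment> \<open>Marginals of the empirical measure of paths are empirical measures of
      positions at times in \<open>{0..T}\<close>, and the equation sees only these times.\<close>
    then have "solves_integral_equation T (\<lambda>s y. b s y (time_marginal s ?\<mu>)) (\<zeta> i) (W i) (X i)"
      using time_marginal_empirical_measure[OF N X]
      by (subst solves_integral_equation_cong[where g' = "\<lambda>s y. b s y (empirical_measure euclidean N (\<lambda>j. X j s))"]) auto
    then show ?thesis
      using solves_integral_equation_iff[OF X[OF i] mu z[OF i]] by simp
  qed
  let ?U = "uniform_count_measure {1..N}" and ?BF = "borel_of (mtopology_of paths)" and ?BE = "borel_of (mtopology_of inputs)"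
  have meas: "X \<in> ?U \<rightarrow>\<^sub>M ?BF"
    using X by (intro measurable_uniform_count_measure) simp
  have "input_law ?\<mu> = distr (distr ?U ?BF X) ?BE (inverse_solution_map T b ?\<mu>)"
    unfolding input_law_def using X by (subst empirical_measure_eq_distr[OF N]) auto
  also have "\<dots> = distr ?U ?BE (inverse_solution_map T b ?\<mu> \<circ> X)"
    by (rule distr_distr[OF continuous_map_measurable[OF continuous_map_inverse_solution_map[OF mu]] meas])
  also have "\<dots> = distr ?U ?BE (\<lambda>i. (\<zeta> i, W i))"
    using inv by (intro distr_cong) (auto simp: space_uniform_count_measure)
  also have "\<dots> = empirical_measure (mtopology_of inputs) N (\<lambda>i. (\<zeta> i, W i))"
    using z by (intro empirical_measure_eq_distr[OF N, symmetric]) auto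
  finally show "input_law ?\<mu> = empirical_measure (mtopology_of inputs) N (\<lambda>i. (\<zeta> i, W i))" .
qed

end


section \<open>Large deviations of the particle system\<close>

theorem lemma32:
  fixes T p Kb :: real
    and b :: "real \<Rightarrow> real ^ 'd \<Rightarrow> (real ^ 'd) measure \<Rightarrow> real ^ 'd"
    and a :: "nat \<Rightarrow> real"
    and M :: "nat \<Rightarrow> 'w measure"
    and \<zeta> :: "nat \<Rightarrow> nat \<Rightarrow> 'w \<Rightarrow> real ^ 'd"
    and W X :: "nat \<Rightarrow> nat \<Rightarrow> 'w \<Rightarrow> real \<Rightarrow> real ^ 'd"
    and I :: "((real ^ 'd) \<times> (real \<Rightarrow> real ^ 'd)) measure \<Rightarrow> ennreal"
    and J :: "(real \<Rightarrow> real ^ 'd) measure \<Rightarrow> ennreal"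
  assumes "T > 0" and "p \<ge> 1"
    and "(\<lambda>(t, x, \<mu>). b t x \<mu>) \<in>
      restrict_space borel {0..T} \<Otimes>\<^sub>M borel \<Otimes>\<^sub>M
        borel_of (wasserstein_topology p euclidean_metric) \<rightarrow>\<^sub>M borel"
    and "\<And>t x x' \<mu> \<mu>'. \<lbrakk>t \<in> {0..T}; \<mu> \<in> wasserstein_space p euclidean_metric;
        \<mu>' \<in> wasserstein_space p euclidean_metric\<rbrakk> \<Longrightarrow>
      norm (b t x \<mu> - b t x' \<mu>') powr p
        \<le> Kb * (norm (x - x') powr p + wasserstein_dist p euclidean_metric \<mu> \<mu>' powr p)"
    and "\<And>N. N \<ge> 1 \<Longrightarrow> prob_space (M N)"
    and "\<And>N i. \<lbrakk>N \<ge> 1; i \<in> {1..N}\<rbrakk> \<Longrightarrow>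
      (\<lambda>\<omega>. (\<zeta> N i \<omega>, W N i \<omega>)) \<in> random_variables_Lp p (M N) (input_metric T)"
    and "lower_semicontinuous_in (wasserstein_topology p (input_metric T)) I"
    and "large_deviations_principle (wasserstein_topology p (input_metric T)) a M
      (\<lambda>N \<omega>. empirical_measure (mtopology_of (input_metric T)) N (\<lambda>i. (\<zeta> N i \<omega>, W N i \<omega>))) I"
    and "\<And>N \<omega>. \<lbrakk>N \<ge> 1; \<omega> \<in> space (M N)\<rbrakk> \<Longrightarrow>
      particle_system_solution T b N (\<lambda>i. \<zeta> N i \<omega>) (\<lambda>i. W N i \<omega>) (\<lambda>i. X N i \<omega>)"
    and J_def: "\<And>\<mu>. J \<mu> = I (inv_into (wasserstein_space p (input_metric T)) (Psi p T b) \<mu>)"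
  shows "large_deviations_principle (wasserstein_topology p (path_metric T)) a M
      (\<lambda>N \<omega>. empirical_measure (mtopology_of (path_metric T)) N (\<lambda>i. X N i \<omega>)) J
    \<and> (good_rate_function (wasserstein_topology p (input_metric T)) I \<longrightarrow>
        good_rate_function (wasserstein_topology p (path_metric T)) J)
    \<and> (\<forall>\<mu>\<in>wasserstein_space p (path_metric T).
        J \<mu> = I (distr \<mu> (borel_of (mtopology_of (input_metric T))) (inverse_solution_map T b \<mu>)))"
proof -
  define L where "L = (2 * \<bar>Kb\<bar> + 1) powr (1 / p)"
  have L: "L > 0" by (simp add: L_def)
  have p0: "p > 0" using \<open>p \<ge> 1\<close> by simp
  have Lipschitz: "norm (b t x \<mu> - b t x' \<mu>') \<le> L * (norm (x - x') + wasserstein_dist p euclidean_metric \<mu> \<mu>')"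
    if "t \<in> {0..T}" "\<mu> \<in> wasserstein_space p euclidean_metric" "\<mu>' \<in> wasserstein_space p euclidean_metric" for t x x' \<mu> \<mu>'
    unfolding L_def by (rule le_of_powr_le[OF assms(4)[OF that] _ _ wasserstein_dist_nonneg p0]) auto
  \<comment> \<open>One outcome for the system of a single particle provides a path and a flow along
    which the drift is integrable.\<close>
  obtain \<omega> where \<omega>: "\<omega> \<in> space (M 1)"
    using prob_space.not_empty[OF assms(5)[of 1]] by auto
  define x0 where "x0 = X 1 1 \<omega>"
  define \<mu>0 where "\<mu>0 = empirical_measure (mtopology_of (path_metric T)) 1 (\<lambda>i. X 1 i \<omega>)"
  have sol: "solves_integral_equation T (\<lambda>s y. b s y (empirical_measure euclidean 1 (\<lambda>j. X 1 j \<omega> s))) (\<zeta> 1 1 \<omega>) (W 1 1 \<omega>) x0"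
    using assms(9)[OF _ \<omega>] by (simp add: particle_system_solution_def x0_def)
  then have x0: "x0 \<in> mspace (path_metric T)"
    by (simp add: solves_integral_equation_def)
  have X1: "X 1 i \<omega> \<in> mspace (path_metric T)" if "i \<in> {1..1}" for i
    using x0 that by (simp add: x0_def)
  have mu0: "\<mu>0 \<in> wasserstein_space p (path_metric T)"
    unfolding \<mu>0_def by (rule empirical_measure_in_wasserstein_space[OF _ X1]) auto
  have "set_integrable lborel {0..T} (\<lambda>s. b s (x0 s) (empirical_measure euclidean 1 (\<lambda>j. X 1 j \<omega> s)))"
    using sol by (simp add: solves_integral_equation_def)
  also have "?this \<longleftrightarrow> set_integrable lborel {0..T} (\<lambda>s. b s (x0 s) (time_marginal s \<mu>0))"
    unfolding \<mu>0_def using time_marginal_empirical_measure[OF _ X1] by (intro set_integrable_cong) auto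
  finally have int0: "set_integrable lborel {0..T} (\<lambda>s. b s (x0 s) (time_marginal s \<mu>0))" .
  interpret mean_field_drift T p L b
  proof
    show "set_integrable lborel {0..T} (\<lambda>s. b s (x s) (time_marginal s \<mu>))"
      if "x \<in> mspace (path_metric T)" "\<mu> \<in> wasserstein_space p (path_metric T)" for x \<mu>
      by (rule integrable_drift[OF assms(3) p0 less_imp_le[OF L] Lipschitz that x0 mu0 int0])
  qed (fact \<open>T > 0\<close> \<open>p \<ge> 1\<close> L Lipschitz)+
  let ?Y = "\<lambda>N \<omega>. empirical_measure (mtopology_of inputs) N (\<lambda>i. (\<zeta> N i \<omega>, W N i \<omega>))"
  let ?Y' = "\<lambda>N \<omega>. empirical_measure (mtopology_of paths) N (\<lambda>i. X N i \<omega>)"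
  \<comment> \<open>The identity holds at every outcome, so the empirical law of the particles is a
    continuous image of the measurable empirical law of the inputs.\<close>
  have Psi: "?Y' N \<omega> = Psi p T b (?Y N \<omega>)" if N: "N \<ge> 1" and \<omega>: "\<omega> \<in> space (M N)" for N \<omega>
  proof -
    have "(\<zeta> N i \<omega>, W N i \<omega>) \<in> mspace inputs" if "i \<in> {1..N}" for i
    proof -
      have "(\<lambda>\<omega>. (\<zeta> N i \<omega>, W N i \<omega>)) \<in> M N \<rightarrow>\<^sub>M borel_of (mtopology_of inputs)"
        using assms(6)[OF N that] by (simp add: random_variables_Lp_def)
      from measurable_space[OF this \<omega>] show ?thesis by simp
    qed
    from input_law_empirical_measure[OF N this assms(9)[OF N \<omega>]] show ?thesis
      using Psi_input_law[of "?Y' N \<omega>"] by simp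
  qed
  have J: "J \<mu> = I (input_law \<mu>)" if "\<mu> \<in> path_laws" for \<mu>
    by (simp add: J_def inv_into_Psi[OF that])
  show ?thesis
  proof (intro conjI impI ballI)
    show "large_deviations_principle (wasserstein_topology p paths) a M ?Y' J"
      by (rule large_deviations_principle_homeomorphic[OF assms(8) homeomorphic_maps_Psi Psi]) (auto simp: J)
    show "good_rate_function (wasserstein_topology p paths) J"
      if "good_rate_function (wasserstein_topology p inputs) I"
      by (rule good_rate_function_homeomorphic[OF that homeomorphic_maps_Psi]) (auto simp: J)
    show "J \<mu> = I (distr \<mu> (borel_of (mtopology_of inputs)) (inverse_solution_map T b \<mu>))" if "\<mu> \<in> path_laws" for \<mu>
      using J[OF that] by (simp add: input_law_def)
  qed
qed

end
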